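(* Let $A$ be a finite-dimensional real alternative algebra with unity and a fixed antiinvolution $x\mapsto x^c$, with $\mathbb{S}_A\ne\emptyset$. Let $D\subseteq\mathbb{C}$ be open and let $f=\mathcal{I}(F)$ be a slice function on $\Omega_D$ whose stem function satisfies $F\in C^1(\overline D)$. Let $J\in\mathbb{S}_A$. Assume that $D_J=\Omega_D\cap\mathbb{C}_J$ is a relatively compact open subset of $\mathbb{C}_J$, with boundary $\partial D_J$ piecewise of class $C^1$. Then, for every $x\in\Omega_D$ (in the case in which $A$ is associative) or every $x\in D_J$ (in the case in which $A$ is not associative), the following formula holds: \[f(x)=\frac1{2\pi}\int_{\partial D_J}C_A(x,y)\,J^{-1}dy\,f(y)-\frac1{2\pi}\int_{D_J}C_A(x,y)\,J^{-1}\,dy^c\wedge dy\,\frac{\partial f}{\partial y^c}(y).\]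
   Context: Setting. $A$ is a finite-dimensional real alternative algebra with unity, of real dimension $d>1$ (alternative: the associator $(x,y,z)=(xy)z-x(yz)$ is alternating); $\mathbb{R}$ is identified with $\mathbb{R}\cdot 1\subseteq A$. An antiinvolution $x\mapsto x^c$ is fixed: a linear map with $(x^c)^c=x$, $(xy)^c=y^cx^c$, and $x^c=x$ for $x\in\mathbb{R}$. Put $t(x)=x+x^c$, $n(x)=xx^c$ (elements of $A$, not assumed real). Quadratic cone: $Q_A=\mathbb{R}\cup\{x\in A\mid t(x)\in\mathbb{R},\ n(x)\in\mathbb{R},\ 4n(x)>t(x)^2\}$. $\mathbb{S}_A=\{J\in Q_A\mid J^2=-1\}$, assumed non-empty. For $J\in\mathbb{S}_A$, $\mathbb{C}_J=\langle 1,J\rangle\simeq\mathbb{C}$ (with $J\leftrightarrow i$, and the corresponding orientation); one has $Q_A=\bigcup_{J\in\mathbb{S}_A}\mathbb{C}_J$, and on $\mathbb{C}_J$ the map $y\mapsto y^c$ is complex conjugation. For $y=\alpha+\beta J\in Q_A$, $\mathbb{S}_y=\{\alpha+\beta I\mid I\in\mathbb{S}_A\}$. Slice functions. $A_{\mathbb{C}}=A\otimes_{\mathbb{R}}\mathbb{C}=\{x+iy\mid x,y\in A\}$ with product $(x+iy)(x'+iy')=xx'-yy'+i(xy'+yx')$ and conjugation $\overline{x+iy}=x-iy$. $D\subseteq\mathbb{C}$ is open and, without restriction, invariant under complex conjugation. A stem function on $D$ is $F=F_1+iF_2:D\to A_{\mathbb{C}}$ ($F_1,F_2$ $A$-valued)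 with $F(\bar z)=\overline{F(z)}$. Let $\Omega_D=\{\alpha+\beta J\mid \alpha,\beta\in\mathbb{R},\ \alpha+i\beta\in D,\ J\in\mathbb{S}_A\}$. The slice function $f=\mathcal{I}(F):\Omega_D\to A$ is $f(\alpha+\beta J)=F_1(\alpha+i\beta)+JF_2(\alpha+i\beta)$; if $F\in C^1(\overline D)$, the same formula defines $f$ on the points corresponding to $\overline D$. The function $\partial f/\partial x^c$ is the slice function $\mathcal{I}(\partial F/\partial\bar z)$, where $\partial F/\partial\bar z=\frac12\left(\partial F/\partial\alpha+i\,\partial F/\partial\beta\right)$, $z=\alpha+i\beta$; it is written $\partial f/\partial y^c$ when the variable is $y$. Cauchy kernel. For $y\in Q_A$ put $\Delta_y(z)=z^2-z\,t(y)+n(y)$. For $x\in Q_A\setminus\mathbb{S}_y$, $C_A(x,y)$ is the value at $x$ of the slice function of $x$ induced by the stem function $z\mapsto-\Delta_y(z)^{-1}(z-y^c)$. For $x,y\in\mathbb{C}_J$, $x\neq y,y^c$, one has $C_A(x,y)=(y-x)^{-1}$. The integrands are read as $(C_A(x,y)J^{-1}dy)f(y)$, and similarly for the area integral. *)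

theory Defs
  imports "HOL-Analysis.Analysis"
begin

text \<open>
  Alternative algebras need not be associative, so \<^class>\<open>real_algebra_1\<close> is too strong. The
  superclass \<^class>\<open>euclidean_space\<close> serves only to provide a finite-dimensional real vector space
  with its canonical topology; the inner product is unrelated to the multiplication.
\<close>

class alternative_star_algebra = euclidean_space + one + times +
  fixes star :: "'a \<Rightarrow> 'a"
  assumes distrib_mult_left: "x * (y + z) = x * y + x * z"
    and distrib_mult_right: "(x + y) * z = x * z + y * z"
    and scaleR_mult_left: "(r *\<^sub>R x) * y = r *\<^sub>R (x * y)"
    and scaleR_mult_right: "x * (r *\<^sub>R y) = r *\<^sub>R (x * y)"
    and unit_left: "1 * x = x"
    and unit_right: "x * 1 = x"
    and left_alternative: "(x * x) * y = x * (x * y)"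
    and right_alternative: "(x * y) * y = x * (y * y)"
    and flexible: "(x * y) * x = x * (y * x)"
    and star_add: "star (x + y) = star x + star y"
    and star_scaleR: "star (r *\<^sub>R x) = r *\<^sub>R star x"
    and star_star: "star (star x) = x"
    and star_mult: "star (x * y) = star y * star x"
    and star_real: "star (r *\<^sub>R 1) = r *\<^sub>R 1"

definition alg_trace :: "'a::alternative_star_algebra \<Rightarrow> 'a"
  where "alg_trace x = x + star x"

definition alg_norm :: "'a::alternative_star_algebra \<Rightarrow> 'a"
  where "alg_norm x = x * star x"

definition quadratic_cone :: "'a::alternative_star_algebra set"
  where "quadratic_cone = range (\<lambda>r::real. r *\<^sub>R 1) \<union>
    {x. \<exists>t n::real. alg_trace x = t *\<^sub>R 1 \<and> alg_norm x = n *\<^sub>R 1 \<and> 4 * n > t\<^sup>2}"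

definition imag_units :: "'a::alternative_star_algebra set"
  where "imag_units = {J \<in> quadratic_cone. J * J = - 1}"

definition complex_line :: "'a::alternative_star_algebra \<Rightarrow> 'a set"
  where "complex_line J = span {1, J}"

definition line_embed :: "'a::alternative_star_algebra \<Rightarrow> complex \<Rightarrow> 'a"
  where "line_embed J z = Re z *\<^sub>R 1 + Im z *\<^sub>R J"

definition circularization :: "complex set \<Rightarrow> 'a::alternative_star_algebra set"
  where "circularization D = {line_embed J z |J z. J \<in> imag_units \<and> z \<in> D}"

definition slice_domain :: "complex set \<Rightarrow> 'a::alternative_star_algebra \<Rightarrow> 'a set"
  where "slice_domain D J = circularization D \<inter> complex_line J"

text \<open>
  The two-sided inverse with respect to a multiplication and a unit. It is only applied where the
  inverse exists and is unique.
\<close>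

definition inverse_wrt :: "('b \<Rightarrow> 'b \<Rightarrow> 'b) \<Rightarrow> 'b \<Rightarrow> 'b \<Rightarrow> 'b"
  where "inverse_wrt mul e w = (THE v. mul w v = e \<and> mul v w = e)"

text \<open>
  The complexified algebra consists of the pairs \<open>(x, y)\<close>, standing for \<open>x + iy\<close>.
\<close>

type_synonym 'a complexified = "'a \<times> 'a"

definition cx_mult ::
    "'a::alternative_star_algebra complexified \<Rightarrow> 'a complexified \<Rightarrow> 'a complexified"
  where "cx_mult v w = (fst v * fst w - snd v * snd w, fst v * snd w + snd v * fst w)"

definition cx_conj :: "'a::alternative_star_algebra complexified \<Rightarrow> 'a complexified"
  where "cx_conj w = (fst w, - snd w)"

definition cx_of_alg :: "'a::alternative_star_algebra \<Rightarrow> 'a complexified"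
  where "cx_of_alg x = (x, 0)"

definition cx_of_complex :: "complex \<Rightarrow> 'a::alternative_star_algebra complexified"
  where "cx_of_complex z = (Re z *\<^sub>R 1, Im z *\<^sub>R 1)"

definition stem_function_on ::
    "complex set \<Rightarrow> (complex \<Rightarrow> 'a::alternative_star_algebra complexified) \<Rightarrow> bool"
  where "stem_function_on D F \<longleftrightarrow> (\<forall>z\<in>D. cnj z \<in> D \<and> F (cnj z) = cx_conj (F z))"

text \<open>
  A point \<open>x\<close> has several representations \<open>\<alpha> + \<beta>J\<close>, but the value below does not depend on the
  choice when \<open>F\<close> satisfies the symmetry of a stem function at the points involved. The value is
  meaningful only at points corresponding to the domain of the stem function.
\<close>

definition slice_function ::
    "(complex \<Rightarrow> 'a::alternative_star_algebra complexified) \<Rightarrow> 'a \<Rightarrow> 'a"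
  where "slice_function F x =
    (THE v. \<exists>J z. J \<in> imag_units \<and> x = line_embed J z \<and> v = fst (F z) + J * snd (F z))"

text \<open>
  Class \<open>C\<^sup>1\<close> up to the boundary: \<open>F\<close> is continuous on the closure of the open set \<open>D\<close>, of class
  \<open>C\<^sup>1\<close> in \<open>D\<close>, and its partial derivatives extend continuously to the closure. No extension of
  \<open>F\<close> to a neighbourhood of the closure is required.
\<close>

definition C1_on_closure :: "complex set \<Rightarrow> (complex \<Rightarrow> 'b::real_normed_vector) \<Rightarrow> bool"
  where "C1_on_closure D F \<longleftrightarrow> continuous_on (closure D) F \<and>
    (\<exists>P Q. continuous_on (closure D) P \<and> continuous_on (closure D) Q \<and>
      (\<forall>z\<in>D. (F has_derivative (\<lambda>h. Re h *\<^sub>R P z + Im h *\<^sub>R Q z)) (at z)))"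

definition stem_dbar ::
    "(complex \<Rightarrow> 'a::alternative_star_algebra complexified) \<Rightarrow> complex \<Rightarrow> 'a complexified"
  where "stem_dbar F z = (1 / 2) *\<^sub>R
    (vector_derivative (\<lambda>t. F (z + of_real t)) (at 0) +
     cx_mult (cx_of_complex \<i>) (vector_derivative (\<lambda>t. F (z + \<i> * of_real t)) (at 0)))"

definition slice_dbar ::
    "(complex \<Rightarrow> 'a::alternative_star_algebra complexified) \<Rightarrow> 'a \<Rightarrow> 'a"
  where "slice_dbar F = slice_function (stem_dbar F)"

definition delta_stem :: "'a::alternative_star_algebra \<Rightarrow> complex \<Rightarrow> 'a complexified"
  where "delta_stem y z =
    cx_mult (cx_of_complex z) (cx_of_complex z)
    - cx_mult (cx_of_complex z) (cx_of_alg (alg_trace y))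
    + cx_of_alg (alg_norm y)"

definition cauchy_kernel :: "'a::alternative_star_algebra \<Rightarrow> 'a \<Rightarrow> 'a"
  where "cauchy_kernel x y = slice_function
    (\<lambda>z. - cx_mult (inverse_wrt cx_mult (cx_of_complex 1) (delta_stem y z))
                   (cx_of_complex z - cx_of_alg (star y))) x"

text \<open>
  \<open>\<Gamma>\<close> is a parametrization of the boundary of \<open>U\<close> relative to the plane \<open>complex_line J\<close> by finitely
  many regular simple arcs or simple closed curves of class \<open>C\<^sup>1\<close> on \<open>[0, 1]\<close> (with one-sided
  derivatives at the end points), which meet at most at their end points. Along each of them
  \<open>U\<close> lies locally on the left and its complement on the right; the left normal is \<open>J * \<gamma>'\<close>, as
  \<open>J\<close> corresponds to the imaginary unit. Thus \<open>\<Gamma>\<close> carries the boundary orientation.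
\<close>

definition piecewise_C1_boundary ::
    "'a::alternative_star_algebra \<Rightarrow> 'a set \<Rightarrow> (real \<Rightarrow> 'a) set \<Rightarrow> bool"
  where "piecewise_C1_boundary J U \<Gamma> \<longleftrightarrow>
    finite \<Gamma> \<and>
    (\<Union>\<gamma>\<in>\<Gamma>. path_image \<gamma>) = top_of_set (complex_line J) frontier_of U \<and>
    pairwise (\<lambda>\<gamma> \<delta>. \<gamma> ` {0<..<1} \<inter> path_image \<delta> = {}) \<Gamma> \<and>
    (\<forall>\<gamma>\<in>\<Gamma>. simple_path \<gamma> \<and>
      (\<exists>\<gamma>'. continuous_on {0..1} \<gamma>' \<and>
        (\<forall>t\<in>{0..1}. (\<gamma> has_vector_derivative \<gamma>' t) (at t within {0..1}) \<and> \<gamma>' t \<noteq> 0) \<and>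
        (\<forall>t\<in>{0<..<1}. \<forall>\<^sub>F s in at_right 0.
          \<gamma> t + s *\<^sub>R (J * \<gamma>' t) \<in> U \<and> \<gamma> t - s *\<^sub>R (J * \<gamma>' t) \<notin> U)))"

definition boundary_integrand ::
    "'a::alternative_star_algebra \<Rightarrow> ('a \<Rightarrow> 'a) \<Rightarrow> 'a \<Rightarrow> (real \<Rightarrow> 'a) \<Rightarrow> real \<Rightarrow> 'a"
  where "boundary_integrand J f x \<gamma> t =
    ((cauchy_kernel x (\<gamma> t) * inverse_wrt (*) 1 J) * vector_derivative \<gamma> (at t within {0..1}))
      * f (\<gamma> t)"

text \<open>
  The value of the 2-form \<open>dy\<^sup>c \<and> dy\<close> on a pair of tangent vectors. In the coordinates
  \<open>y = \<alpha> + \<beta>J\<close> the form is its value on \<open>(1, J)\<close> times \<open>d\<alpha> \<and> d\<beta>\<close>.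
\<close>

definition wedge_star :: "'a::alternative_star_algebra \<Rightarrow> 'a \<Rightarrow> 'a"
  where "wedge_star u v = star u * v - star v * u"

definition area_integrand ::
    "'a::alternative_star_algebra \<Rightarrow> ('a \<Rightarrow> 'a) \<Rightarrow> 'a \<Rightarrow> complex \<Rightarrow> 'a"
  where "area_integrand J g x z =
    ((cauchy_kernel x (line_embed J z) * inverse_wrt (*) 1 J) * wedge_star 1 J)
      * g (line_embed J z)"

end

theory Submission
  imports Defs
begin

text \<open>
  Left multiplication by \<open>J\<close> makes the algebra a complex vector space, by left alternativity alone.
  On \<open>complex_line J\<close> the kernel is \<open>(y - x)\<^sup>-\<^sup>1\<close>, so for \<open>x\<close> on this line the claim is the
  Cauchy-Pompeiu formula for the vector valued function \<open>g = F\<^sub>1 + J F\<^sub>2\<close> on \<open>D\<close>. In the associative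
  case the representation formula expresses the kernel and \<open>f\<close> at \<open>\<alpha> + \<beta>I\<close> through their values at
  \<open>\<alpha> \<plusminus> \<beta>J\<close>, which reduces every \<open>x\<close> to this situation.

  Cauchy-Pompeiu follows from Green's theorem, which is proved by slicing. On almost every horizontal
  line the boundary curves are crossed transversally, finitely often and away from their end points, so
  \<open>\<integral> \<partial>u/\<partial>x dx\<close> over the slice is the sum of \<open>\<plusminus>u\<close> over the crossings; integrating over the lines and
  applying the one-dimensional area formula to the ordinate of the curves yields \<open>\<integral> u dy\<close> along the
  boundary. Corners and cusps only affect finitely many lines. Green's theorem is applied to \<open>K g\<close>,
  where \<open>K \<zeta> = cnj \<zeta> / max (\<bar>\<zeta>\<bar>, \<epsilon>)\<^sup>2\<close> agrees with \<open>1 / \<zeta>\<close> off the \<open>\<epsilon>\<close>-disc and has constant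
  \<open>\<partial>K/\<partial>cnj \<zeta> = 1 / \<epsilon>\<^sup>2\<close> inside, and then \<open>\<epsilon>\<close> tends to 0.
\<close>

subsection \<open>The one-dimensional area formula\<close>

text \<open>The boundary hypotheses are pointwise: at an interior parameter only the normal
  direction is known to separate \<open>D\<close> from its complement, and corners or cusps are
  unrestricted. Local graphs and winding numbers are thus not at hand. Slicing asks only for the two
  sides of a transversal crossing, and Sard's theorem makes almost every line transversal. Excising
  a disc around the pole would create a new domain with an additional boundary curve. The truncated
  kernel is continuous on the whole plane instead, so Green's theorem applies to \<open>D\<close>
  itself; differentiability is in doubt only on a circle, which a line meets at most twice. The disc
  contributes \<open>1 / \<epsilon>^2\<close> times its area, doubled because \<open>P + J Q\<close>
  is twice the dbar derivative: hence \<open>2 * pi\<close>. Without associativity the brackets are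
  moved only through \<open>(a * b) * v = a * (b * v)\<close> for \<open>a\<close>, \<open>b\<close>
  in the plane of \<open>J\<close>. Off that plane, right multiplication has to commute with the
  left factors \<open>(1 - I * J) / 2\<close> and \<open>(1 + I * J) / 2\<close>; this is why the
  range of \<open>x\<close> depends on associativity.\<close>

lemma negligible_critical_values:
  fixes f :: "real \<Rightarrow> real"
  assumes "\<And>x. x \<in> S \<Longrightarrow> (f has_field_derivative 0) (at x within S)"
  shows "negligible (f ` S)"
proof -
  \<comment> \<open>\<open>baby_Sard\<close> concerns maps between Cartesian powers of the reals, so
    \<open>f\<close> is conjugated by the identification of \<open>real\<close> with
    \<open>real^1\<close>; a zero derivative has rank 0 < 1.\<close>
  let ?lift = "vec :: real \<Rightarrow> real^1"
  let ?drop = "(\<lambda>x::real^1. x $ 1)"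
  have der: "(?lift \<circ> f \<circ> ?drop has_derivative (\<lambda>_. 0)) (at x within ?lift ` S)"
    if x: "x \<in> ?lift ` S" for x
  proof -
    obtain z where z: "z \<in> S" "x = vec z" using x by blast
    have "(f has_vector_derivative 0) (at z within S)"
      using assms[OF z(1)] has_real_derivative_iff_has_vector_derivative by blast
    then have "((\<lambda>x. vec (f (x $ 1))) has_derivative (*\<^sub>R) 0) (at (vec z) within ?lift ` S)"
      using has_derivative_vector_1[of f "\<lambda>_. 0" z S] by (simp add: has_vector_derivative_def)
    moreover have "(*\<^sub>R) 0 = (\<lambda>_ :: real^1. 0 :: real^1)" by auto
    ultimately show ?thesis using z by (simp add: o_def)
  qed
  have "negligible ((?lift \<circ> f \<circ> ?drop) ` (?lift ` S))"
  proof (rule baby_Sard[OF _ der])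
    show "rank (matrix (\<lambda>_. 0 :: real^1) :: real^1^1) < CARD(1)"
      by (simp add: matrix_def) (simp add: zero_vec_def[symmetric])
  qed auto
  then have "negligible (?drop ` (?lift \<circ> f \<circ> ?drop) ` (?lift ` S))"
    by (rule negligible_differentiable_image_negligible[rotated])
       (auto intro!: linear_imp_differentiable_on simp: linear_iff)
  also have "?drop ` (?lift \<circ> f \<circ> ?drop) ` (?lift ` S) = f ` S"
    by (auto simp: image_image o_def)
  finally show ?thesis .
qed

lemma inj_on_deriv_nonzero_interval:
  fixes f :: "real \<Rightarrow> real"
  assumes der: "\<And>x. x \<in> {a<..<b} \<Longrightarrow> (f has_field_derivative f' x) (at x)"
    and nz: "\<And>x. x \<in> {a<..<b} \<Longrightarrow> f' x \<noteq> 0"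
  shows "inj_on f {a<..<b}"
proof -
  have False if "x \<in> {a<..<b}" "y \<in> {a<..<b}" "f x = f y" "x < y" for x y
  proof -
    have "continuous_on {x..y} f"
      using that der by (meson DERIV_isCont continuous_at_imp_continuous_on atLeastAtMost_iff
          greaterThanLessThan_iff less_le_trans le_less_trans)
    moreover have "f differentiable (at z)" if "x < z" "z < y" for z
      using der[of z] that \<open>x \<in> _\<close> \<open>y \<in> _\<close> real_differentiable_def by force
    ultimately obtain z where z: "x < z" "z < y" "DERIV f z :> 0"
      using Rolle[OF \<open>x < y\<close> \<open>f x = f y\<close>] by blast
    with der[of z] nz[of z] that show False
      using DERIV_unique by force
  qed
  then show ?thesis
    by (metis inj_on_def linorder_neqE_linordered_idom)
qed

text \<open>An infinite level set accumulates in the compact interval at one of its own points,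
  where the difference quotients taken along the level set vanish and force \<open>\<eta>'\<close>
  to be 0.\<close>

lemma finite_regular_level_set:
  fixes \<eta> \<eta>' :: "real \<Rightarrow> real"
  assumes cont: "continuous_on {0..1} \<eta>"
    and der: "\<And>t. t \<in> {0..1} \<Longrightarrow> (\<eta> has_field_derivative \<eta>' t) (at t within {0..1})"
    and nz: "\<And>t. t \<in> {0..1} \<Longrightarrow> \<eta> t = y \<Longrightarrow> \<eta>' t \<noteq> 0"
  shows "finite {t \<in> {0..1}. \<eta> t = y}"
proof (rule ccontr)
  let ?T = "{t \<in> {0..1}. \<eta> t = y}"
  assume inf: "infinite ?T"
  have cl: "closed ?T"
    using continuous_closed_preimage_constant[OF cont, of y] by auto
  have "?T \<subseteq> {0..1}" by auto
  then obtain t where t: "t \<in> {0..1}" "t islimpt ?T"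
    using Heine_Borel_imp_Bolzano_Weierstrass[OF compact_Icc[of 0 1] inf] by blast
  then have tT: "t \<in> ?T" using cl closed_limpt by blast
  have lim: "((\<lambda>s. (\<eta> s - \<eta> t) / (s - t)) \<longlongrightarrow> \<eta>' t) (at t within {0..1})"
    using der[OF t(1)] by (simp add: has_field_derivative_iff)
  have "at t within ?T \<noteq> bot"
    using t(2) trivial_limit_within by blast
  moreover have lim': "((\<lambda>s. (\<eta> s - \<eta> t) / (s - t)) \<longlongrightarrow> \<eta>' t) (at t within ?T)"
    by (rule tendsto_within_subset[OF lim]) auto
  moreover have "((\<lambda>s. (\<eta> s - \<eta> t) / (s - t)) \<longlongrightarrow> 0) (at t within ?T)"
    by (rule tendsto_eventually) (use tT in \<open>auto simp: eventually_at_filter\<close>)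
  ultimately have "\<eta>' t = 0"
    using tendsto_unique by blast
  with nz tT show False by auto
qed

text \<open>The pieces serve as domains on which a function with nonzero derivative is injective.
  Disjointness costs them the interval shape, but an enclosing interval inside \<open>W\<close> is
  all that Rolle's theorem asks for.\<close>

lemma open_real_disjoint_interval_pieces:
  fixes W :: "real set"
  assumes "open W"
  obtains A :: "nat \<Rightarrow> real set" where "disjoint_family A" "(\<Union>n. A n) = W"
    "\<And>n. A n \<in> sets borel" "\<And>n. \<exists>a b. A n \<subseteq> {a<..<b} \<and> {a<..<b} \<subseteq> W"
proof -
  obtain \<D> where D: "countable \<D>" "\<D> \<subseteq> Pow W" "\<And>X. X \<in> \<D> \<Longrightarrow> \<exists>a b. X = box a b" "\<Union>\<D> = W"
    using open_countable_Union_open_box[OF assms] by metis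
  \<comment> \<open>The empty set is added because the cover may be empty, whereas an enumeration by
    all naturals needs a nonempty set.\<close>
  define B where "B = from_nat_into (insert {} \<D>)"
  have rB: "range B = insert {} \<D>"
    unfolding B_def using D(1) by (intro range_from_nat_into) auto
  have B: "\<exists>a b. B n = {a<..<b} \<and> {a<..<b} \<subseteq> W" for n
  proof -
    have "B n \<in> insert {} \<D>" using rB by blast
    then show ?thesis
    proof
      assume "B n = {}"
      then have "B n = {0<..<0} \<and> {0<..<0} \<subseteq> W" by simp
      then show ?thesis by blast
    next
      assume n: "B n \<in> \<D>"
      then obtain a b where "B n = box a b" using D(3) by blast
      moreover have "B n \<subseteq> W" using n D(2) by blast
      ultimately show ?thesis by (auto simp: box_real)
    qed
  qed
  show ?thesis
  proof
    show "disjoint_family (disjointed B)" by (rule disjoint_family_disjointed)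
    have "(\<Union>n. B n) = \<Union>(insert {} \<D>)" using rB by metis
    then show "(\<Union>n. disjointed B n) = W" using D(4) by (simp add: UN_disjointed_eq)
    have "range B \<subseteq> sets borel"
      using B by (metis borel_open image_subset_iff open_greaterThanLessThan)
    then have "range (disjointed B) \<subseteq> sets borel"
      by (rule sets.range_disjointed_sets)
    then show "disjointed B n \<in> sets borel" for n by blast
    show "\<exists>a b. disjointed B n \<subseteq> {a<..<b} \<and> {a<..<b} \<subseteq> W" for n
      using B[of n] disjointed_subset[of B n] by metis
  qed
qed

text \<open>The integrand is given on the parameter side, as values along a curve; injectivity
  rewrites it as a function of \<open>\<eta> t\<close>, the form in which change of variables
  applies.\<close>

lemma set_lebesgue_change_of_variables_inj:
  fixes k :: "real \<Rightarrow> 'b::euclidean_space" and \<eta> \<eta>' :: "real \<Rightarrow> real"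
  assumes A: "A \<in> sets lebesgue"
    and der: "\<And>t. t \<in> A \<Longrightarrow> (\<eta> has_field_derivative \<eta>' t) (at t within A)"
    and inj: "inj_on \<eta> A"
    and int: "set_integrable lebesgue A (\<lambda>t. \<bar>\<eta>' t\<bar> *\<^sub>R k t)"
  shows "set_integrable lebesgue (\<eta> ` A) (\<lambda>y. k (inv_into A \<eta> y))" (is ?i)
    and "(LINT y:\<eta> ` A|lebesgue. k (inv_into A \<eta> y)) = (LINT t:A|lebesgue. \<bar>\<eta>' t\<bar> *\<^sub>R k t)"
      (is ?e)
proof -
  let ?g = "\<lambda>y. k (inv_into A \<eta> y)"
  have eq: "\<bar>\<eta>' t\<bar> *\<^sub>R ?g (\<eta> t) = \<bar>\<eta>' t\<bar> *\<^sub>R k t" if "t \<in> A" for t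
    using inj that by simp
  have 1: "set_integrable lebesgue A (\<lambda>t. \<bar>\<eta>' t\<bar> *\<^sub>R ?g (\<eta> t))"
    by (rule iffD2[OF set_integrable_cong[OF refl refl eq] int])
  have 2: "integral A (\<lambda>t. \<bar>\<eta>' t\<bar> *\<^sub>R ?g (\<eta> t)) = integral A (\<lambda>t. \<bar>\<eta>' t\<bar> *\<^sub>R k t)"
    by (rule integral_cong) (use eq in auto)
  from iffD1[OF has_absolute_integral_change_of_variables_real[OF A der inj, of ?g] conjI[OF 1 2]]
  have 3: "set_integrable lebesgue (\<eta> ` A) ?g"
    "integral (\<eta> ` A) ?g = integral A (\<lambda>t. \<bar>\<eta>' t\<bar> *\<^sub>R k t)" by simp_all
  show ?i by fact
  show ?e
    using 3 int by (simp add: set_lebesgue_integral_eq_integral(2))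
qed

text \<open>Partial sums are integrals over finite disjoint unions, bounded by the integral over the
  whole union. Applied to norms, this licenses the exchange of sum and integral.\<close>

lemma summable_set_integral_disjoint:
  fixes k :: "'a \<Rightarrow> real"
  assumes "\<And>n::nat. A n \<in> sets M" "disjoint_family A" "set_integrable M (\<Union>n. A n) k"
    and nonneg: "\<And>x. 0 \<le> k x"
  shows "summable (\<lambda>n. (LINT x:A n|M. k x))"
proof (rule bounded_imp_summable)
  have int: "set_integrable M (A n) k" for n
    by (rule set_integrable_subset[OF assms(3)]) (use assms(1) in auto)
  show "0 \<le> (LINT x:A n|M. k x)" for n
    unfolding set_lebesgue_integral_def by (rule integral_nonneg_AE) (use nonneg in auto)
  fix n
  have "(\<Sum>i\<le>n. (LINT x:A i|M. k x)) = (LINT x|M. (\<Sum>i\<le>n. indicator (A i) x *\<^sub>R k x))"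
    unfolding set_lebesgue_integral_def
    by (rule Bochner_Integration.integral_sum[symmetric]) (use int in \<open>simp add: set_integrable_def\<close>)
  also have "\<dots> \<le> (LINT x:(\<Union>n. A n)|M. k x)"
    unfolding set_lebesgue_integral_def
  proof (rule integral_mono)
    show "integrable M (\<lambda>x. \<Sum>i\<le>n. indicator (A i) x *\<^sub>R k x)"
      using int by (intro Bochner_Integration.integrable_sum) (simp add: set_integrable_def)
    show "integrable M (\<lambda>x. indicator (\<Union>n. A n) x *\<^sub>R k x)"
      using assms(3) by (simp add: set_integrable_def)
    fix x
    have "(\<Sum>i\<le>n. indicat_real (A i) x) = indicator (\<Union>i\<le>n. A i) x"
      by (rule indicator_UN_disjoint[symmetric])
        (use assms(2) in \<open>auto intro: disjoint_family_on_mono\<close>)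
    also have "\<dots> \<le> indicator (\<Union>n. A n) x"
      by (auto simp: indicator_def)
    finally show "(\<Sum>i\<le>n. indicator (A i) x *\<^sub>R k x) \<le> indicator (\<Union>n. A n) x *\<^sub>R k x"
      using nonneg by (simp add: sum_distrib_right[symmetric] mult_right_mono)
  qed
  finally show "(\<Sum>i\<le>n. (LINT x:A i|M. k x)) \<le> (LINT x:(\<Union>n. A n)|M. k x)" .
qed

lemma AE_regular_value:
  fixes \<eta> \<eta>' :: "real \<Rightarrow> real"
  assumes der: "\<And>t. t \<in> {0..1} \<Longrightarrow> (\<eta> has_field_derivative \<eta>' t) (at t within {0..1})"
  shows "AE y in lebesgue. \<eta> 0 \<noteq> y \<and> \<eta> 1 \<noteq> y \<and>
    finite {t \<in> {0<..<1}. \<eta> t = y} \<and> (\<forall>t\<in>{0<..<1}. \<eta> t = y \<longrightarrow> \<eta>' t \<noteq> 0)"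
proof -
  have cont: "continuous_on {0..1} \<eta>"
    using der DERIV_continuous_on by blast
  \<comment> \<open>Excluded are the two end values and the critical values, a null set by Sard;
    every other level is regular, hence finite.\<close>
  let ?N = "insert (\<eta> 0) (insert (\<eta> 1) (\<eta> ` {t \<in> {0..1}. \<eta>' t = 0}))"
  have "(\<eta> has_field_derivative 0) (at t within {t \<in> {0..1}. \<eta>' t = 0})"
    if "t \<in> {t \<in> {0..1}. \<eta>' t = 0}" for t
    using der[of t] that by (auto intro: DERIV_subset)
  then have "negligible (\<eta> ` {t \<in> {0..1}. \<eta>' t = 0})"
    by (rule negligible_critical_values)
  then have "?N \<in> null_sets lebesgue"
    by (simp only: negligible_iff_null_sets[symmetric] negligible_insert)
  then have "AE y in lebesgue. y \<notin> ?N" by (rule AE_not_in)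
  then show ?thesis
  proof eventually_elim
    case (elim y)
    then have nz: "\<eta>' t \<noteq> 0" if "t \<in> {0..1}" "\<eta> t = y" for t
      using that by blast
    have "finite {t \<in> {0..1}. \<eta> t = y}"
      by (rule finite_regular_level_set[OF cont der nz])
    then have "finite {t \<in> {0<..<1}. \<eta> t = y}"
      by (rule rev_finite_subset) auto
    with nz elim show ?case by auto
  qed
qed

text \<open>On each injectivity piece the substitution \<open>y = \<eta> t\<close> turns the
  parameter integral into an integral over values, and summing the pieces counts every regular
  crossing once. \<open>S\<close> is the sum of this series, a representative whose integrability
  comes with the construction.\<close>

lemma signed_area_formula:
  fixes \<phi> :: "real \<Rightarrow> 'b::euclidean_space" and \<eta> \<eta>' :: "real \<Rightarrow> real"
  assumes der: "\<And>t. t \<in> {0..1} \<Longrightarrow> (\<eta> has_field_derivative \<eta>' t) (at t within {0..1})"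
    and cont': "continuous_on {0..1} \<eta>'" and contphi: "continuous_on {0..1} \<phi>"
  obtains S where "integrable lebesgue S"
    "AE y in lebesgue. S y = (\<Sum>t | t \<in> {0<..<1} \<and> \<eta> t = y. sgn (\<eta>' t) *\<^sub>R \<phi> t)"
    "integral\<^sup>L lebesgue S = integral {0..1} (\<lambda>t. \<eta>' t *\<^sub>R \<phi> t)"
proof -
  \<comment> \<open>Points with \<open>\<eta>' t = 0\<close> contribute nothing to the parameter
    integral, so only \<open>W\<close> has to be cut into pieces.\<close>
  define W where "W = {t \<in> {0<..<1}. \<eta>' t \<noteq> 0}"
  have "openin (top_of_set {0<..<1}) ({0<..<1} \<inter> \<eta>' -` (- {0}))"
    by (rule continuous_openin_preimage_gen[OF continuous_on_subset[OF cont']]) auto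
  also have "{0<..<1} \<inter> \<eta>' -` (- {0}) = W" by (auto simp: W_def)
  finally have openW: "open W"
    using openin_open_trans open_greaterThanLessThan by blast
  obtain A :: "nat \<Rightarrow> real set" where disj: "disjoint_family A" and UA: "(\<Union>n. A n) = W"
    and Ab: "\<And>n. A n \<in> sets borel" and Aint: "\<And>n. \<exists>a b. A n \<subseteq> {a<..<b} \<and> {a<..<b} \<subseteq> W"
    using open_real_disjoint_interval_pieces[OF openW] by blast
  have AW: "A n \<subseteq> W" for n using UA by blast
  have Al: "A n \<in> sets lebesgue" for n using Ab[of n] by simp
  have derW: "(\<eta> has_field_derivative \<eta>' t) (at t)" if "t \<in> W" for t
  proof -
    have "t \<in> {0<..<1}" "t \<in> {0..1}" using that by (auto simp: W_def)
    then show ?thesis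
      using der[of t] at_within_Icc_at[of 0 t 1] by simp
  qed
  have inj: "inj_on \<eta> (A n)" for n
  proof -
    obtain a b where ab: "A n \<subseteq> {a<..<b}" "{a<..<b} \<subseteq> W" using Aint by blast
    have "inj_on \<eta> {a<..<b}"
      by (rule inj_on_deriv_nonzero_interval[of a b \<eta> \<eta>']) (use ab derW in \<open>auto simp: W_def\<close>)
    then show ?thesis using ab(1) inj_on_subset by blast
  qed
  \<comment> \<open>Change of variables produces the absolute value of \<open>\<eta>'\<close>; the
    sign is moved into the integrand.\<close>
  define h where "h t = sgn (\<eta>' t) *\<^sub>R \<phi> t" for t
  have h: "\<bar>\<eta>' t\<bar> *\<^sub>R h t = \<eta>' t *\<^sub>R \<phi> t" for t
    by (simp add: h_def abs_mult_sgn)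
  have hn: "\<bar>\<eta>' t\<bar> *\<^sub>R norm (h t) = norm (\<eta>' t *\<^sub>R \<phi> t)" for t
    by (cases "\<eta>' t = 0") (auto simp: h_def abs_sgn_eq)
  have int: "set_integrable lebesgue {0..1} (\<lambda>t. \<eta>' t *\<^sub>R \<phi> t)"
    by (intro absolutely_integrable_continuous_real continuous_intros cont' contphi)
  then have intn: "set_integrable lebesgue {0..1} (\<lambda>t. norm (\<eta>' t *\<^sub>R \<phi> t))"
    by (rule set_integrable_norm)
  have W01: "W \<subseteq> {0..1}" and Wl: "W \<in> sets lebesgue"
    using openW by (auto simp: W_def)
  have intW: "set_integrable lebesgue W (\<lambda>t. \<eta>' t *\<^sub>R \<phi> t)"
    "set_integrable lebesgue W (\<lambda>t. norm (\<eta>' t *\<^sub>R \<phi> t))"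
    using set_integrable_subset[OF int Wl W01] set_integrable_subset[OF intn Wl W01] by auto
  have intA: "set_integrable lebesgue (A n) (\<lambda>t. \<bar>\<eta>' t\<bar> *\<^sub>R h t)"
    "set_integrable lebesgue (A n) (\<lambda>t. \<bar>\<eta>' t\<bar> *\<^sub>R norm (h t))" for n
    using set_integrable_subset[OF intW(1) Al AW] set_integrable_subset[OF intW(2) Al AW]
    unfolding h hn by auto
  have derA: "(\<eta> has_field_derivative \<eta>' t) (at t within A n)" if "t \<in> A n" for t n
    using derW AW that has_field_derivative_at_within by blast
  define f where "f n y = indicator (\<eta> ` A n) y *\<^sub>R h (inv_into (A n) \<eta> y)" for n y
  have intf: "integrable lebesgue (f n)"
    and If: "integral\<^sup>L lebesgue (f n) = (LINT t:A n|lebesgue. \<eta>' t *\<^sub>R \<phi> t)" for n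
    using set_lebesgue_change_of_variables_inj[OF Al derA inj intA(1), of n]
    by (simp_all add: f_def[abs_def] set_integrable_def set_lebesgue_integral_def h)
  have nf: "norm (f n y) = indicator (\<eta> ` A n) y *\<^sub>R norm (h (inv_into (A n) \<eta> y))" for n y
    by (simp add: f_def indicator_def)
  have Inf: "(LINT y|lebesgue. norm (f n y)) = (LINT t:A n|lebesgue. norm (\<eta>' t *\<^sub>R \<phi> t))" for n
    using set_lebesgue_change_of_variables_inj(2)[OF Al derA inj intA(2), of n]
    unfolding nf set_lebesgue_integral_def hn by simp
  have reg: "AE y in lebesgue. \<eta> 0 \<noteq> y \<and> \<eta> 1 \<noteq> y \<and>
    finite {t \<in> {0<..<1}. \<eta> t = y} \<and> (\<forall>t\<in>{0<..<1}. \<eta> t = y \<longrightarrow> \<eta>' t \<noteq> 0)"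
    by (rule AE_regular_value[OF der])
  have fsums: "(\<lambda>n. f n y) sums (\<Sum>t | t \<in> {0<..<1} \<and> \<eta> t = y. sgn (\<eta>' t) *\<^sub>R \<phi> t)"
    "summable (\<lambda>n. norm (f n y))"
    if fin: "finite {t \<in> {0<..<1}. \<eta> t = y}" and nz: "\<And>t. t\<in>{0<..<1} \<Longrightarrow> \<eta> t = y \<Longrightarrow> \<eta>' t \<noteq> 0" for y
  proof -
    let ?T = "{t \<in> {0<..<1}. \<eta> t = y}"
    have TW: "?T \<subseteq> W" using nz by (auto simp: W_def)
    \<comment> \<open>By injectivity a piece contains at most one point of the level set, so this
      sum has at most one nonzero term.\<close>
    have fe: "f n y = (\<Sum>t\<in>?T. if t \<in> A n then h t else 0)" for n
    proof (cases "y \<in> \<eta> ` A n")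
      case True
      then obtain s where s: "s \<in> A n" "\<eta> s = y" by blast
      have "inv_into (A n) \<eta> y = s" using s inj by auto
      then have "f n y = h s" using True by (simp add: f_def)
      moreover have "?T \<inter> A n = {s}"
        using s inj[of n] AW[of n] by (auto simp: W_def inj_on_def)
      then have "(\<Sum>t\<in>?T. if t \<in> A n then h t else 0) = h s"
        using fin by (simp add: sum.If_cases Int_def conj_ac)
      ultimately show ?thesis by simp
    next
      case False
      then have "\<And>t. t \<in> ?T \<Longrightarrow> t \<notin> A n" by blast
      with False show ?thesis by (simp add: f_def sum.neutral)
    qed
    have one: "\<exists>m. \<forall>n. t \<in> A n \<longleftrightarrow> n = m" if t: "t \<in> ?T" for t
    proof -
      obtain m where "t \<in> A m" using TW UA t by blast
      then show ?thesis using disj unfolding disjoint_family_on_def by blast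
    qed
    have "(\<lambda>n. if t \<in> A n then h t else 0) sums h t" if t: "t \<in> ?T" for t
    proof -
      obtain m where m: "\<And>n. t \<in> A n \<longleftrightarrow> n = m" using one[OF t] by blast
      show ?thesis unfolding m by (rule sums_single)
    qed
    then have "(\<lambda>n. \<Sum>t\<in>?T. if t \<in> A n then h t else 0) sums (\<Sum>t\<in>?T. h t)"
      by (rule sums_sum)
    then show "(\<lambda>n. f n y) sums (\<Sum>t | t \<in> {0<..<1} \<and> \<eta> t = y. sgn (\<eta>' t) *\<^sub>R \<phi> t)"
      by (simp add: fe h_def)
    \<comment> \<open>There are finitely many level points, each in exactly one piece, so all but
      finitely many terms vanish.\<close>
    have "finite (\<Union>t\<in>?T. {n. t \<in> A n})"
    proof (rule finite_UN_I[OF fin])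
      fix t assume "t \<in> ?T"
      then obtain m where "\<And>n. t \<in> A n \<longleftrightarrow> n = m" using one by blast
      then show "finite {n. t \<in> A n}" by simp
    qed
    moreover have "f n y = 0" if "n \<notin> (\<Union>t\<in>?T. {n. t \<in> A n})" for n
      unfolding fe by (rule sum.neutral) (use that in auto)
    ultimately show "summable (\<lambda>n. norm (f n y))"
      by (intro summable_finite) auto
  qed
  have ae1: "AE y in lebesgue. summable (\<lambda>n. norm (f n y))"
    using reg
  proof eventually_elim
    case (elim y)
    show ?case by (rule fsums(2)) (use elim in auto)
  qed
  have ae2: "AE y in lebesgue. (\<Sum>n. f n y) = (\<Sum>t | t \<in> {0<..<1} \<and> \<eta> t = y. sgn (\<eta>' t) *\<^sub>R \<phi> t)"
    using reg
  proof eventually_elim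
    case (elim y)
    show ?case by (rule sums_unique[symmetric], rule fsums(1)) (use elim in auto)
  qed
  have summ: "summable (\<lambda>n. (LINT y|lebesgue. norm (f n y)))"
    unfolding Inf by (rule summable_set_integral_disjoint[OF Al disj]) (use intW UA in auto)
  have "integral\<^sup>L lebesgue (\<lambda>y. \<Sum>n. f n y) = (\<Sum>n. (LINT t:A n|lebesgue. \<eta>' t *\<^sub>R \<phi> t))"
    using integral_suminf[OF intf ae1 summ] by (simp add: If)
  also have "\<dots> = (LINT t:W|lebesgue. \<eta>' t *\<^sub>R \<phi> t)"
    using lebesgue_integral_countable_add[of A lebesgue "\<lambda>t. \<eta>' t *\<^sub>R \<phi> t"] Al disj intW UA
    by (simp add: disjoint_family_on_def)
  also have "\<dots> = integral W (\<lambda>t. \<eta>' t *\<^sub>R \<phi> t)"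
    by (rule set_lebesgue_integral_eq_integral(2)[OF intW(1)])
  also have "\<dots> = integral {0..1} (\<lambda>t. \<eta>' t *\<^sub>R \<phi> t)"
  proof (rule integral_spike_set)
    have "{t \<in> W - {0..1}. \<eta>' t *\<^sub>R \<phi> t \<noteq> 0} = {}" using W01 by auto
    then show "negligible {t \<in> W - {0..1}. \<eta>' t *\<^sub>R \<phi> t \<noteq> 0}" by (rule empty_imp_negligible)
    show "negligible {t \<in> {0..1} - W. \<eta>' t *\<^sub>R \<phi> t \<noteq> 0}"
      by (rule negligible_subset[of "{0,1}"]) (auto simp: W_def)
  qed
  finally show ?thesis
    using that[OF integrable_suminf[OF intf ae1 summ] ae2] by blast
qed

subsection \<open>Green's theorem\<close>

text \<open>This is the fundamental theorem of calculus on each component of \<open>S\<close>: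
  \<open>\<sigma>\<close> is 1 where a component ends and -1 where one begins.\<close>

lemma has_integral_open_real_crossings:
  fixes v v' :: "real \<Rightarrow> 'b::banach"
  assumes X: "finite X" "frontier S \<subseteq> X" and S: "open S" "bounded S"
    and cross: "\<And>p. p \<in> X \<Longrightarrow> \<sigma> p = 1 \<and> (\<forall>\<^sub>F s in at_right 0. p - s \<in> S \<and> p + s \<notin> S) \<or>
      \<sigma> p = - 1 \<and> (\<forall>\<^sub>F s in at_right 0. p + s \<in> S \<and> p - s \<notin> S)"
    and cont: "continuous_on (closure S) v"
    and E: "finite E" and der: "\<And>x. x \<in> S - E \<Longrightarrow> (v has_vector_derivative v' x) (at x)"
  shows "(v' has_integral (\<Sum>p\<in>X. \<sigma> p *\<^sub>R v p)) S"
proof -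
  have conn: "C \<subseteq> S \<or> C \<inter> S = {}" if "connected C" "C \<inter> X = {}" for C
    using connected_Int_frontier[of C S] that X(2) by blast
  have ftc: "(v' has_integral (v b - v a)) {a..b}" if "a < b" "{a<..<b} \<subseteq> S" for a b
  proof (rule fundamental_theorem_of_calculus_interior_strong[OF E])
    have "{a..b} = closure {a<..<b}" using that by simp
    also have "\<dots> \<subseteq> closure S" using that closure_mono by blast
    finally show "continuous_on {a..b} v" using cont continuous_on_subset by blast
  qed (use that der in auto)
  have notin: "p \<notin> S" if "p \<in> X" for p
  proof
    assume "p \<in> S"
    then obtain d where d: "d > 0" "\<And>x. dist x p < d \<Longrightarrow> x \<in> S"
      using S(1) unfolding open_dist by blast
    have "\<forall>\<^sub>F s in at_right 0. p + s \<in> S \<and> p - s \<in> S"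
      unfolding eventually_at_right_field using d by (intro exI[of _ d]) (auto simp: dist_real_def)
    moreover have "\<forall>\<^sub>F s in at_right 0. p + s \<notin> S \<or> p - s \<notin> S"
      using cross[OF that] by (auto elim: eventually_mono)
    ultimately have "\<forall>\<^sub>F s in at_right (0::real). False" by eventually_elim auto
    then show False by simp
  qed
  \<comment> \<open>The induction truncates \<open>S\<close> at a point \<open>b\<close> outside
    \<open>X\<close>; the extra term \<open>v b\<close> closes the component that \<open>b\<close>
    may cut.\<close>
  have main: "(v' has_integral ((\<Sum>p | p \<in> X \<and> p < b. \<sigma> p *\<^sub>R v p) + (if b \<in> S then v b else 0)))
      (S \<inter> {..b})" if "b \<notin> X" for b
    using that
  proof (induction "card {p \<in> X. p < b}" arbitrary: b)
    case 0
    then have emp: "{p \<in> X. p < b} = {}" using X(1) by simp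
    then have "{..b} \<inter> X = {}" using \<open>b \<notin> X\<close> by fastforce
    \<comment> \<open>The ray contains no frontier point, so it is inside \<open>S\<close> or
      disjoint from it, and boundedness excludes the former.\<close>
    moreover have "\<not> {..b} \<subseteq> S"
      using S(2) bounded_subset not_bounded_UNIV
      by (metis bdd_below.unfold bounded_imp_bdd_below atMost_iff linorder_not_le lt_ex order_le_less_trans order_less_imp_le subsetD)
    ultimately have "{..b} \<inter> S = {}" using conn[of "{..b}"] by auto
    then have "S \<inter> {..b} = {}" "b \<notin> S" by auto
    then show ?case unfolding emp by simp
  next
    case (Suc n)
    let ?Xb = "{p \<in> X. p < b}"
    define m where "m = Max ?Xb"
    have fin: "finite ?Xb" using X(1) by simp
    have ne: "?Xb \<noteq> {}" using Suc(2) by (metis card.empty nat.distinct(1))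
    have "m \<in> ?Xb" unfolding m_def by (rule Max_in[OF fin ne])
    then have m: "m \<in> X" "m < b" by auto
    have mmax: "p \<le> m" if "p \<in> X" "p < b" for p
      unfolding m_def by (rule Max_ge[OF fin]) (use that in auto)
    obtain d where d: "d > 0" "\<And>x. x \<in> X \<Longrightarrow> x \<noteq> m \<Longrightarrow> d \<le> dist m x"
      using finite_set_avoid[OF X(1), of m] by blast
    \<comment> \<open>Every other point of \<open>X\<close> is at least \<open>d\<close> away from
      \<open>m\<close>, so \<open>{b0..<m}\<close> is free of crossings and the passage from
      \<open>b0\<close> to \<open>b\<close> meets exactly \<open>m\<close>.\<close>
    define b0 where "b0 = m - d / 2"
    have b0: "b0 < m" using d by (simp add: b0_def)
    have gap: "x \<notin> X" if "b0 \<le> x" "x < m" for x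
      using d(2)[of x] that d(1) by (auto simp: b0_def dist_real_def)
    have Xb: "?Xb = insert m {p \<in> X. p < b0}"
      using m mmax gap b0 by (auto simp: not_less) (metis linorder_not_less order_le_imp_less_or_eq)
    then have "n = card {p \<in> X. p < b0}" using Suc(2) b0 X(1) by simp
    then have IH: "(v' has_integral ((\<Sum>p | p \<in> X \<and> p < b0. \<sigma> p *\<^sub>R v p) + (if b0 \<in> S then v b0 else 0)))
      (S \<inter> {..b0})"
      using Suc(1) gap b0 by blast
    have sum: "(\<Sum>p | p \<in> X \<and> p < b. \<sigma> p *\<^sub>R v p)
        = \<sigma> m *\<^sub>R v m + (\<Sum>p | p \<in> X \<and> p < b0. \<sigma> p *\<^sub>R v p)"
      unfolding Xb using X(1) b0 by (subst sum.insert) auto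
    have left: "{b0..<m} \<subseteq> S \<or> {b0..<m} \<inter> S = {}" by (rule conn) (use gap in auto)
    have right: "{m<..b} \<subseteq> S \<or> {m<..b} \<inter> S = {}"
      by (rule conn) (use mmax Suc.prems in \<open>auto, metis linorder_not_le order_le_imp_less_or_eq\<close>)
    have ev0: "\<forall>\<^sub>F s in at_right 0. m - s \<in> {b0..<m} \<and> m + s \<in> {m<..b}"
      unfolding eventually_at_right_field using b0 m by (intro exI[of _ "min (m - b0) (b - m)"]) auto
    have near: "\<exists>s. P s \<and> m - s \<in> {b0..<m} \<and> m + s \<in> {m<..b}"
      if "\<forall>\<^sub>F s in at_right 0. P s" for P :: "real \<Rightarrow> bool"
      using eventually_happens'[OF trivial_limit_at_right_real eventually_conj[OF that ev0]] by blast
    from cross[OF m(1)] show ?case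
    proof (elim disjE conjE)
      assume sg: "\<sigma> m = 1" and ev: "\<forall>\<^sub>F s in at_right 0. m - s \<in> S \<and> m + s \<notin> S"
      have L: "{b0..<m} \<subseteq> S" and R: "{m<..b} \<inter> S = {}"
        using near[OF ev] left right by blast+
      have "b \<notin> S" using R m by auto
      have "(v' has_integral (v m - v b0)) {b0..m}" by (rule ftc) (use L b0 in auto)
      moreover have "b0 \<in> S" using L b0 by auto
      then have "(v' has_integral ((\<Sum>p | p \<in> X \<and> p < b0. \<sigma> p *\<^sub>R v p) + v b0)) (S \<inter> {..b0})"
        using IH by simp
      moreover have "negligible (S \<inter> {..b0} \<inter> {b0..m})"
        by (rule negligible_subset[of "{b0}"]) auto
      ultimately have "(v' has_integral ((\<Sum>p | p \<in> X \<and> p < b0. \<sigma> p *\<^sub>R v p) + v b0) + (v m - v b0))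
          (S \<inter> {..b0} \<union> {b0..m})"
        by (intro has_integral_Un)
      then have "(v' has_integral ((\<Sum>p | p \<in> X \<and> p < b. \<sigma> p *\<^sub>R v p) + (if b \<in> S then v b else 0)))
          (S \<inter> {..b0} \<union> {b0..m})"
        using \<open>b \<notin> S\<close> sg by (simp add: sum algebra_simps)
      moreover have "S \<inter> {..b} - (S \<inter> {..b0} \<union> {b0..m}) = {}"
        using R by (auto simp: disjoint_iff not_le)
      then have "negligible (S \<inter> {..b} - (S \<inter> {..b0} \<union> {b0..m}))" by simp
      moreover have "negligible (S \<inter> {..b0} \<union> {b0..m} - S \<inter> {..b})"
        by (rule negligible_subset[of "{m}"]) (use L m b0 in \<open>auto simp: subset_iff\<close>)
      ultimately show ?thesis
        by (subst has_integral_spike_set_eq[where T = "S \<inter> {..b0} \<union> {b0..m}"])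
          (auto elim: negligible_subset)
    next
      assume sg: "\<sigma> m = - 1" and ev: "\<forall>\<^sub>F s in at_right 0. m + s \<in> S \<and> m - s \<notin> S"
      have R: "{m<..b} \<subseteq> S" and L: "{b0..<m} \<inter> S = {}"
        using near[OF ev] left right by blast+
      have "b \<in> S" using R m by auto
      have "(v' has_integral (v b - v m)) {m..b}" by (rule ftc) (use R m in auto)
      moreover have "b0 \<notin> S" using L b0 by auto
      then have "(v' has_integral (\<Sum>p | p \<in> X \<and> p < b0. \<sigma> p *\<^sub>R v p)) (S \<inter> {..b0})"
        using IH by simp
      moreover have "negligible (S \<inter> {..b0} \<inter> {m..b})"
        by (rule negligible_subset[of "{}"]) (use b0 in auto)
      ultimately have "(v' has_integral (\<Sum>p | p \<in> X \<and> p < b0. \<sigma> p *\<^sub>R v p) + (v b - v m))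
          (S \<inter> {..b0} \<union> {m..b})"
        by (intro has_integral_Un)
      then have "(v' has_integral ((\<Sum>p | p \<in> X \<and> p < b. \<sigma> p *\<^sub>R v p) + (if b \<in> S then v b else 0)))
          (S \<inter> {..b0} \<union> {m..b})"
        using \<open>b \<in> S\<close> sg by (simp add: sum algebra_simps)
      moreover have "S \<inter> {..b} - (S \<inter> {..b0} \<union> {m..b}) = {}"
        using L by (auto simp: disjoint_iff not_le) (meson nle_le)
      then have "negligible (S \<inter> {..b} - (S \<inter> {..b0} \<union> {m..b}))" by simp
      moreover have "negligible (S \<inter> {..b0} \<union> {m..b} - S \<inter> {..b})"
        by (rule negligible_subset[of "{m}"]) (use R m b0 in \<open>auto simp: subset_iff, metis order_le_less\<close>)
      ultimately show ?thesis
        by (subst has_integral_spike_set_eq[where T = "S \<inter> {..b0} \<union> {m..b}"])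
          (auto elim: negligible_subset)
    qed
  qed
  obtain B where B: "\<And>x. x \<in> S \<union> X \<Longrightarrow> \<bar>x\<bar> < B"
    using S(2) X(1) by (metis bounded_Un bounded_pos_less finite_imp_bounded real_norm_def)
  have "(v' has_integral ((\<Sum>p | p \<in> X \<and> p < B. \<sigma> p *\<^sub>R v p) + (if B \<in> S then v B else 0)))
      (S \<inter> {..B})"
    by (rule main) (use B in force)
  moreover have "{p \<in> X. p < B} = X" "B \<notin> S" "S \<inter> {..B} = S" using B by force+
  ultimately show ?thesis by simp
qed

text \<open>The planar version of \<open>piecewise_C1_boundary\<close>. Curves and velocities are
  families over an index set, so that coordinate curves and rotated curves can reuse the same index
  set.\<close>

locale oriented_C1_boundary =
  fixes D :: "complex set" and I :: "'i set" and c c' :: "'i \<Rightarrow> real \<Rightarrow> complex"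
  assumes open_D: "open D" and bounded_D: "bounded D" and finite_I: "finite I"
    and frontier_D: "frontier D = (\<Union>i\<in>I. path_image (c i))"
    and disj: "\<lbrakk>i \<in> I; j \<in> I; i \<noteq> j\<rbrakk> \<Longrightarrow> c i ` {0<..<1} \<inter> path_image (c j) = {}"
    and simple: "i \<in> I \<Longrightarrow> simple_path (c i)"
    and cont': "i \<in> I \<Longrightarrow> continuous_on {0..1} (c' i)"
    and der: "\<lbrakk>i \<in> I; t \<in> {0..1}\<rbrakk> \<Longrightarrow> (c i has_vector_derivative c' i t) (at t within {0..1})"
    and nz: "\<lbrakk>i \<in> I; t \<in> {0..1}\<rbrakk> \<Longrightarrow> c' i t \<noteq> 0"
    and normal: "\<lbrakk>i \<in> I; t \<in> {0<..<1}\<rbrakk> \<Longrightarrow> \<forall>\<^sub>F s in at_right 0.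
      c i t + s *\<^sub>R (\<i> * c' i t) \<in> D \<and> c i t - s *\<^sub>R (\<i> * c' i t) \<notin> D"
begin

text \<open>A simple path may close up and identify the parameters 0 and 1; interiority of
  \<open>t\<close> rules this out, while \<open>s\<close> may be an end point.\<close>

lemma inj_interior:
  assumes "i \<in> I" "j \<in> I" "t \<in> {0<..<1}" "s \<in> {0..1}" "c i t = c j s"
  shows "i = j \<and> t = s"
proof -
  have ij: "i = j"
  proof (rule ccontr)
    assume "i \<noteq> j"
    moreover have "c i t \<in> c i ` {0<..<1}" using assms(3) by blast
    moreover have "c i t \<in> path_image (c j)"
      using assms(4,5) by (auto simp: path_image_def)
    ultimately show False using disj assms(1,2) by blast
  qed
  have "loop_free (c i)" using simple[OF assms(1)] by (simp add: simple_path_def)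
  then show ?thesis
    using assms ij unfolding loop_free_def by fastforce
qed

text \<open>
  For \<open>k\<close> on the segment from the normal to \<open>w\<close>, the points \<open>c i t + s *\<^sub>R k\<close> with small \<open>s \<noteq> 0\<close> avoid
  the frontier, because the curve leaves \<open>c i t\<close> in the direction \<open>\<plusminus>c' i t\<close>. Hence \<open>D\<close> lies in direction
  \<open>w\<close> exactly if it lies in the normal direction.
\<close>

lemma transversal_crossing:
  assumes i: "i \<in> I" and t: "t \<in> {0<..<1}" and w: "Im (cnj (c' i t) * w) > 0"
  shows "\<forall>\<^sub>F s in at_right 0. c i t + s *\<^sub>R w \<in> D \<and> c i t - s *\<^sub>R w \<notin> D"
proof -
  define p d where "p = c i t" and "d = c' i t"
  have t01: "t \<in> {0..1}" using t by auto
  have d0: "norm d > 0" using nz[OF i t01] by (simp add: d_def)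
  \<comment> \<open>Pairing with \<open>cnj d\<close> measures, up to the factor
    \<open>norm d\<close>, the component along the left normal: \<open>M\<close> bounds the length
    of all directions in \<open>K\<close>, and \<open>m\<close> bounds their pairings from
    below.\<close>
  define K where "K = closed_segment (\<i> * d) w"
  define M where "M = max (norm (\<i> * d)) (norm w)"
  define m where "m = min (Im (cnj d * (\<i> * d))) (Im (cnj d * w))"
  have "Im (cnj d * (\<i> * d)) = (norm d)\<^sup>2"
    by (simp add: cmod_power2) (simp add: power2_eq_square)
  then have m0: "m > 0" using d0 w by (simp add: m_def d_def)
  have M0: "M > 0" using d0 unfolding M_def by (simp add: norm_mult less_max_iff_disj)
  have K: "norm k \<le> M" "Im (cnj d * k) \<ge> m" if "k \<in> K" for k
  proof -
    obtain u where u: "0 \<le> u" "u \<le> 1" "k = (1 - u) *\<^sub>R (\<i> * d) + u *\<^sub>R w"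
      using \<open>k \<in> K\<close> unfolding K_def closed_segment_def by blast
    have "norm k \<le> (1 - u) * norm (\<i> * d) + u * norm w"
      unfolding u(3) using u(1,2) by (intro order_trans[OF norm_triangle_ineq]) simp
    also have "\<dots> \<le> (1 - u) * M + u * M"
      using u by (intro add_mono mult_left_mono) (auto simp: M_def)
    finally show "norm k \<le> M" by (simp add: algebra_simps)
    have "m = (1 - u) * m + u * m" by (simp add: algebra_simps)
    also have "\<dots> \<le> (1 - u) * Im (cnj d * (\<i> * d)) + u * Im (cnj d * w)"
      using u by (intro add_mono mult_left_mono) (auto simp: m_def)
    also have "\<dots> = Im (cnj d * k)" unfolding u(3) by (simp add: algebra_simps)
    finally show "Im (cnj d * k) \<ge> m" .
  qed
  \<comment> \<open>The bound \<open>norm d / 2\<close> will give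
    \<open>norm d * \<bar>\<tau> - t\<bar> \<le> 2 * \<bar>s\<bar> * M\<close>; the bound
    \<open>m / (4 * M)\<close> then yields
    \<open>\<bar>s\<bar> * m \<le> \<bar>s\<bar> * m / 2\<close>, a contradiction.\<close>
  define \<eta> where "\<eta> = min (norm d / 2) (m / (4 * M))"
  have \<eta>: "\<eta> > 0" "\<eta> \<le> norm d / 2" "\<eta> \<le> m / (4 * M)"
    using d0 m0 M0 by (simp_all add: \<eta>_def)
  obtain \<delta> where \<delta>: "\<delta> > 0"
    "\<And>\<tau>. \<tau> \<in> {0..1} \<Longrightarrow> \<bar>\<tau> - t\<bar> < \<delta> \<Longrightarrow> norm (c i \<tau> - p - (\<tau> - t) *\<^sub>R d) \<le> \<eta> * \<bar>\<tau> - t\<bar>"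
    using der[OF i t01] \<eta>(1) unfolding has_vector_derivative_def has_derivative_within_alt p_def d_def
    by (metis real_norm_def)
  \<comment> \<open>All of the frontier except the arc of \<open>c i\<close> with parameters near
    \<open>t\<close>. This set is closed and misses \<open>p\<close>, so frontier points close to
    \<open>p\<close> come from that arc.\<close>
  define R where "R = (\<Union>j\<in>I - {i}. path_image (c j)) \<union> c i ` ({0..1} - ball t \<delta>)"
  have contc: "continuous_on {0..1} (c j)" if "j \<in> I" for j
    using simple[OF that] by (simp add: simple_path_def path_def)
  have "compact (c i ` ({0..1} - ball t \<delta>))"
    by (intro compact_continuous_image continuous_on_subset[OF contc[OF i]] compact_diff) auto
  moreover have "compact (\<Union>j\<in>I - {i}. path_image (c j))"
    using finite_I simple simple_path_imp_path by (intro compact_UN compact_path_image) auto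
  ultimately have "closed R" unfolding R_def by (intro closed_Un compact_imp_closed)
  moreover have "p \<notin> R"
  proof
    assume "p \<in> R"
    then consider "p \<in> (\<Union>j\<in>I - {i}. path_image (c j))" | "p \<in> c i ` ({0..1} - ball t \<delta>)"
      unfolding R_def by blast
    then show False
    proof cases
      case 1
      then obtain j s where "j \<in> I" "j \<noteq> i" "s \<in> {0..1}" "p = c j s"
        unfolding path_image_def by blast
      then show False using inj_interior[OF i _ t] unfolding p_def by blast
    next
      case 2
      then obtain s where "s \<in> {0..1}" "s \<notin> ball t \<delta>" "p = c i s" by blast
      then show False using inj_interior[OF i i t, of s] \<delta>(1) by (auto simp: p_def)
    qed
  qed
  ultimately obtain r where r: "r > 0" "ball p r \<inter> R = {}"
    by (metis Compl_iff Int_Diff disjoint_eq_subset_Compl open_Compl open_contains_ball)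
  have avoid: "p + s *\<^sub>R k \<notin> frontier D" if s: "s \<noteq> 0" "\<bar>s\<bar> * M < r" and k: "k \<in> K" for s k
  proof
    assume "p + s *\<^sub>R k \<in> frontier D"
    then obtain j \<tau> where j: "j \<in> I" "\<tau> \<in> {0..1}" "p + s *\<^sub>R k = c j \<tau>"
      unfolding frontier_D path_image_def by blast
    have skM: "norm (s *\<^sub>R k) \<le> \<bar>s\<bar> * M" using K(1)[OF k] by (simp add: mult_left_mono)
    then have "norm (s *\<^sub>R k) < r" using s(2) by linarith
    then have "p + s *\<^sub>R k \<in> ball p r" by (simp add: dist_norm)
    then have "p + s *\<^sub>R k \<notin> R" using r by blast
    then have ji: "j = i" using j unfolding R_def path_image_def by blast
    have "\<tau> \<in> ball t \<delta>"
      using \<open>p + s *\<^sub>R k \<notin> R\<close> j ji unfolding R_def by blast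
    then have \<tau>: "\<bar>\<tau> - t\<bar> < \<delta>" by (simp add: dist_real_def abs_minus_commute)
    define e where "e = c i \<tau> - p - (\<tau> - t) *\<^sub>R d"
    have e: "norm e \<le> \<eta> * \<bar>\<tau> - t\<bar>" unfolding e_def by (rule \<delta>(2)[OF j(2) \<tau>])
    have sk: "s *\<^sub>R k = (\<tau> - t) *\<^sub>R d + e" using j(3) ji by (simp add: e_def algebra_simps)
    \<comment> \<open>The tangential part drops out because \<open>Im (cnj d * d) = 0\<close>; only
      the remainder \<open>e\<close> of the linear approximation is left.\<close>
    have "\<bar>s\<bar> * m \<le> \<bar>s\<bar> * Im (cnj d * k)" using K(2)[OF k] by (simp add: mult_left_mono)
    also have "\<dots> = \<bar>Im (cnj d * (s *\<^sub>R k))\<bar>"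
      using K(2)[OF k] m0 by (simp add: abs_mult)
    also have "Im (cnj d * (s *\<^sub>R k)) = Im (cnj d * e)"
      unfolding sk by (simp add: algebra_simps)
    also have "\<bar>Im (cnj d * e)\<bar> \<le> norm d * norm e"
      using abs_Im_le_cmod[of "cnj d * e"] by (simp add: norm_mult)
    also have "\<dots> \<le> norm d * (\<eta> * \<bar>\<tau> - t\<bar>)" using e by (simp add: mult_left_mono)
    finally have 1: "\<bar>s\<bar> * m \<le> \<eta> * (norm d * \<bar>\<tau> - t\<bar>)" by (simp add: mult_ac)
    have "norm d * \<bar>\<tau> - t\<bar> = norm (s *\<^sub>R k - e)" unfolding sk by simp
    also have "\<dots> \<le> \<bar>s\<bar> * M + \<eta> * \<bar>\<tau> - t\<bar>"
      using norm_triangle_ineq4[of "s *\<^sub>R k" e] e skM by linarith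
    also have "\<eta> * \<bar>\<tau> - t\<bar> \<le> norm d / 2 * \<bar>\<tau> - t\<bar>" by (rule mult_right_mono[OF \<eta>(2)]) simp
    finally have "norm d * \<bar>\<tau> - t\<bar> \<le> 2 * \<bar>s\<bar> * M" by simp
    then have "\<eta> * (norm d * \<bar>\<tau> - t\<bar>) \<le> m / (4 * M) * (2 * \<bar>s\<bar> * M)"
      using \<eta> m0 M0 by (intro mult_mono[OF \<eta>(3)]) auto
    also have "\<dots> = \<bar>s\<bar> * m / 2" using M0 by simp
    finally have "\<bar>s\<bar> * m \<le> \<bar>s\<bar> * m / 2" using 1 by linarith
    moreover have "\<bar>s\<bar> * m > 0" using s m0 by simp
    ultimately show False by linarith
  qed
  have conn: "p + s *\<^sub>R (\<i> * d) \<in> D \<longleftrightarrow> p + s *\<^sub>R w \<in> D" if s: "s \<noteq> 0" "\<bar>s\<bar> * M < r" for s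
  proof -
    let ?C = "(\<lambda>k. p + s *\<^sub>R k) ` K"
    have "connected ?C" unfolding K_def
      by (intro connected_continuous_image continuous_intros) auto
    moreover have "?C \<inter> frontier D = {}" using avoid[OF s] by blast
    ultimately have "?C \<inter> D = {} \<or> ?C - D = {}" using connected_Int_frontier by blast
    moreover have "p + s *\<^sub>R (\<i> * d) \<in> ?C" "p + s *\<^sub>R w \<in> ?C"
      by (auto simp: K_def)
    ultimately show ?thesis by blast
  qed
  have "\<forall>\<^sub>F s in at_right 0. 0 < s \<and> s * M < r"
    unfolding eventually_at_right_field using r M0
    by (intro exI[of _ "r / M"]) (auto simp: field_simps)
  with normal[OF i t] show ?thesis
    unfolding p_def[symmetric] d_def[symmetric]
  proof eventually_elim
    case (elim s)
    \<comment> \<open>The same segment argument with \<open>- s\<close> carries the negative normal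
      direction to \<open>- w\<close>.\<close>
    show ?case using conn[of s] conn[of "- s"] elim by simp
  qed
qed

end

section \<open>Lebesgue measure of the plane in horizontal slices\<close>

lemma measurable_Complex [measurable]:
  "(\<lambda>(y, x). Complex x y) \<in> (lborel \<Otimes>\<^sub>M lborel) \<rightarrow>\<^sub>M borel"
proof -
  have "(\<lambda>(y, x). Complex x y) = (\<lambda>p. of_real (snd p) + \<i> * of_real (fst p))"
    by (auto simp: complex_eq_iff fun_eq_iff)
  then show ?thesis by simp
qed

text \<open>Both sides agree on boxes, which determines the measure. The ordinate is the first
  component so that the inner Fubini integral runs along a horizontal line.\<close>

lemma lborel_complex: "(lborel :: complex measure) = distr (lborel \<Otimes>\<^sub>M lborel) borel (\<lambda>(y, x). Complex x y)"
proof (rule lborel_eqI)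
  fix l u :: complex
  assume lu: "\<And>b. b \<in> Basis \<Longrightarrow> l \<bullet> b \<le> u \<bullet> b"
  have le: "Re l \<le> Re u" "Im l \<le> Im u"
    using lu[of 1] lu[of \<i>] by (auto simp: Basis_complex_def inner_complex_def)
  have "emeasure (distr (lborel \<Otimes>\<^sub>M lborel) borel (\<lambda>(y, x). Complex x y)) (box l u)
      = emeasure (lborel \<Otimes>\<^sub>M lborel) ((\<lambda>(y, x). Complex x y) -` box l u \<inter> space (lborel \<Otimes>\<^sub>M lborel))"
    by (rule emeasure_distr) auto
  also have "(\<lambda>(y, x). Complex x y) -` box l u \<inter> space (lborel \<Otimes>\<^sub>M lborel)
      = {Im l<..<Im u} \<times> {Re l<..<Re u}"
    by (auto simp: box_def Basis_complex_def inner_complex_def space_pair_measure)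
  also have "emeasure (lborel \<Otimes>\<^sub>M lborel) ({Im l<..<Im u} \<times> {Re l<..<Re u})
      = ennreal (Im u - Im l) * ennreal (Re u - Re l)"
    using le by (subst lborel.emeasure_pair_measure_Times) auto
  also have "\<dots> = ennreal (\<Prod>b\<in>Basis. (u - l) \<bullet> b)"
    using le by (simp add: Basis_complex_def inner_complex_def ennreal_mult[symmetric] mult.commute)
  finally show "emeasure (distr (lborel \<Otimes>\<^sub>M lborel) borel (\<lambda>(y, x). Complex x y)) (box l u)
      = ennreal (\<Prod>b\<in>Basis. (u - l) \<bullet> b)" .
qed simp

lemma
  fixes f :: "complex \<Rightarrow> 'b::{banach, second_countable_topology}"
  assumes f: "integrable lborel f"
  shows AE_integrable_horizontal: "AE y in lborel. integrable lborel (\<lambda>x. f (Complex x y))"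
    and integrable_horizontal_integral: "integrable lborel (\<lambda>y. LINT x|lborel. f (Complex x y))"
    and integral_horizontal: "(LINT y|lborel. (LINT x|lborel. f (Complex x y))) = integral\<^sup>L lborel f"
proof -
  have fm: "f \<in> borel_measurable borel" using borel_measurable_integrable[OF f] by simp
  have int: "integrable (lborel \<Otimes>\<^sub>M lborel) (\<lambda>(y, x). f (Complex x y))"
    using f integrable_distr_eq[OF measurable_Complex fm] lborel_complex
    by (simp add: case_prod_unfold)
  show "AE y in lborel. integrable lborel (\<lambda>x. f (Complex x y))"
    using lborel_pair.AE_integrable_fst'[OF int] by simp
  show "integrable lborel (\<lambda>y. LINT x|lborel. f (Complex x y))"
    using lborel_pair.integrable_fst'[OF int] by simp
  have "integral\<^sup>L lborel f = integral\<^sup>L (lborel \<Otimes>\<^sub>M lborel) (\<lambda>(y, x). f (Complex x y))"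
    using integral_distr[OF measurable_Complex fm] lborel_complex
    by (simp add: case_prod_unfold)
  then show "(LINT y|lborel. (LINT x|lborel. f (Complex x y))) = integral\<^sup>L lborel f"
    using lborel_pair.integral_fst'[OF int] by simp
qed

lemma continuous_on_Complex_horizontal: "continuous_on A (\<lambda>x. Complex x y)"
  by (simp add: Complex_eq continuous_intros)

lemma closure_horizontal_slice:
  "(\<lambda>x. Complex x y) ` closure {x. Complex x y \<in> D} \<subseteq> closure D"
  by (rule image_closure_subset)
    (use continuous_on_Complex_horizontal closure_subset[THEN subsetD] in auto)

context oriented_C1_boundary
begin

text \<open>A frontier point of the slice lies in the closure of \<open>D\<close> but outside the
  open set \<open>D\<close>, hence on a curve; lines through curve ends are excluded.\<close>

lemma frontier_horizontal_slice:
  assumes ends: "\<And>i. i \<in> I \<Longrightarrow> Im (c i 0) \<noteq> y \<and> Im (c i 1) \<noteq> y"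
    and x: "x \<in> frontier {x. Complex x y \<in> D}"
  shows "\<exists>i\<in>I. \<exists>t\<in>{0<..<1}. c i t = Complex x y"
proof -
  let ?S = "{x. Complex x y \<in> D}"
  have "open ?S" using open_vimage[OF open_D continuous_on_Complex_horizontal] by (simp add: vimage_def)
  then have x': "x \<in> closure ?S" "x \<notin> ?S" using x by (auto simp: frontier_def interior_open)
  have "Complex x y \<in> frontier D"
    using x' open_D closure_horizontal_slice[of y D] by (auto simp: frontier_def interior_open)
  then obtain i t where t: "i \<in> I" "t \<in> {0..1}" "c i t = Complex x y"
    unfolding frontier_D path_image_def by force
  then have "Im (c i t) = y" by simp
  then have "t \<noteq> 0" "t \<noteq> 1" using ends[OF t(1)] by auto
  then show ?thesis using t by force
qed

lemma continuous_on_c: "i \<in> I \<Longrightarrow> continuous_on {0..1} (c i)"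
  using simple by (auto simp: simple_path_def path_def)

lemma c_in_closure: "i \<in> I \<Longrightarrow> t \<in> {0..1} \<Longrightarrow> c i t \<in> closure D"
  using frontier_D unfolding frontier_def path_image_def by blast

text \<open>\<open>D\<close> lies to the left of its curves, so a curve moving upward bounds the
  slice on the right: the sign of \<open>Im (c' i t)\<close> is the sign of the crossing. The set
  \<open>E\<close> leaves room for the circle on which the truncated kernel changes its
  formula.\<close>

lemma Green_horizontal:
  fixes u p :: "complex \<Rightarrow> 'b::euclidean_space"
  assumes cont: "continuous_on (closure D) u"
    and p: "set_integrable lborel D p"
    and E: "\<And>y. finite {x. Complex x y \<in> E}"
    and deru: "\<And>x y. Complex x y \<in> D - E \<Longrightarrow>
      ((\<lambda>s. u (Complex s y)) has_vector_derivative p (Complex x y)) (at x)"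
  shows "(LINT z:D|lborel. p z) = (\<Sum>i\<in>I. integral {0..1} (\<lambda>t. Im (c' i t) *\<^sub>R u (c i t)))"
proof -
  have derIm: "((\<lambda>t. Im (c i t)) has_field_derivative Im (c' i t)) (at t within {0..1})"
    if "i \<in> I" "t \<in> {0..1}" for i t
    unfolding has_real_derivative_iff_has_vector_derivative
    by (rule bounded_linear.has_vector_derivative[OF bounded_linear_Im der[OF that]])
  have contIm: "continuous_on {0..1} (\<lambda>t. Im (c' i t))" if "i \<in> I" for i
    by (intro continuous_intros cont'[OF that])
  have contu: "continuous_on {0..1} (\<lambda>t. u (c i t))" if "i \<in> I" for i
    by (rule continuous_on_compose2[OF cont continuous_on_c[OF that]]) (use c_in_closure that in auto)
  define Q where "Q i S \<longleftrightarrow> integrable lebesgue S \<and>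
    (AE y in lebesgue. S y = (\<Sum>t | t \<in> {0<..<1} \<and> Im (c i t) = y. sgn (Im (c' i t)) *\<^sub>R u (c i t))) \<and>
    integral\<^sup>L lebesgue S = integral {0..1} (\<lambda>t. Im (c' i t) *\<^sub>R u (c i t))" for i S
  have "\<exists>S. Q i S" if i: "i \<in> I" for i
    by (rule signed_area_formula[OF derIm[OF i] contIm[OF i] contu[OF i]])
      (assumption, unfold Q_def, intro exI conjI)
  then obtain S where "\<And>i. i \<in> I \<Longrightarrow> Q i (S i)"
    by metis
  then have S: "\<And>i. i \<in> I \<Longrightarrow> integrable lebesgue (S i)"
    "\<And>i. i \<in> I \<Longrightarrow> AE y in lebesgue. S i y = (\<Sum>t | t \<in> {0<..<1} \<and> Im (c i t) = y. sgn (Im (c' i t)) *\<^sub>R u (c i t))"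
    "\<And>i. i \<in> I \<Longrightarrow> integral\<^sup>L lebesgue (S i) = integral {0..1} (\<lambda>t. Im (c' i t) *\<^sub>R u (c i t))"
    unfolding Q_def by simp_all
  have slice: "((\<lambda>x. p (Complex x y)) has_integral
      (\<Sum>i\<in>I. \<Sum>t | t \<in> {0<..<1} \<and> Im (c i t) = y. sgn (Im (c' i t)) *\<^sub>R u (c i t)))
      {x. Complex x y \<in> D}"
    if reg: "\<And>i. i \<in> I \<Longrightarrow> Im (c i 0) \<noteq> y \<and> Im (c i 1) \<noteq> y \<and>
      finite {t \<in> {0<..<1}. Im (c i t) = y} \<and> (\<forall>t\<in>{0<..<1}. Im (c i t) = y \<longrightarrow> Im (c' i t) \<noteq> 0)" for y
  proof -
    let ?S = "{x. Complex x y \<in> D}"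
    \<comment> \<open>Crossings are indexed by curve and parameter; distinct indices give distinct
      abscissae, so the sum over points of the line becomes a sum over parameters.\<close>
    define P where "P = (SIGMA i:I. {t \<in> {0<..<1}. Im (c i t) = y})"
    define r where "r = (\<lambda>(i, t). Re (c i t))"
    define X where "X = r ` P"
    have finP: "finite P" unfolding P_def using finite_I reg by (intro finite_SigmaI) auto
    have cP: "c (fst q) (snd q) = Complex (r q) y" if "q \<in> P" for q
      using that by (auto simp: P_def r_def complex_eq_iff)
    have inj: "inj_on r P"
    proof (rule inj_onI)
      fix q q' assume q: "q \<in> P" "q' \<in> P" "r q = r q'"
      obtain i t j s where eq: "q = (i, t)" "q' = (j, s)" by (cases q, cases q')
      have "i \<in> I" "j \<in> I" "t \<in> {0<..<1}" "s \<in> {0..1}"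
        using q(1,2) by (auto simp: P_def eq)
      moreover have "c i t = c j s" using cP[OF q(1)] cP[OF q(2)] q(3) by (simp add: eq)
      ultimately show "q = q'" using inj_interior eq by blast
    qed
    define \<sigma> where "\<sigma> x = (let q = the_inv_into P r x in sgn (Im (c' (fst q) (snd q))))" for x
    have \<sigma>: "\<sigma> (r q) = sgn (Im (c' (fst q) (snd q)))" if "q \<in> P" for q
      using that inj by (simp add: \<sigma>_def the_inv_into_f_f)
    have openS: "open ?S" using open_vimage[OF open_D continuous_on_Complex_horizontal] by (simp add: vimage_def)
    have "((\<lambda>x. p (Complex x y)) has_integral (\<Sum>x\<in>X. \<sigma> x *\<^sub>R u (Complex x y))) ?S"
    proof (rule has_integral_open_real_crossings[where E = "{x. Complex x y \<in> E}"])
      show "finite X" using finP by (simp add: X_def)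
      show "frontier ?S \<subseteq> X"
      proof
        fix x assume "x \<in> frontier ?S"
        then obtain i t where it: "i \<in> I" "t \<in> {0<..<1}" "c i t = Complex x y"
          using frontier_horizontal_slice reg by blast
        then have "(i, t) \<in> P" "r (i, t) = x" by (auto simp: P_def r_def)
        then show "x \<in> X" unfolding X_def by blast
      qed
      show "bounded ?S"
      proof (rule bounded_subset)
        show "bounded (Re ` D)" by (rule bounded_linear_image[OF bounded_D bounded_linear_Re])
        show "?S \<subseteq> Re ` D" by force
      qed
      show "continuous_on (closure ?S) (\<lambda>x. u (Complex x y))"
        by (rule continuous_on_compose2[OF cont continuous_on_Complex_horizontal closure_horizontal_slice])
      fix x assume "x \<in> X"
      then obtain q where q: "q \<in> P" "x = r q" unfolding X_def by blast
      define i t where "i = fst q" and "t = snd q"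
      have it: "i \<in> I" "t \<in> {0<..<1}" "Im (c i t) = y" using q(1) by (auto simp: P_def i_def t_def)
      have cx: "c i t = Complex x y" using cP[OF q(1)] by (simp add: i_def t_def q(2))
      have sx: "\<sigma> x = sgn (Im (c' i t))" using \<sigma>[OF q(1)] by (simp add: i_def t_def q(2))
      have shift: "c i t + s *\<^sub>R 1 = Complex (x + s) y" "c i t - s *\<^sub>R 1 = Complex (x - s) y"
        "c i t + s *\<^sub>R (- 1) = Complex (x - s) y" "c i t - s *\<^sub>R (- 1) = Complex (x + s) y" for s
        by (simp_all add: cx complex_eq_iff)
      have "Im (c' i t) \<noteq> 0" using reg it by blast
      then consider "Im (c' i t) > 0" | "Im (c' i t) < 0" by linarith
      then show "\<sigma> x = 1 \<and> (\<forall>\<^sub>F s in at_right 0. x - s \<in> ?S \<and> x + s \<notin> ?S) \<or>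
        \<sigma> x = - 1 \<and> (\<forall>\<^sub>F s in at_right 0. x + s \<in> ?S \<and> x - s \<notin> ?S)"
      \<comment> \<open>An upward crossing has the direction \<open>-1\<close> on its left, a
        downward one has \<open>1\<close>, since
        \<open>Im (cnj (c' i t) * (- 1)) = Im (c' i t)\<close>.\<close>
      proof cases
        case 1
        then show ?thesis
          using transversal_crossing[OF it(1,2), of "- 1"] unfolding shift by (simp add: sx)
      next
        case 2
        then show ?thesis
          using transversal_crossing[OF it(1,2), of 1] unfolding shift by (simp add: sx)
      qed
    qed (use openS E deru in auto)
    also have "(\<Sum>x\<in>X. \<sigma> x *\<^sub>R u (Complex x y)) = (\<Sum>q\<in>P. \<sigma> (r q) *\<^sub>R u (Complex (r q) y))"
      unfolding X_def using inj by (simp add: sum.reindex)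
    also have "\<dots> = (\<Sum>q\<in>P. sgn (Im (c' (fst q) (snd q))) *\<^sub>R u (c (fst q) (snd q)))"
      by (rule sum.cong) (auto simp: \<sigma> cP)
    also have "\<dots> = (\<Sum>i\<in>I. \<Sum>t | t \<in> {0<..<1} \<and> Im (c i t) = y. sgn (Im (c' i t)) *\<^sub>R u (c i t))"
      unfolding P_def using finite_I reg by (subst sum.Sigma) (auto simp: case_prod_unfold)
    finally show ?thesis .
  qed
  let ?g = "\<lambda>z. indicator D z *\<^sub>R p z"
  have g: "integrable lborel ?g" using p by (simp add: set_integrable_def)
  \<comment> \<open>Fubini speaks of \<open>lborel\<close>, the area formula of
    \<open>lebesgue\<close>; the former is transferred to the completion.\<close>
  have ae1: "AE y in lebesgue. integrable lborel (\<lambda>x. ?g (Complex x y))"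
    using AE_integrable_horizontal[OF g] by (rule AE_completion)
  have ae2: "AE y in lebesgue. \<forall>i\<in>I. Im (c i 0) \<noteq> y \<and> Im (c i 1) \<noteq> y \<and>
      finite {t \<in> {0<..<1}. Im (c i t) = y} \<and> (\<forall>t\<in>{0<..<1}. Im (c i t) = y \<longrightarrow> Im (c' i t) \<noteq> 0)"
    by (rule AE_finite_allI[OF finite_I AE_regular_value[OF derIm]])
  have ae3: "AE y in lebesgue. \<forall>i\<in>I. S i y =
      (\<Sum>t | t \<in> {0<..<1} \<and> Im (c i t) = y. sgn (Im (c' i t)) *\<^sub>R u (c i t))"
    by (rule AE_finite_allI[OF finite_I S(2)])
  have ae: "AE y in lebesgue. (LINT x|lborel. ?g (Complex x y)) = (\<Sum>i\<in>I. S i y)"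
    using ae1 ae2 ae3
  proof eventually_elim
    case (elim y)
    have "((\<lambda>x. ?g (Complex x y)) has_integral (LINT x|lborel. ?g (Complex x y))) UNIV"
      by (rule has_integral_integral_lborel[OF elim(1)])
    moreover have "(\<lambda>x. ?g (Complex x y)) = (\<lambda>x. if x \<in> {x. Complex x y \<in> D} then p (Complex x y) else 0)"
      by (auto simp: indicator_def)
    ultimately have "((\<lambda>x. p (Complex x y)) has_integral (LINT x|lborel. ?g (Complex x y))) {x. Complex x y \<in> D}"
      by (simp only: has_integral_restrict_UNIV)
    from has_integral_unique[OF this slice] elim show ?case by simp
  qed
  have hm: "(\<lambda>y. LINT x|lborel. ?g (Complex x y)) \<in> borel_measurable lborel"
    using integrable_horizontal_integral[OF g] by (rule borel_measurable_integrable)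
  have "(LINT z:D|lborel. p z) = (LINT y|lborel. (LINT x|lborel. ?g (Complex x y)))"
    unfolding set_lebesgue_integral_def by (rule integral_horizontal[OF g, symmetric])
  also have "\<dots> = (LINT y|lebesgue. (LINT x|lborel. ?g (Complex x y)))"
    by (rule integral_completion[OF hm, symmetric])
  also have "\<dots> = (LINT y|lebesgue. (\<Sum>i\<in>I. S i y))"
    by (rule integral_cong_AE[OF measurable_completion[OF hm] _ ae])
      (rule borel_measurable_sum, rule borel_measurable_integrable[OF S(1)])
  also have "\<dots> = (\<Sum>i\<in>I. integral\<^sup>L lebesgue (S i))"
    by (rule Bochner_Integration.integral_sum[OF S(1)])
  also have "\<dots> = (\<Sum>i\<in>I. integral {0..1} (\<lambda>t. Im (c' i t) *\<^sub>R u (c i t)))"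
    by (rule sum.cong) (use S(3) in auto)
  finally show ?thesis .
qed

end

section \<open>The vertical case by a quarter turn\<close>

lemma lborel_distr_mult_ii: "(lborel :: complex measure) = distr lborel borel ((*) \<i>)"
proof (rule lborel_eqI)
  fix l u :: complex
  assume lu: "\<And>b. b \<in> Basis \<Longrightarrow> l \<bullet> b \<le> u \<bullet> b"
  have le: "Re l \<le> Re u" "Im l \<le> Im u"
    using lu[of 1] lu[of \<i>] by (auto simp: Basis_complex_def inner_complex_def)
  have "emeasure (distr lborel borel ((*) \<i>)) (box l u)
      = emeasure lborel ((*) \<i> -` box l u \<inter> space lborel)"
    by (rule emeasure_distr) auto
  also have "(*) \<i> -` box l u \<inter> space lborel = box (Complex (Im l) (- Re u)) (Complex (Im u) (- Re l))"
    by (auto simp: box_def Basis_complex_def inner_complex_def)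
  also have "emeasure lborel (box (Complex (Im l) (- Re u)) (Complex (Im u) (- Re l)))
      = ennreal (\<Prod>b\<in>Basis. (u - l) \<bullet> b)"
    using le by (subst emeasure_lborel_box) (auto simp: Basis_complex_def inner_complex_def mult.commute)
  finally show "emeasure (distr lborel borel ((*) \<i>)) (box l u) = ennreal (\<Prod>b\<in>Basis. (u - l) \<bullet> b)" .
qed simp

lemma
  fixes f :: "complex \<Rightarrow> 'b::{banach, second_countable_topology}"
  assumes f: "integrable lborel f"
  shows integrable_mult_ii: "integrable lborel (\<lambda>z. f (\<i> * z))"
    and integral_mult_ii: "(LINT z|lborel. f (\<i> * z)) = integral\<^sup>L lborel f"
proof -
  have m: "(*) \<i> \<in> lborel \<rightarrow>\<^sub>M borel" by simp
  have fm: "f \<in> borel_measurable borel" using borel_measurable_integrable[OF f] by simp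
  show "integrable lborel (\<lambda>z. f (\<i> * z))"
    using f integrable_distr_eq[OF m fm] lborel_distr_mult_ii by simp
  show "(LINT z|lborel. f (\<i> * z)) = integral\<^sup>L lborel f"
    using integral_distr[OF m fm] lborel_distr_mult_ii by simp
qed

lemma linear_mult_minus_ii: "linear ((*) (- \<i>))"
  by (rule bounded_linear.linear[OF bounded_linear_mult_right])

context oriented_C1_boundary
begin

text \<open>A rotation commutes with multiplication by \<open>\<i>\<close>, so the left normal stays
  the left normal; exchanging the coordinates by a reflection would reverse all sides.\<close>

lemma rotate: "oriented_C1_boundary ((*) (- \<i>) ` D) I (\<lambda>i t. - \<i> * c i t) (\<lambda>i t. - \<i> * c' i t)"
proof
  have hom: "homeomorphic_map euclidean euclidean ((*) (- \<i>))"
  proof (rule homeomorphic_maps_imp_map)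
    show "homeomorphic_maps euclidean euclidean ((*) (- \<i>)) ((*) \<i>)"
      unfolding homeomorphic_maps_def by (auto intro!: continuous_intros)
  qed
  have img: "(*) (- \<i>) ` D = (*) \<i> -` D"
    by (auto simp: image_iff) (metis mult.left_commute mult_minus_left complex_i_mult_minus minus_minus)
  show "open ((*) (- \<i>) ` D)"
    unfolding img by (intro open_vimage[OF open_D] continuous_intros)
  show "bounded ((*) (- \<i>) ` D)"
    by (intro bounded_linear_image[OF bounded_D] bounded_linear_mult_right)
  show "finite I" by (rule finite_I)
  have "frontier ((*) (- \<i>) ` D) = (*) (- \<i>) ` frontier D"
    using homeomorphic_map_frontier_of[OF hom, of D] by simp
  then show "frontier ((*) (- \<i>) ` D) = (\<Union>i\<in>I. path_image (\<lambda>t. - \<i> * c i t))"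
    unfolding frontier_D by (simp add: path_image_def image_UN image_image)
  show "(\<lambda>t. - \<i> * c i t) ` {0<..<1} \<inter> path_image (\<lambda>t. - \<i> * c j t) = {}"
    if "i \<in> I" "j \<in> I" "i \<noteq> j" for i j
    using disj[OF that] by (auto simp: path_image_def)
  show "simple_path (\<lambda>t. - \<i> * c i t)" if "i \<in> I" for i
    using simple[OF that] simple_path_linear_image_eq[OF linear_mult_minus_ii, of "c i"]
    by (simp add: inj_on_def o_def)
  show "continuous_on {0..1} (\<lambda>t. - \<i> * c' i t)" if "i \<in> I" for i
    by (intro continuous_intros cont'[OF that])
  show "((\<lambda>t. - \<i> * c i t) has_vector_derivative - \<i> * c' i t) (at t within {0..1})"
    if "i \<in> I" "t \<in> {0..1}" for i t
    by (rule bounded_linear.has_vector_derivative[OF bounded_linear_mult_right der[OF that]])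
  show "- \<i> * c' i t \<noteq> 0" if "i \<in> I" "t \<in> {0..1}" for i t
    using nz[OF that] by simp
  show "\<forall>\<^sub>F s in at_right 0. - \<i> * c i t + s *\<^sub>R (\<i> * (- \<i> * c' i t)) \<in> (*) (- \<i>) ` D \<and>
      - \<i> * c i t - s *\<^sub>R (\<i> * (- \<i> * c' i t)) \<notin> (*) (- \<i>) ` D"
    if "i \<in> I" "t \<in> {0<..<1}" for i t
    using normal[OF that]
  proof eventually_elim
    case (elim s)
    have "- \<i> * c i t + s *\<^sub>R (\<i> * (- \<i> * c' i t)) = - \<i> * (c i t + s *\<^sub>R (\<i> * c' i t))"
      "- \<i> * c i t - s *\<^sub>R (\<i> * (- \<i> * c' i t)) = - \<i> * (c i t - s *\<^sub>R (\<i> * c' i t))"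
      by (simp_all add: algebra_simps scaleR_conv_of_real)
    with elim show ?case by auto
  qed
qed

text \<open>This is the horizontal case for the rotated domain and \<open>u (\<i> * w)\<close>:
  horizontal lines become vertical ones, and \<open>Im (- \<i> * c' i t) = - Re (c' i t)\<close>
  accounts for the sign.\<close>

lemma Green_vertical:
  fixes u q :: "complex \<Rightarrow> 'b::euclidean_space"
  assumes cont: "continuous_on (closure D) u"
    and q: "set_integrable lborel D q"
    and E: "\<And>x. finite {y. Complex x y \<in> E}"
    and deru: "\<And>x y. Complex x y \<in> D - E \<Longrightarrow>
      ((\<lambda>s. u (Complex x s)) has_vector_derivative q (Complex x y)) (at y)"
  shows "(LINT z:D|lborel. q z) = - (\<Sum>i\<in>I. integral {0..1} (\<lambda>t. Re (c' i t) *\<^sub>R u (c i t)))"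
proof -
  let ?D = "(*) (- \<i>) ` D"
  interpret R: oriented_C1_boundary ?D I "\<lambda>i t. - \<i> * c i t" "\<lambda>i t. - \<i> * c' i t"
    by (rule rotate)
  have mem: "w \<in> ?D \<longleftrightarrow> \<i> * w \<in> D" for w
    by (auto simp: image_iff) (metis mult.left_commute mult_minus_left complex_i_mult_minus minus_minus)
  have ind: "indicator ?D w *\<^sub>R q (\<i> * w) = indicator D (\<i> * w) *\<^sub>R q (\<i> * w)" for w
    using mem[of w] by (simp add: indicator_def)
  have rot: "\<i> * Complex a b = Complex (- b) a" for a b by (simp add: complex_eq_iff)
  have q': "integrable lborel (\<lambda>z. indicator D z *\<^sub>R q z)" using q by (simp add: set_integrable_def)
  have "(LINT w:?D|lborel. q (\<i> * w)) = (\<Sum>i\<in>I. integral {0..1} (\<lambda>t. Im (- \<i> * c' i t) *\<^sub>R u (\<i> * (- \<i> * c i t))))"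
  proof (rule R.Green_horizontal[where E = "(*) \<i> -` E"])
    have "(*) \<i> ` closure ?D \<subseteq> closure D"
      by (rule image_closure_subset) (use closure_subset[THEN subsetD] mem in \<open>auto intro!: continuous_intros\<close>)
    then show "continuous_on (closure ?D) (\<lambda>w. u (\<i> * w))"
      by (intro continuous_on_compose2[OF cont] continuous_intros)
    show "set_integrable lborel ?D (\<lambda>w. q (\<i> * w))"
      unfolding set_integrable_def ind by (rule integrable_mult_ii[OF q'])
    show "finite {x. Complex x y \<in> (*) \<i> -` E}" for y
      using E[of "- y"] by (simp add: rot)
    show "((\<lambda>s. u (\<i> * Complex s y)) has_vector_derivative q (\<i> * Complex x y)) (at x)"
      if "Complex x y \<in> ?D - (*) \<i> -` E" for x y
      using deru[of "- y" x] that mem[of "Complex x y"] by (simp add: rot)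
  qed
  also have "(LINT w:?D|lborel. q (\<i> * w)) = (LINT z:D|lborel. q z)"
    unfolding set_lebesgue_integral_def ind by (rule integral_mult_ii[OF q'])
  also have "(\<lambda>i. integral {0..1} (\<lambda>t. Im (- \<i> * c' i t) *\<^sub>R u (\<i> * (- \<i> * c i t))))
      = (\<lambda>i. - integral {0..1} (\<lambda>t. Re (c' i t) *\<^sub>R u (c i t)))"
    by (auto simp: fun_eq_iff)
  finally show ?thesis by (simp add: sum_negf)
qed

end

subsection \<open>The Cauchy-Pompeiu formula\<close>

text \<open>Two instances occur: left multiplication by an imaginary unit on the algebra, and
  multiplication by \<open>\<i>\<close> on its complexification.\<close>

locale complex_structure =
  fixes J :: "'b::euclidean_space \<Rightarrow> 'b"
  assumes linear_J: "linear J" and J_J [simp]: "J (J v) = - v"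
begin

definition cs :: "complex \<Rightarrow> 'b \<Rightarrow> 'b"
  where "cs z v = Re z *\<^sub>R v + Im z *\<^sub>R J v"

lemma J_add: "J (v + w) = J v + J w" and J_scaleR: "J (r *\<^sub>R v) = r *\<^sub>R J v" and J_minus: "J (- v) = - J v"
  using linear_J by (simp_all add: linear_add linear_scale linear_neg)

lemma bounded_linear_J: "bounded_linear J"
  using linear_J by (simp add: linear_conv_bounded_linear)

lemma bounded_bilinear_cs: "bounded_bilinear cs"
  unfolding bilinear_conv_bounded_bilinear[symmetric] bilinear_def linear_iff cs_def
  by (simp add: algebra_simps J_add J_scaleR)

sublocale cs: bounded_bilinear cs
  by (rule bounded_bilinear_cs)

lemma cs_mult: "cs (a * b) v = cs a (cs b v)"
  by (simp add: cs_def J_add J_scaleR algebra_simps)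

lemma cs_of_real: "cs (of_real r) v = r *\<^sub>R v" and cs_one [simp]: "cs 1 v = v" and cs_ii: "cs \<i> v = J v"
  by (simp_all add: cs_def)

lemma J_cs: "J (cs a v) = cs a (J v)"
  by (simp add: cs_def J_add J_scaleR J_minus)

end

section \<open>Integrability of continuous functions and of the inverse distance\<close>

lemma set_integrable_continuous_on_compact:
  fixes f :: "'a::euclidean_space \<Rightarrow> 'b::{banach, second_countable_topology}"
  assumes "compact K" "continuous_on K f" "A \<in> sets borel" "A \<subseteq> K"
  shows "set_integrable lborel A f"
proof -
  have "set_integrable lborel K f"
    using borel_integrable_compact[OF assms(1,2)] by (simp add: set_integrable_def)
  then show ?thesis by (rule set_integrable_subset) (use assms in auto)
qed

text \<open>One factor of the product majorant for \<open>1 / norm (z - z0)\<close>; the exponent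
  exceeds -1, so the singularity is integrable.\<close>

lemma integrable_abs_powr_minus_half:
  fixes R a :: real
  assumes "R \<ge> 0"
  shows "integrable lborel (\<lambda>x. indicator {-R..R} (x - a) * \<bar>x - a\<bar> powr (-1/2))"
proof -
  let ?f = "\<lambda>x::real. \<bar>x\<bar> powr (-1/2)"
  have "((\<lambda>x. x powr (-1/2)) has_integral (R powr (-1/2+1) / (-1/2+1))) {0..R}"
    by (rule has_integral_powr_from_0) (use assms in auto)
  then have "(\<lambda>x. x powr (-1/2)) integrable_on {0..R}" by blast
  then have "?f integrable_on {0..R}"
    by (rule integrable_eq) auto
  then have pos: "?f absolutely_integrable_on {0..R}"
    by (rule nonnegative_absolutely_integrable_1) auto
  then have "(\<lambda>x. ?f (- x)) absolutely_integrable_on {-R..-0}"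
    by (subst absolutely_integrable_reflect_real)
  then have neg: "?f absolutely_integrable_on {-R..0}" by simp
  have "set_integrable lebesgue ({-R..0} \<union> {0..R}) ?f"
    by (rule set_integrable_Un[OF neg pos]) auto
  also have "{-R..0} \<union> {0..R} = {-R..R}" using assms by auto
  finally have "integrable lebesgue (\<lambda>x. indicator {-R..R} x *\<^sub>R ?f x)"
    by (simp add: set_integrable_def)
  then have "integrable lborel (\<lambda>x. indicator {-R..R} x *\<^sub>R ?f x)"
    by (subst (asm) integrable_completion) auto
  then show ?thesis
    using lborel_integrable_real_affine[of "\<lambda>x. indicator {-R..R} x *\<^sub>R ?f x" 1 "- a"] by simp
qed

text \<open>Local integrability of \<open>1 / \<bar>z\<bar>\<close> follows from \<open>\<bar>z\<bar> \<ge> sqrt \<bar>x\<bar> * sqrt \<bar>y\<bar>\<close>, which separates the variables.\<close>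

lemma set_integrable_inverse_dist:
  fixes z0 :: complex
  assumes A: "A \<in> sets borel" "bounded A"
  shows "set_integrable lborel A (\<lambda>z. 1 / norm (z - z0))"
proof -
  obtain R where R: "R > 0" "\<And>z. z \<in> A \<Longrightarrow> norm (z - z0) \<le> R"
  proof -
    obtain B where "\<And>z. z \<in> A \<Longrightarrow> norm z \<le> B" using A(2) bounded_iff by blast
    then have "norm (z - z0) \<le> \<bar>B\<bar> + norm z0 + 1" if "z \<in> A" for z
      using that norm_triangle_ineq4[of z z0] by fastforce
    moreover have "\<bar>B\<bar> + norm z0 + 1 > 0" using norm_ge_zero[of z0] by linarith
    ultimately show ?thesis using that by blast
  qed
  define a where "a t x = indicator {-R..R} (x - t) * \<bar>x - t\<bar> powr (-1/2)" for t x :: real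
  have [measurable]: "a t \<in> borel_measurable borel" for t
    unfolding a_def by measurable
  have inta: "integrable lborel (a t)" for t
    unfolding a_def[abs_def] by (rule integrable_abs_powr_minus_half) (use R in simp)
  have "integrable (lborel \<Otimes>\<^sub>M lborel) (\<lambda>(y, x). a (Im z0) y * a (Re z0) x)"
  proof (rule lborel_pair.Fubini_integrable)
    show "(\<lambda>(y, x). a (Im z0) y * a (Re z0) x) \<in> borel_measurable (lborel \<Otimes>\<^sub>M lborel)" by measurable
    show "integrable lborel (\<lambda>y. LINT x|lborel. norm (case (y, x) of (y, x) \<Rightarrow> a (Im z0) y * a (Re z0) x))"
      using inta by (simp add: abs_mult)
    show "AE y in lborel. integrable lborel (\<lambda>x. case (y, x) of (y, x) \<Rightarrow> a (Im z0) y * a (Re z0) x)"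
      using inta by simp
  qed
  then have "integrable lborel (\<lambda>z. a (Im z0) (Im z) * a (Re z0) (Re z))"
    unfolding lborel_complex
    by (subst integrable_distr_eq[OF measurable_Complex]) (auto simp: case_prod_unfold)
  then show ?thesis
    unfolding set_integrable_def
  proof (rule Bochner_Integration.integrable_bound)
    show "(\<lambda>z. indicator A z *\<^sub>R (1 / norm (z - z0))) \<in> borel_measurable lborel"
      using A(1) by measurable
    \<comment> \<open>Since \<open>0 powr s = 0\<close>, the majorant vanishes on the two axes
      through \<open>z0\<close>, where the estimate would fail; they form a null set.\<close>
    have "AE z in lborel. Re z \<noteq> Re z0" "AE z in lborel. Im z \<noteq> Im z0"
      using AE_lborel_inner_neq[of "1::complex" "Re z0"] AE_lborel_inner_neq[of \<i> "Im z0"]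
      by (simp_all add: Basis_complex_def)
    then show "AE z in lborel. norm (indicator A z *\<^sub>R (1 / norm (z - z0)))
        \<le> norm (a (Im z0) (Im z) * a (Re z0) (Re z))"
    proof eventually_elim
      case (elim z)
      define x y where "x = Re z - Re z0" and "y = Im z - Im z0"
      have xy: "x \<noteq> 0" "y \<noteq> 0" using elim by (auto simp: x_def y_def inner_complex_def)
      have nz: "norm (z - z0) = sqrt (x\<^sup>2 + y\<^sup>2)" by (simp add: cmod_def x_def y_def)
      show ?case
      proof (cases "z \<in> A")
        case True
        have "\<bar>x\<bar> \<le> R" "\<bar>y\<bar> \<le> R"
          using R(2)[OF True] abs_Re_le_cmod[of "z - z0"] abs_Im_le_cmod[of "z - z0"]
          by (auto simp: x_def y_def)
        then have "a (Im z0) (Im z) * a (Re z0) (Re z) = \<bar>y\<bar> powr (-1/2) * \<bar>x\<bar> powr (-1/2)"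
          by (simp add: a_def x_def[symmetric] y_def[symmetric] abs_le_iff minus_le_iff)
        also have "\<dots> = 1 / sqrt (\<bar>x\<bar> * \<bar>y\<bar>)"
          using xy by (simp add: powr_minus_divide powr_half_sqrt real_sqrt_mult)
        finally have eq: "a (Im z0) (Im z) * a (Re z0) (Re z) = 1 / sqrt (\<bar>x\<bar> * \<bar>y\<bar>)" .
        \<comment> \<open>The arithmetic-geometric mean inequality, with a factor 2 to
          spare.\<close>
        have "0 \<le> (\<bar>x\<bar> - \<bar>y\<bar>)\<^sup>2" by simp
        then have "2 * (\<bar>x\<bar> * \<bar>y\<bar>) \<le> x\<^sup>2 + y\<^sup>2" by (simp add: power2_diff)
        moreover have "0 < \<bar>x\<bar> * \<bar>y\<bar>" using xy by simp
        ultimately have "\<bar>x\<bar> * \<bar>y\<bar> \<le> x\<^sup>2 + y\<^sup>2" by linarith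
        then have "1 / norm (z - z0) \<le> 1 / sqrt (\<bar>x\<bar> * \<bar>y\<bar>)"
          unfolding nz using \<open>0 < \<bar>x\<bar> * \<bar>y\<bar>\<close> by (intro divide_left_mono mult_pos_pos real_sqrt_gt_zero) auto
        then show ?thesis using True unfolding eq by simp
      qed simp
    qed
  qed
qed

section \<open>The truncated kernel\<close>

definition truncated_kernel :: "real \<Rightarrow> complex \<Rightarrow> complex"
  where "truncated_kernel \<epsilon> \<zeta> = cnj \<zeta> / of_real ((max (norm \<zeta>) \<epsilon>)\<^sup>2)"

lemma truncated_kernel_outside:
  assumes "\<epsilon> \<le> norm \<zeta>"
  shows "truncated_kernel \<epsilon> \<zeta> = 1 / \<zeta>"
proof (cases "\<zeta> = 0")
  case False
  then show ?thesis
    using assms by (simp add: truncated_kernel_def max_def complex_norm_square field_simps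
        del: of_real_power)
qed (simp add: truncated_kernel_def)

lemma truncated_kernel_inside: "norm \<zeta> \<le> \<epsilon> \<Longrightarrow> truncated_kernel \<epsilon> \<zeta> = cnj \<zeta> / of_real (\<epsilon>\<^sup>2)"
  by (simp add: truncated_kernel_def max_def)

text \<open>The bound is independent of \<open>\<epsilon>\<close>, which makes it the majorant for
  the limit; at 0 both sides vanish by the convention \<open>1 / 0 = 0\<close>.\<close>

lemma norm_truncated_kernel_le: "norm (truncated_kernel \<epsilon> \<zeta>) \<le> 1 / norm \<zeta>"
proof (cases "\<zeta> = 0")
  case False
  have "(norm \<zeta>)\<^sup>2 \<le> (max (norm \<zeta>) \<epsilon>)\<^sup>2" by (intro power_mono) auto
  moreover have "0 < (norm \<zeta>)\<^sup>2" using False by simp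
  ultimately have "norm \<zeta> / (max (norm \<zeta>) \<epsilon>)\<^sup>2 \<le> norm \<zeta> / (norm \<zeta>)\<^sup>2"
    using False by (intro divide_left_mono) (auto simp: zero_less_mult_iff less_max_iff_disj)
  then show ?thesis
    unfolding truncated_kernel_def norm_divide norm_of_real complex_mod_cnj
    using False by (simp add: power2_eq_square)
qed (simp add: truncated_kernel_def)

lemma continuous_on_truncated_kernel:
  assumes "\<epsilon> > 0" "continuous_on A h"
  shows "continuous_on A (\<lambda>z. truncated_kernel \<epsilon> (h z))"
  unfolding truncated_kernel_def
  by (intro continuous_intros assms(2)) (use assms(1) in \<open>auto simp: max_def\<close>)

text \<open>Outside the disc the derivative is complex linear and contributes nothing to the dbar
  derivative; inside it is conjugate linear and contributes the constant that replaces the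
  pole.\<close>

lemma has_derivative_truncated_kernel:
  assumes "\<epsilon> > 0" "norm \<zeta> \<noteq> \<epsilon>"
  shows "(truncated_kernel \<epsilon> has_derivative
    (\<lambda>h. if norm \<zeta> < \<epsilon> then cnj h / of_real (\<epsilon>\<^sup>2) else - h / \<zeta>\<^sup>2)) (at \<zeta>)"
proof (cases "norm \<zeta> < \<epsilon>")
  case True
  have "((\<lambda>\<zeta>. cnj \<zeta> / of_real (\<epsilon>\<^sup>2)) has_derivative (\<lambda>h. cnj h / of_real (\<epsilon>\<^sup>2))) (at \<zeta>)"
    by (rule bounded_linear_imp_has_derivative)
      (intro bounded_linear_divide[THEN bounded_linear_compose] bounded_linear_cnj)
  then have "(truncated_kernel \<epsilon> has_derivative (\<lambda>h. cnj h / of_real (\<epsilon>\<^sup>2))) (at \<zeta>)"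
    by (rule has_derivative_transform_within_open[where s = "ball 0 \<epsilon>"])
      (use True in \<open>auto simp: truncated_kernel_inside\<close>)
  then show ?thesis using True by simp
next
  case False
  then have gt: "norm \<zeta> > \<epsilon>" using assms by simp
  then have "\<zeta> \<noteq> 0" using assms(1) by auto
  then have "((\<lambda>\<zeta>. 1 / \<zeta>) has_derivative (\<lambda>h. - h / \<zeta>\<^sup>2)) (at \<zeta>)"
    by (auto intro!: derivative_eq_intros simp: fun_eq_iff field_simps power2_eq_square)
  then have "(truncated_kernel \<epsilon> has_derivative (\<lambda>h. - h / \<zeta>\<^sup>2)) (at \<zeta>)"
    by (rule has_derivative_transform_within_open[where s = "- cball 0 \<epsilon>"])
      (use gt in \<open>auto simp: truncated_kernel_outside\<close>)
  then show ?thesis using False by simp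
qed

lemma has_vector_derivative_horizontal:
  assumes "(G has_derivative G') (at (Complex x y))"
  shows "((\<lambda>s. G (Complex s y)) has_vector_derivative G' 1) (at x)"
proof -
  interpret G': bounded_linear G' using assms by (rule has_derivative_bounded_linear)
  have "((\<lambda>s. Complex s y) has_derivative of_real) (at x)"
    unfolding Complex_eq by (auto intro!: derivative_eq_intros)
  from has_derivative_compose[OF this assms]
  have "((\<lambda>s. G (Complex s y)) has_derivative (\<lambda>h. G' (of_real h))) (at x)" .
  moreover have "G' (of_real h) = h *\<^sub>R G' 1" for h
    by (metis G'.scaleR of_real_def)
  ultimately show ?thesis by (simp add: has_vector_derivative_def)
qed

lemma has_vector_derivative_vertical:
  assumes "(G has_derivative G') (at (Complex x y))"
  shows "((\<lambda>s. G (Complex x s)) has_vector_derivative G' \<i>) (at y)"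
proof -
  interpret G': bounded_linear G' using assms by (rule has_derivative_bounded_linear)
  have "((\<lambda>s. Complex x s) has_derivative (\<lambda>h. \<i> * of_real h)) (at y)"
    unfolding Complex_eq by (auto intro!: derivative_eq_intros)
  from has_derivative_compose[OF this assms]
  have "((\<lambda>s. G (Complex x s)) has_derivative (\<lambda>h. G' (\<i> * of_real h))) (at y)" .
  moreover have "G' (\<i> * of_real h) = h *\<^sub>R G' \<i>" for h
    by (metis G'.scaleR mult.commute scaleR_conv_of_real)
  ultimately show ?thesis by (simp add: has_vector_derivative_def)
qed

text \<open>Makes the circle an admissible exceptional set for Green's theorem: solving its equation
  for the abscissa leaves at most two points.\<close>

lemma finite_horizontal_sphere: "finite {x. Complex x y \<in> sphere z0 \<epsilon>}"
proof (rule finite_subset)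
  let ?r = "sqrt (\<epsilon>\<^sup>2 - (y - Im z0)\<^sup>2)"
  show "{x. Complex x y \<in> sphere z0 \<epsilon>} \<subseteq> {Re z0 + ?r, Re z0 - ?r}"
  proof
    fix x assume "x \<in> {x. Complex x y \<in> sphere z0 \<epsilon>}"
    then have "norm (Complex x y - z0) = \<epsilon>" by (simp add: dist_norm norm_minus_commute)
    then have "(x - Re z0)\<^sup>2 + (y - Im z0)\<^sup>2 = \<epsilon>\<^sup>2" by (auto simp: cmod_power2[symmetric] cmod_power2)
    then have "?r = \<bar>x - Re z0\<bar>" by (metis add_diff_cancel_right' real_sqrt_abs)
    then show "x \<in> {Re z0 + ?r, Re z0 - ?r}" by auto
  qed
qed simp

lemma finite_vertical_sphere: "finite {y. Complex x y \<in> sphere z0 \<epsilon>}"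
proof (rule finite_subset)
  let ?r = "sqrt (\<epsilon>\<^sup>2 - (x - Re z0)\<^sup>2)"
  show "{y. Complex x y \<in> sphere z0 \<epsilon>} \<subseteq> {Im z0 + ?r, Im z0 - ?r}"
  proof
    fix y assume "y \<in> {y. Complex x y \<in> sphere z0 \<epsilon>}"
    then have "norm (Complex x y - z0) = \<epsilon>" by (simp add: dist_norm norm_minus_commute)
    then have "(x - Re z0)\<^sup>2 + (y - Im z0)\<^sup>2 = \<epsilon>\<^sup>2" by (auto simp: cmod_power2[symmetric] cmod_power2)
    then have "?r = \<bar>y - Im z0\<bar>" by (metis add_diff_cancel_left' real_sqrt_abs)
    then show "y \<in> {Im z0 + ?r, Im z0 - ?r}" by auto
  qed
qed simp

lemma
  fixes c :: "'b::{banach, second_countable_topology}" and z0 :: complex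
  shows set_integrable_const_ball: "set_integrable lborel (ball z0 r) (\<lambda>_. c)"
    and set_integral_const_ball: "r \<ge> 0 \<Longrightarrow> (LINT z:ball z0 r|lborel. c) = (pi * r\<^sup>2) *\<^sub>R c"
proof -
  have fin: "emeasure lborel (ball z0 r) < \<infinity>" by (rule emeasure_lborel_ball_finite)
  show "set_integrable lborel (ball z0 r) (\<lambda>_. c)"
    unfolding set_integrable_def by (rule integrable_scaleR_left) (use fin in auto)
  assume "r \<ge> 0"
  then have "measure lborel (ball z0 r) = pi * r\<^sup>2"
    using content_ball[of r z0] by (simp add: unit_ball_vol_2)
  then show "(LINT z:ball z0 r|lborel. c) = (pi * r\<^sup>2) *\<^sub>R c"
    using fin by (simp add: set_lebesgue_integral_def)
qed

lemma ball_average_tendsto: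
  fixes g :: "complex \<Rightarrow> 'b::euclidean_space"
  assumes D: "open D" "z0 \<in> D" and g: "continuous_on D g" and int: "set_integrable lborel D g"
    and eps: "\<And>n. \<epsilon> n > 0" "\<epsilon> \<longlonglongrightarrow> 0"
  shows "(\<lambda>n. (1 / (\<epsilon> n)\<^sup>2) *\<^sub>R (LINT z:D \<inter> ball z0 (\<epsilon> n)|lborel. g z)) \<longlonglongrightarrow> pi *\<^sub>R g z0"
proof (rule tendstoI)
  fix e :: real assume e: "e > 0"
  \<comment> \<open>The rescaled integral will be off by at most \<open>pi * e'\<close>, and
    \<open>pi < 4\<close>.\<close>
  define e' where "e' = e / 4"
  have e': "e' > 0" using e by (simp add: e'_def)
  obtain r where r: "r > 0" "ball z0 r \<subseteq> D" using D openE by blast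
  have "isCont g z0" using g D by (simp add: continuous_on_eq_continuous_at)
  then obtain d where d: "d > 0" "\<And>z. dist z z0 < d \<Longrightarrow> dist (g z) (g z0) < e'"
    using e' unfolding continuous_at_eps_delta dist_norm by blast
  have "\<forall>\<^sub>F n in sequentially. \<epsilon> n < min r d"
    using order_tendstoD(2)[OF eps(2), of "min r d"] r d by simp
  then show "\<forall>\<^sub>F n in sequentially.
      dist ((1 / (\<epsilon> n)\<^sup>2) *\<^sub>R (LINT z:D \<inter> ball z0 (\<epsilon> n)|lborel. g z)) (pi *\<^sub>R g z0) < e"
  proof eventually_elim
    case (elim n)
    let ?B = "ball z0 (\<epsilon> n)"
    have DB: "D \<inter> ?B = ?B" using elim r by auto
    have iB: "set_integrable lborel ?B g"
      using set_integrable_subset[OF int, of ?B] DB by auto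
    note ic = set_integrable_const_ball[of z0 "\<epsilon> n"]
    note cB = set_integral_const_ball[of "\<epsilon> n" z0, OF less_imp_le[OF eps(1)]]
    have "norm ((LINT z:?B|lborel. g z) - (pi * (\<epsilon> n)\<^sup>2) *\<^sub>R g z0) = norm (LINT z:?B|lborel. g z - g z0)"
      using set_integral_diff(2)[OF iB ic, of "g z0"] by (simp add: cB)
    also have "\<dots> \<le> (LINT z:?B|lborel. norm (g z - g z0))"
      by (rule set_integral_norm_bound) (intro set_integral_diff iB ic)
    also have "\<dots> \<le> (LINT z:?B|lborel. e')"
    proof (rule set_integral_mono)
      show "set_integrable lborel ?B (\<lambda>z. norm (g z - g z0))"
        by (intro set_integrable_norm set_integral_diff iB ic)
      show "norm (g z - g z0) \<le> e'" if "z \<in> ?B" for z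
        using d(2)[of z] that elim by (simp add: dist_norm norm_minus_commute less_imp_le)
    qed (rule ic)
    also have "\<dots> = (pi * (\<epsilon> n)\<^sup>2) * e'" by (simp add: cB)
    finally have le: "norm ((LINT z:?B|lborel. g z) - (pi * (\<epsilon> n)\<^sup>2) *\<^sub>R g z0) \<le> pi * (\<epsilon> n)\<^sup>2 * e'" .
    have "(1 / (\<epsilon> n)\<^sup>2) *\<^sub>R (LINT z:?B|lborel. g z) - pi *\<^sub>R g z0
        = (1 / (\<epsilon> n)\<^sup>2) *\<^sub>R ((LINT z:?B|lborel. g z) - (pi * (\<epsilon> n)\<^sup>2) *\<^sub>R g z0)"
      using eps(1)[of n] by (simp add: scaleR_diff_right)
    then have "dist ((1 / (\<epsilon> n)\<^sup>2) *\<^sub>R (LINT z:?B|lborel. g z)) (pi *\<^sub>R g z0)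
        = (1 / (\<epsilon> n)\<^sup>2) * norm ((LINT z:?B|lborel. g z) - (pi * (\<epsilon> n)\<^sup>2) *\<^sub>R g z0)"
      by (simp add: dist_norm)
    also have "\<dots> \<le> (1 / (\<epsilon> n)\<^sup>2) * (pi * (\<epsilon> n)\<^sup>2 * e')"
      by (rule mult_left_mono[OF le]) simp
    also have "\<dots> = pi * e'" using eps(1)[of n] by simp
    also have "\<dots> < e" using e pi_less_4 by (simp add: e'_def)
    finally show ?case by (simp only: DB)
  qed
qed

section \<open>Green's theorem in complex form and the limit of the truncated kernel\<close>

locale complex_structure_boundary =
  oriented_C1_boundary D I c c' + complex_structure J
  for D :: "complex set" and I :: "'i set" and c c' :: "'i \<Rightarrow> real \<Rightarrow> complex"
    and J :: "'b::euclidean_space \<Rightarrow> 'b"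
begin

text \<open>The two boundary sums combine through
  \<open>Im a *\<^sub>R v - J (Re a *\<^sub>R v) = - J (cs a v)\<close>. The integrand
  \<open>p + J q\<close> is twice the dbar derivative of \<open>u\<close>.\<close>

lemma Green_dbar:
  assumes cont: "continuous_on (closure D) u"
    and p: "set_integrable lborel D p" and q: "set_integrable lborel D q"
    and E: "\<And>y. finite {x. Complex x y \<in> E}" "\<And>x. finite {y. Complex x y \<in> E}"
    and derp: "\<And>x y. Complex x y \<in> D - E \<Longrightarrow>
      ((\<lambda>s. u (Complex s y)) has_vector_derivative p (Complex x y)) (at x)"
    and derq: "\<And>x y. Complex x y \<in> D - E \<Longrightarrow>
      ((\<lambda>s. u (Complex x s)) has_vector_derivative q (Complex x y)) (at y)"
  shows "(LINT z:D|lborel. p z + J (q z))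
    = - J (\<Sum>i\<in>I. integral {0..1} (\<lambda>t. cs (c' i t) (u (c i t))))"
proof -
  have contu: "continuous_on {0..1} (\<lambda>t. u (c i t))" if "i \<in> I" for i
    by (rule continuous_on_compose2[OF cont continuous_on_c[OF that]]) (use c_in_closure that in auto)
  have Jq: "set_integrable lborel D (\<lambda>z. J (q z))" "(LINT z:D|lborel. J (q z)) = J (LINT z:D|lborel. q z)"
  proof -
    have eq: "indicator D z *\<^sub>R J (q z) = J (indicator D z *\<^sub>R q z)" for z by (simp add: J_scaleR)
    show "set_integrable lborel D (\<lambda>z. J (q z))"
      using q unfolding set_integrable_def eq by (rule integrable_bounded_linear[OF bounded_linear_J])
    show "(LINT z:D|lborel. J (q z)) = J (LINT z:D|lborel. q z)"
      using q unfolding set_integrable_def set_lebesgue_integral_def eq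
      by (rule integral_bounded_linear[OF bounded_linear_J])
  qed
  have b: "integral {0..1} (\<lambda>t. cs (c' i t) (u (c i t)))
      = integral {0..1} (\<lambda>t. Re (c' i t) *\<^sub>R u (c i t)) + J (integral {0..1} (\<lambda>t. Im (c' i t) *\<^sub>R u (c i t)))"
    if i: "i \<in> I" for i
  proof -
    have 1: "(\<lambda>t. Re (c' i t) *\<^sub>R u (c i t)) integrable_on {0..1}"
      "(\<lambda>t. Im (c' i t) *\<^sub>R u (c i t)) integrable_on {0..1}"
      by (intro integrable_continuous_interval continuous_intros cont'[OF i] contu[OF i])+
    have "((\<lambda>t. Re (c' i t) *\<^sub>R u (c i t) + J (Im (c' i t) *\<^sub>R u (c i t))) has_integral
      integral {0..1} (\<lambda>t. Re (c' i t) *\<^sub>R u (c i t)) + J (integral {0..1} (\<lambda>t. Im (c' i t) *\<^sub>R u (c i t)))) {0..1}"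
      using 1 has_integral_linear[OF integrable_integral[OF 1(2)] bounded_linear_J]
      by (intro has_integral_add integrable_integral) (auto simp: o_def)
    then show ?thesis by (simp add: cs_def J_scaleR integral_unique)
  qed
  have "(LINT z:D|lborel. p z + J (q z)) = (LINT z:D|lborel. p z) + J (LINT z:D|lborel. q z)"
    using set_integral_add(2)[OF p Jq(1)] Jq(2) by simp
  also have "\<dots> = (\<Sum>i\<in>I. integral {0..1} (\<lambda>t. Im (c' i t) *\<^sub>R u (c i t)))
      - J (\<Sum>i\<in>I. integral {0..1} (\<lambda>t. Re (c' i t) *\<^sub>R u (c i t)))"
    using Green_horizontal[OF cont p E(1) derp] Green_vertical[OF cont q E(2) derq]
    by (simp add: J_minus)
  also have "\<dots> = - J (\<Sum>i\<in>I. integral {0..1} (\<lambda>t. cs (c' i t) (u (c i t))))"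
    by (simp add: b sum.distrib J_add linear_sum[OF linear_J] sum_negf)
  finally show ?thesis .
qed

lemma continuous_Cauchy_boundary_integrand:
  assumes z0: "z0 \<in> D" and g: "continuous_on (closure D) g" and i: "i \<in> I"
  shows "continuous_on {0..1} (\<lambda>t. cs (c' i t / (c i t - z0)) (g (c i t)))"
proof -
  have "c i t \<noteq> z0" if "t \<in> {0..1}" for t
    using frontier_D frontier_disjoint_eq[of D] open_D z0 i that unfolding path_image_def by blast
  then show ?thesis
    by (intro cs.continuous_on continuous_intros cont'[OF i] continuous_on_c[OF i]
        continuous_on_compose2[OF g continuous_on_c[OF i]]) (use c_in_closure i in auto)
qed

text \<open>Integrability and formula rest on the same dominated convergence: the kernels
  \<open>K n\<close> tend to \<open>1 / (z - z0)\<close> below an integrable majorant, while the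
  discs shrink to the value at \<open>z0\<close>.\<close>

lemma
  assumes z0: "z0 \<in> D" and g: "continuous_on (closure D) g"
    and P: "continuous_on (closure D) P" and Q: "continuous_on (closure D) Q"
    and der_g: "\<And>z. z \<in> D \<Longrightarrow> (g has_derivative (\<lambda>h. Re h *\<^sub>R P z + Im h *\<^sub>R Q z)) (at z)"
  shows set_integrable_Cauchy_kernel_dbar:
      "set_integrable lborel D (\<lambda>z. cs (1 / (z - z0)) (P z + J (Q z)))"
    and Cauchy_Pompeiu: "(2 * pi) *\<^sub>R g z0 =
      - J (\<Sum>i\<in>I. integral {0..1} (\<lambda>t. cs (c' i t / (c i t - z0)) (g (c i t))))
      - (LINT z:D|lborel. cs (1 / (z - z0)) (P z + J (Q z)))"
proof -
  define H where "H z = P z + J (Q z)" for z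
  have H: "continuous_on (closure D) H"
    unfolding H_def by (intro continuous_intros P bounded_linear.continuous_on[OF bounded_linear_J] Q)
  have compD: "compact (closure D)" using bounded_D by simp
  have Db: "D \<in> sets borel" using open_D by simp
  have intD: "set_integrable lborel A f" if "continuous_on (closure D) f" "A \<in> sets borel" "A \<subseteq> D"
    for f :: "complex \<Rightarrow> 'b" and A
    by (rule set_integrable_continuous_on_compact[OF compD that(1,2)]) (use that closure_subset in auto)
  obtain M where M: "\<And>z. z \<in> D \<Longrightarrow> norm (H z) \<le> M"
    using compact_imp_bounded[OF compact_continuous_image[OF H compD]] closure_subset
    unfolding bounded_iff by blast
  obtain C where C: "C > 0" "\<And>a v. norm (cs a v) \<le> norm a * norm v * C"
    using cs.pos_bounded by blast
  have dom: "set_integrable lborel D (\<lambda>z. (M * C) *\<^sub>R (1 / norm (z - z0)))"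
    by (intro set_integrable_scaleR_right set_integrable_inverse_dist Db bounded_D)
  have bound: "norm (cs a (H z)) \<le> M * C * (1 / norm (z - z0))"
    if "z \<in> D" "norm a \<le> 1 / norm (z - z0)" for a z
  proof -
    have "norm (cs a (H z)) \<le> norm a * norm (H z) * C" by (rule C(2))
    also have "\<dots> \<le> 1 / norm (z - z0) * M * C"
      using M[OF that(1)] that(2) C(1) by (intro mult_right_mono mult_mono) auto
    finally show ?thesis by (simp add: mult_ac)
  qed
  obtain r where r: "r > 0" "ball z0 r \<subseteq> D" using open_D z0 openE by blast
  \<comment> \<open>Radii of at most \<open>r\<close> keep every truncation disc inside
    \<open>D\<close>, so on the boundary curves the kernel already equals
    \<open>1 / (z - z0)\<close>.\<close>
  define \<epsilon> where "\<epsilon> n = r / real (Suc n)" for n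
  have eps: "\<epsilon> n > 0" "\<epsilon> n \<le> r" for n
    using r(1) by (auto simp: \<epsilon>_def field_simps)
  have eps0: "\<epsilon> \<longlonglongrightarrow> 0"
    unfolding \<epsilon>_def[abs_def] by (rule LIMSEQ_Suc[OF lim_const_over_n])
  define K where "K n z = truncated_kernel (\<epsilon> n) (z - z0)" for n z
  have contK: "continuous_on A (K n)" for A n
    unfolding K_def by (intro continuous_on_truncated_kernel eps continuous_intros)
  \<comment> \<open>The boundary term does not depend on \<open>n\<close>; only the area terms move
    in the limit.\<close>
  define L where "L = - J (\<Sum>i\<in>I. integral {0..1} (\<lambda>t. cs (c' i t / (c i t - z0)) (g (c i t))))"
  have step: "L = (LINT z:D|lborel. cs (K n z) (H z))
      + 2 *\<^sub>R ((1 / (\<epsilon> n)\<^sup>2) *\<^sub>R (LINT z:D \<inter> ball z0 (\<epsilon> n)|lborel. g z))" for n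
  proof -
    let ?e = "\<epsilon> n"
    let ?B = "ball z0 ?e"
    \<comment> \<open>\<open>a\<close> and \<open>b\<close> are the partial derivatives of
      \<open>K n\<close>, that is, its derivative applied to 1 and to \<open>\<i>\<close>. Hence
      \<open>a z + \<i> * b z\<close> is \<open>2 / ?e^2\<close> in the disc and 0 outside; on the
      circle itself the second branch is a default value.\<close>
    define a where "a z = (if norm (z - z0) < ?e then 1 / of_real (?e\<^sup>2) else - 1 / (z - z0)\<^sup>2)" for z
    define b where "b z = (if norm (z - z0) < ?e then - \<i> / of_real (?e\<^sup>2) else - \<i> / (z - z0)\<^sup>2)" for z
    define u where "u z = cs (K n z) (g z)" for z
    define p where "p z = cs (K n z) (P z) + cs (a z) (g z)" for z
    define q where "q z = cs (K n z) (Q z) + cs (b z) (g z)" for z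
    \<comment> \<open>The coefficients jump across the circle, so \<open>D\<close> is cut along it;
      off the open disc the pole is absent and continuity on a compact set applies.\<close>
    have split: "set_integrable lborel D (\<lambda>z. cs (if norm (z - z0) < ?e then k else l / (z - z0)\<^sup>2) (g z))"
      for k l
    proof -
      have "set_integrable lborel (D \<inter> ?B) (\<lambda>z. cs k (g z))"
        by (intro intD cs.continuous_on continuous_intros g) (use open_D in auto)
      moreover have "set_integrable lborel (D - ?B) (\<lambda>z. cs (l / (z - z0)\<^sup>2) (g z))"
      proof (rule set_integrable_continuous_on_compact[where K = "closure D - ?B"])
        show "continuous_on (closure D - ?B) (\<lambda>z. cs (l / (z - z0)\<^sup>2) (g z))"
          by (intro cs.continuous_on continuous_intros continuous_on_subset[OF g]) (use eps[of n] in auto)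
      qed (use compact_diff[OF compD] Db closure_subset in auto)
      ultimately have "set_integrable lborel ((D \<inter> ?B) \<union> (D - ?B))
          (\<lambda>z. cs (if norm (z - z0) < ?e then k else l / (z - z0)\<^sup>2) (g z))"
      proof (intro set_integrable_Un)
        assume "set_integrable lborel (D \<inter> ?B) (\<lambda>z. cs k (g z))"
        then show "set_integrable lborel (D \<inter> ?B) (\<lambda>z. cs (if norm (z - z0) < ?e then k else l / (z - z0)\<^sup>2) (g z))"
          by (rule iffD1[OF set_integrable_cong[OF refl refl], rotated])
            (auto simp: dist_norm norm_minus_commute)
      next
        assume "set_integrable lborel (D - ?B) (\<lambda>z. cs (l / (z - z0)\<^sup>2) (g z))"
        then show "set_integrable lborel (D - ?B) (\<lambda>z. cs (if norm (z - z0) < ?e then k else l / (z - z0)\<^sup>2) (g z))"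
          by (rule iffD1[OF set_integrable_cong[OF refl refl], rotated])
            (auto simp: dist_norm norm_minus_commute)
      qed (use Db in auto)
      also have "(D \<inter> ?B) \<union> (D - ?B) = D" by blast
      finally show ?thesis .
    qed
    have contc: "continuous_on (closure D) (\<lambda>z. cs (K n z) (f z))" if "continuous_on (closure D) f" for f
      by (intro cs.continuous_on contK that)
    have derG: "(u has_derivative (\<lambda>h. cs (K n z) (Re h *\<^sub>R P z + Im h *\<^sub>R Q z)
        + cs (if norm (z - z0) < ?e then cnj h / of_real (?e\<^sup>2) else - h / (z - z0)\<^sup>2) (g z))) (at z)"
      if z: "z \<in> D - sphere z0 ?e" for z
    proof -
      have "norm (z - z0) \<noteq> ?e" using z by (auto simp: dist_norm norm_minus_commute)
      have "((\<lambda>z. z - z0) has_derivative (\<lambda>h. h)) (at z)"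
        by (auto intro!: derivative_eq_intros)
      from has_derivative_compose[OF this has_derivative_truncated_kernel[OF eps(1) \<open>norm (z - z0) \<noteq> ?e\<close>]]
      have "(K n has_derivative
          (\<lambda>h. if norm (z - z0) < ?e then cnj h / of_real (?e\<^sup>2) else - h / (z - z0)\<^sup>2)) (at z)"
        unfolding K_def .
      from cs.FDERIV[OF this der_g] z show ?thesis unfolding u_def[abs_def] by blast
    qed
    have "(LINT z:D|lborel. p z + J (q z))
        = - J (\<Sum>i\<in>I. integral {0..1} (\<lambda>t. cs (c' i t) (u (c i t))))"
    proof (rule Green_dbar[where E = "sphere z0 ?e"])
      show "continuous_on (closure D) u" unfolding u_def by (rule contc[OF g])
      show "set_integrable lborel D p"
        unfolding p_def a_def by (intro set_integral_add split[of _ "- 1"] intD contc P Db order_refl)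
      show "set_integrable lborel D q"
        unfolding q_def b_def by (intro set_integral_add split[of _ "- \<i>"] intD contc Q Db order_refl)
      show "((\<lambda>s. u (Complex s y)) has_vector_derivative p (Complex x y)) (at x)"
        if "Complex x y \<in> D - sphere z0 ?e" for x y
        using has_vector_derivative_horizontal[OF derG[OF that]] by (auto simp: p_def a_def split: if_splits)
      show "((\<lambda>s. u (Complex x s)) has_vector_derivative q (Complex x y)) (at y)"
        if "Complex x y \<in> D - sphere z0 ?e" for x y
        using has_vector_derivative_vertical[OF derG[OF that]] by (auto simp: q_def b_def split: if_splits)
    qed (rule finite_horizontal_sphere finite_vertical_sphere)+
    also have "(\<Sum>i\<in>I. integral {0..1} (\<lambda>t. cs (c' i t) (u (c i t))))
        = (\<Sum>i\<in>I. integral {0..1} (\<lambda>t. cs (c' i t / (c i t - z0)) (g (c i t))))"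
    proof (rule sum.cong[OF refl], rule integral_cong)
      fix i t assume it: "i \<in> I" "t \<in> {0..1::real}"
      then have "c i t \<in> frontier D" unfolding frontier_D path_image_def by blast
      then have "c i t \<notin> ball z0 r" using r(2) open_D frontier_disjoint_eq[of D] by blast
      then have "?e \<le> norm (c i t - z0)" using eps(2)[of n] by (simp add: dist_norm norm_minus_commute)
      then show "cs (c' i t) (u (c i t)) = cs (c' i t / (c i t - z0)) (g (c i t))"
        by (simp add: u_def K_def truncated_kernel_outside cs_mult[symmetric])
    qed
    finally have "L = (LINT z:D|lborel. p z + J (q z))" by (simp add: L_def)
    also have "\<dots> = (LINT z:D|lborel. cs (K n z) (H z) + indicator ?B z *\<^sub>R ((2 / ?e\<^sup>2) *\<^sub>R g z))"
    proof (rule set_lebesgue_integral_cong)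
      show "\<forall>z. z \<in> D \<longrightarrow> p z + J (q z) = cs (K n z) (H z) + indicator ?B z *\<^sub>R ((2 / ?e\<^sup>2) *\<^sub>R g z)"
      proof (intro allI impI)
        fix z
        \<comment> \<open>Product rule: differentiating \<open>g\<close> gives \<open>H\<close>,
          differentiating the kernel gives \<open>a z + \<i> * b z\<close>.\<close>
        have "p z + J (q z) = cs (K n z) (H z) + cs (a z + \<i> * b z) (g z)"
          by (simp add: p_def q_def H_def J_add J_cs cs.add_right cs.add_left cs_mult cs_ii)
        moreover have "a z + \<i> * b z = of_real (indicator ?B z * (2 / ?e\<^sup>2))"
          by (auto simp: a_def b_def indicator_def dist_norm norm_minus_commute)
        ultimately show "p z + J (q z) = cs (K n z) (H z) + indicator ?B z *\<^sub>R ((2 / ?e\<^sup>2) *\<^sub>R g z)"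
          by (simp only: cs_of_real scaleR_scaleR)
      qed
    qed (use Db in auto)
    also have "\<dots> = (LINT z:D|lborel. cs (K n z) (H z)) + (LINT z:D|lborel. indicator ?B z *\<^sub>R ((2 / ?e\<^sup>2) *\<^sub>R g z))"
    proof (rule set_integral_add(2))
      show "set_integrable lborel D (\<lambda>z. cs (K n z) (H z))" by (intro intD contc H Db order_refl)
      have "set_integrable lborel (D \<inter> ?B) (\<lambda>z. (2 / ?e\<^sup>2) *\<^sub>R g z)"
        by (intro intD continuous_intros g) (use open_D in auto)
      then show "set_integrable lborel D (\<lambda>z. indicator ?B z *\<^sub>R ((2 / ?e\<^sup>2) *\<^sub>R g z))"
        by (simp add: set_integrable_def indicator_inter_arith mult.assoc)
    qed
    also have "(LINT z:D|lborel. indicator ?B z *\<^sub>R ((2 / ?e\<^sup>2) *\<^sub>R g z))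
        = (LINT z:D \<inter> ?B|lborel. (2 / ?e\<^sup>2) *\<^sub>R g z)"
      unfolding set_lebesgue_integral_def
      by (rule Bochner_Integration.integral_cong) (auto simp: indicator_def)
    finally show ?thesis by simp
  qed
  have lim: "(\<lambda>n. K n z) \<longlonglongrightarrow> 1 / (z - z0)" for z
  proof (cases "z = z0")
    \<comment> \<open>Convergence also holds at the pole: every \<open>K n z0\<close> is 0, and so
      is \<open>1 / 0\<close>.\<close>
    case True
    then show ?thesis by (simp add: K_def truncated_kernel_def)
  next
    case False
    then have "\<forall>\<^sub>F n in sequentially. \<epsilon> n < norm (z - z0)"
      using order_tendstoD(2)[OF eps0, of "norm (z - z0)"] by simp
    then have "\<forall>\<^sub>F n in sequentially. K n z = 1 / (z - z0)"
      by eventually_elim (simp add: K_def truncated_kernel_outside)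
    then show ?thesis by (rule tendsto_eventually)
  qed
  have meas: "(\<lambda>z. indicator D z *\<^sub>R cs (K n z) (H z)) \<in> borel_measurable lborel" for n
    using borel_measurable_continuous_on_indicator[OF Db, of "\<lambda>z. cs (K n z) (H z)"]
      cs.continuous_on[OF contK continuous_on_subset[OF H closure_subset]] by simp
  have limH: "(\<lambda>n. indicator D z *\<^sub>R cs (K n z) (H z)) \<longlonglongrightarrow> indicator D z *\<^sub>R cs (1 / (z - z0)) (H z)" for z
    by (intro tendsto_scaleR tendsto_const cs.tendsto lim)
  have measL: "(\<lambda>z. indicator D z *\<^sub>R cs (1 / (z - z0)) (H z)) \<in> borel_measurable lborel"
    by (rule borel_measurable_LIMSEQ_metric[OF meas limH])
  have domi: "AE z in lborel. norm (indicator D z *\<^sub>R cs (K n z) (H z))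
      \<le> indicator D z *\<^sub>R ((M * C) *\<^sub>R (1 / norm (z - z0)))" for n
    using bound norm_truncated_kernel_le unfolding K_def by (intro AE_I2) (auto simp: indicator_def)
  have int1: "set_integrable lborel D (\<lambda>z. cs (1 / (z - z0)) (H z))"
    unfolding set_integrable_def
    by (rule integrable_dominated_convergence[OF measL meas dom[unfolded set_integrable_def] AE_I2[OF limH] domi])
  then show "set_integrable lborel D (\<lambda>z. cs (1 / (z - z0)) (P z + J (Q z)))" by (simp add: H_def)
  have "(\<lambda>n. LINT z:D|lborel. cs (K n z) (H z)) \<longlonglongrightarrow> (LINT z:D|lborel. cs (1 / (z - z0)) (H z))"
    unfolding set_lebesgue_integral_def
    by (rule integral_dominated_convergence[OF measL meas dom[unfolded set_integrable_def] AE_I2[OF limH] domi])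
  moreover have "(\<lambda>n. (1 / (\<epsilon> n)\<^sup>2) *\<^sub>R (LINT z:D \<inter> ball z0 (\<epsilon> n)|lborel. g z)) \<longlonglongrightarrow> pi *\<^sub>R g z0"
    by (rule ball_average_tendsto[OF open_D z0 continuous_on_subset[OF g closure_subset] intD[OF g Db order_refl] eps(1) eps0])
  ultimately have "(\<lambda>n. (LINT z:D|lborel. cs (K n z) (H z))
      + 2 *\<^sub>R ((1 / (\<epsilon> n)\<^sup>2) *\<^sub>R (LINT z:D \<inter> ball z0 (\<epsilon> n)|lborel. g z)))
    \<longlonglongrightarrow> (LINT z:D|lborel. cs (1 / (z - z0)) (H z)) + 2 *\<^sub>R (pi *\<^sub>R g z0)"
    by (intro tendsto_add tendsto_scaleR[OF tendsto_const])
  then have "(\<lambda>n. L) \<longlonglongrightarrow> (LINT z:D|lborel. cs (1 / (z - z0)) (H z)) + 2 *\<^sub>R (pi *\<^sub>R g z0)"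
    by (simp only: step[symmetric])
  then have "L = (LINT z:D|lborel. cs (1 / (z - z0)) (H z)) + 2 *\<^sub>R (pi *\<^sub>R g z0)"
    by (simp only: LIMSEQ_const_iff)
  then show "(2 * pi) *\<^sub>R g z0 =
      - J (\<Sum>i\<in>I. integral {0..1} (\<lambda>t. cs (c' i t / (c i t - z0)) (g (c i t))))
      - (LINT z:D|lborel. cs (1 / (z - z0)) (P z + J (Q z)))"
    by (simp add: L_def H_def)
qed

end

subsection \<open>Slice functions on an alternative algebra\<close>

lemma bounded_bilinear_alg_mult:
  "bounded_bilinear ((*) :: 'a::alternative_star_algebra \<Rightarrow> 'a \<Rightarrow> 'a)"
  unfolding bilinear_conv_bounded_bilinear[symmetric] bilinear_def linear_iff
  by (simp add: distrib_mult_left distrib_mult_right scaleR_mult_left scaleR_mult_right)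

interpretation alg: bounded_bilinear "(*) :: 'a::alternative_star_algebra \<Rightarrow> 'a \<Rightarrow> 'a"
  by (rule bounded_bilinear_alg_mult)

lemma alg_one_neq_zero [simp]: "(1::'a::alternative_star_algebra) \<noteq> 0"
proof
  assume "(1::'a) = 0"
  then have "x = 0" for x :: 'a using unit_left[of x] alg.zero_left[of x] by simp
  then show False using nonzero_Basis[where 'a = 'a] nonempty_Basis by blast
qed

lemma star_one: "star (1::'a::alternative_star_algebra) = 1"
  using star_real[of 1, where 'a = 'a] by simp

lemma star_minus: "star (- x) = - star (x::'a::alternative_star_algebra)"
  using star_scaleR[of "- 1" x] by simp

lemma imag_unit_square:
  "J \<in> imag_units \<Longrightarrow> J * J = - (1::'a::alternative_star_algebra)"
  by (simp add: imag_units_def)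

lemma imag_unit_not_real:
  fixes J :: "'a::alternative_star_algebra"
  assumes "J \<in> imag_units"
  shows "J \<noteq> r *\<^sub>R 1"
proof
  assume "J = r *\<^sub>R 1"
  then have "(r * r) *\<^sub>R (1::'a) = - 1"
    using imag_unit_square[OF assms] by (simp add: scaleR_mult_left scaleR_mult_right unit_left)
  then have "(r * r + 1) *\<^sub>R (1::'a) = 0" by (simp add: scaleR_add_left)
  then have "r * r + 1 = 0" by simp
  then show False using zero_le_square[of r] by linarith
qed

text \<open>As \<open>J\<close> is not real, membership in the cone supplies a real trace
  \<open>t\<close> and a real norm \<open>n\<close>. Expanding \<open>J * (t - J)\<close> yields
  \<open>t J = n - 1\<close>, which again forces \<open>t = 0\<close> because \<open>J\<close> is
  not real.\<close>

lemma star_imag_unit: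
  fixes J :: "'a::alternative_star_algebra"
  assumes J: "J \<in> imag_units"
  shows "star J = - J"
proof -
  have "J \<in> quadratic_cone" using J by (simp add: imag_units_def)
  then obtain t n where t: "alg_trace J = t *\<^sub>R 1" and n: "alg_norm J = n *\<^sub>R 1"
    using imag_unit_not_real[OF J] unfolding quadratic_cone_def by blast
  have s: "star J = t *\<^sub>R 1 - J" using t by (simp add: alg_trace_def algebra_simps)
  have "n *\<^sub>R 1 = J * (t *\<^sub>R 1 - J)" using n by (simp add: alg_norm_def s)
  also have "\<dots> = t *\<^sub>R J + 1"
    by (simp add: alg.diff_right scaleR_mult_right unit_right imag_unit_square[OF J])
  finally have tJ: "t *\<^sub>R J = (n - 1) *\<^sub>R 1" by (simp add: scaleR_diff_left)
  have "t = 0"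
  proof (rule ccontr)
    assume "t \<noteq> 0"
    then have "J = ((n - 1) / t) *\<^sub>R 1"
      using tJ by (metis (no_types) divideR_right scaleR_scaleR divide_inverse_commute)
    with imag_unit_not_real[OF J] show False by blast
  qed
  then show ?thesis using s by simp
qed

lemma bounded_linear_line_embed: "bounded_linear (line_embed (J::'a::alternative_star_algebra))"
  unfolding linear_conv_bounded_linear[symmetric] line_embed_def linear_iff
  by (simp add: algebra_simps)

lemma line_embed_ii: "line_embed J \<i> = J"
  for J :: "'a::alternative_star_algebra"
  by (simp add: line_embed_def)

lemma star_line_embed:
  fixes J :: "'a::alternative_star_algebra"
  assumes J: "J \<in> imag_units"
  shows "star (line_embed J z) = line_embed J (cnj z)"
  by (simp add: line_embed_def star_add star_scaleR star_one star_imag_unit[OF J])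

text \<open>The trace determines the real part, and the square of what remains determines the
  imaginary part up to sign. The second alternative is the same point seen from the opposite
  unit.\<close>

lemma line_embed_eq_cases:
  fixes J I :: "'a::alternative_star_algebra"
  assumes J: "J \<in> imag_units" and I: "I \<in> imag_units" and eq: "line_embed J z = line_embed I w"
  shows "w = z \<and> (Im z = 0 \<or> I = J) \<or> w = cnj z \<and> I = - J"
proof -
  have "line_embed J z + star (line_embed J z) = line_embed I w + star (line_embed I w)"
    by (simp only: eq)
  then have "(2 * Re z) *\<^sub>R (1::'a) = (2 * Re w) *\<^sub>R 1"
    by (simp add: star_line_embed[OF J] star_line_embed[OF I]) (simp add: line_embed_def flip: scaleR_add_left)
  then have Re: "Re w = Re z" by simp
  then have v: "Im z *\<^sub>R J = Im w *\<^sub>R I" using eq by (simp add: line_embed_def)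
  then have "(Im z *\<^sub>R J) * (Im z *\<^sub>R J) = (Im w *\<^sub>R I) * (Im w *\<^sub>R I)" by simp
  then have "(Im z * Im z) *\<^sub>R (1::'a) = (Im w * Im w) *\<^sub>R 1"
    by (simp add: scaleR_mult_left scaleR_mult_right imag_unit_square[OF J] imag_unit_square[OF I])
  then have "Im z * Im z = Im w * Im w" by simp
  then have "Im w = Im z \<or> Im w = - Im z" using square_eq_iff by metis
  then show ?thesis
  proof
    assume w: "Im w = Im z"
    then have "w = z" using Re by (simp add: complex_eq_iff)
    moreover have "Im z = 0 \<or> I = J" using v w by auto
    ultimately show ?thesis by blast
  next
    assume w: "Im w = - Im z"
    show ?thesis
    proof (cases "Im z = 0")
      case True
      then show ?thesis using Re w by (simp add: complex_eq_iff)
    next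
      case False
      then have "J = - I" using v w by (simp flip: scaleR_minus_right)
      then show ?thesis using Re w by (simp add: complex_eq_iff)
    qed
  qed
qed

lemma inj_line_embed:
  assumes J: "J \<in> imag_units"
  shows "inj (line_embed J)"
proof (rule injI)
  fix z w assume "line_embed J z = line_embed J w"
  from line_embed_eq_cases[OF J J this] consider "w = z" | "w = cnj z" "J = - J" by blast
  then show "z = w"
  proof cases
    case 2
    then have "2 *\<^sub>R J = 0 *\<^sub>R 1" by (simp add: scaleR_2 eq_neg_iff_add_eq_0)
    then have "J = 0 *\<^sub>R 1" by simp
    with imag_unit_not_real[OF J] show ?thesis by blast
  qed simp
qed

lemma complex_line_eq_range: "complex_line J = range (line_embed J)"
  for J :: "'a::alternative_star_algebra"
proof -
  have "x \<in> range (line_embed J) \<longleftrightarrow> (\<exists>a b. x = a *\<^sub>R 1 + b *\<^sub>R J)" for x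
    by (auto simp: line_embed_def image_iff intro: exI[of _ "Complex _ _"])
  moreover have "x \<in> complex_line J \<longleftrightarrow> (\<exists>a b. x = a *\<^sub>R 1 + b *\<^sub>R J)" for x
    unfolding complex_line_def span_insert span_singleton by (auto simp: algebra_simps)
  ultimately show ?thesis by blast
qed

text \<open>The described value is unique: at a real point the symmetry forces
  \<open>snd (F z) = 0\<close>, so the unit is immaterial; for the opposite unit two signs cancel.
  Symmetry is assumed at the single point \<open>z\<close>, which makes the lemma applicable on the
  closure of \<open>D\<close> and to the kernel away from its poles.\<close>

lemma slice_function_line_embed:
  fixes J :: "'a::alternative_star_algebra"
  assumes J: "J \<in> imag_units" and F: "F (cnj z) = cx_conj (F z)"
  shows "slice_function F (line_embed J z) = fst (F z) + J * snd (F z)"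
  unfolding slice_function_def
proof (rule the_equality)
  show "\<exists>I w. I \<in> imag_units \<and> line_embed J z = line_embed I w \<and>
      fst (F z) + J * snd (F z) = fst (F w) + I * snd (F w)"
    using J by blast
  fix v assume "\<exists>I w. I \<in> imag_units \<and> line_embed J z = line_embed I w \<and> v = fst (F w) + I * snd (F w)"
  then obtain I w where I: "I \<in> imag_units" "line_embed J z = line_embed I w"
    and v: "v = fst (F w) + I * snd (F w)" by blast
  from line_embed_eq_cases[OF J I] show "v = fst (F z) + J * snd (F z)"
  proof (elim disjE conjE)
    assume "w = z" "Im z = 0"
    then have "snd (F z) = - snd (F z)"
      using F by (metis complex_cnj complex_surj cx_conj_def minus_zero snd_conv)
    then have "2 *\<^sub>R snd (F z) = 0" by (simp add: scaleR_2 eq_neg_iff_add_eq_0)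
    then show ?thesis using \<open>w = z\<close> v by (simp add: alg.zero_right)
  next
    assume "w = z" "I = J"
    then show ?thesis using v by simp
  next
    assume "w = cnj z" "I = - J"
    then show ?thesis using v F by (simp add: cx_conj_def alg.minus_left alg.minus_right)
  qed
qed

section \<open>Left multiplication by a fixed imaginary unit\<close>

locale imag_unit =
  fixes J :: "'a::alternative_star_algebra"
  assumes J: "J \<in> imag_units"
begin

sublocale complex_structure "(*) J"
proof (rule complex_structure.intro)
  show "linear ((*) J)"
    by (rule bounded_linear.linear[OF alg.bounded_linear_right])
  show "J * (J * v) = - v" for v
    unfolding left_alternative[symmetric] imag_unit_square[OF J]
    by (simp add: alg.minus_left unit_left)
qed

text \<open>Combined with \<open>cs_mult\<close>, this gives
  \<open>(a * b) * v = a * (b * v)\<close> for \<open>a\<close>, \<open>b\<close> in the plane of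
  \<open>J\<close> and arbitrary \<open>v\<close>, which resolves the brackets of the integrands
  without associativity.\<close>

lemma cs_eq: "cs z v = line_embed J z * v"
  by (simp add: cs_def line_embed_def alg.add_left scaleR_mult_left unit_left)

lemma line_embed_mult: "line_embed J (z * w) = line_embed J z * line_embed J w"
  using cs_mult[of z w 1] by (simp add: cs_eq unit_right)

lemma inverse_wrt_J: "inverse_wrt (*) 1 J = line_embed J (- \<i>)"
proof -
  have "line_embed J (- \<i>) = - J" by (simp add: line_embed_def)
  moreover have "inverse_wrt (*) 1 J = - J"
    unfolding inverse_wrt_def
  proof (rule the_equality)
    show "J * - J = 1 \<and> - J * J = 1"
      by (simp add: alg.minus_left alg.minus_right imag_unit_square[OF J])
    fix v assume "J * v = 1 \<and> v * J = 1"
    then have "J * (J * v) = J" by (simp add: unit_right)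
    then show "v = - J" by (metis J_J minus_minus)
  qed
  ultimately show ?thesis by simp
qed

lemma wedge_star_J: "wedge_star 1 J = line_embed J (2 * \<i>)"
  by (simp add: wedge_star_def star_one star_imag_unit[OF J] unit_left unit_right line_embed_def scaleR_2)

end

text \<open>\<open>cx.cs\<close> is multiplication by complex scalars in the complexified algebra;
  by \<open>cs_mult\<close> successive scalars combine even though \<open>cx_mult\<close> need not
  associate.\<close>

interpretation cx: complex_structure "\<lambda>v :: 'a::alternative_star_algebra complexified. (- snd v, fst v)"
  by (rule complex_structure.intro) (auto simp: linear_iff)

lemma cx_mult_of_complex_left: "cx_mult (cx_of_complex d) v = cx.cs d v"
  and cx_mult_of_complex_right: "cx_mult v (cx_of_complex d) = cx.cs d v"
  by (simp_all add: cx_mult_def cx_of_complex_def cx.cs_def prod_eq_iff scaleR_mult_left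
      scaleR_mult_right unit_left unit_right)

lemma cx_of_complex_eq: "cx_of_complex d = cx.cs d (1, 0)"
  by (simp add: cx_of_complex_def cx.cs_def)

text \<open>A candidate inverse \<open>v\<close> is recovered from \<open>cx.cs d v\<close> by
  applying the scalar \<open>1 / d\<close>, so uniqueness follows from \<open>cs_mult\<close>
  alone.\<close>

lemma inverse_wrt_cx_of_complex:
  assumes "d \<noteq> 0"
  shows "inverse_wrt cx_mult (cx_of_complex 1) (cx_of_complex d)
    = (cx_of_complex (1 / d) :: 'a::alternative_star_algebra complexified)"
  unfolding inverse_wrt_def
proof (rule the_equality)
  show "cx_mult (cx_of_complex d) (cx_of_complex (1 / d)) = (cx_of_complex 1 :: 'a complexified) \<and>
      cx_mult (cx_of_complex (1 / d)) (cx_of_complex d) = (cx_of_complex 1 :: 'a complexified)"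
    unfolding cx_mult_of_complex_left unfolding cx_of_complex_eq
    using assms by (simp flip: cx.cs_mult)
  fix v :: "'a complexified"
  assume "cx_mult (cx_of_complex d) v = cx_of_complex 1 \<and> cx_mult v (cx_of_complex d) = cx_of_complex 1"
  then have "cx.cs (1 / d) (cx.cs d v) = cx.cs (1 / d) (cx_of_complex 1)"
    by (simp add: cx_mult_of_complex_left)
  then show "v = cx_of_complex (1 / d)"
    using assms by (simp add: cx_of_complex_eq flip: cx.cs_mult)
qed

lemma cx_conj_cs: "cx_conj (cx.cs a v) = cx.cs (cnj a) (cx_conj v)"
  by (simp add: cx_conj_def cx.cs_def prod_eq_iff)

lemma bounded_linear_cx_conj:
  "bounded_linear (cx_conj :: 'a::alternative_star_algebra complexified \<Rightarrow> _)"
  unfolding linear_conv_bounded_linear[symmetric] linear_iff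
  by (simp add: cx_conj_def prod_eq_iff)

lemma cx_conj_simps [simp]:
  "cx_conj (cx_of_complex z) = cx_of_complex (cnj z)" "cx_conj (cx_of_alg u) = cx_of_alg u"
  "cx_conj (cx_conj v) = v" "cx_conj (v + w) = cx_conj v + cx_conj w"
  "cx_conj (v - w) = cx_conj v - cx_conj w" "cx_conj (- v) = - cx_conj v"
  "cx_conj (r *\<^sub>R v) = r *\<^sub>R cx_conj v"
  by (simp_all add: cx_conj_def cx_of_complex_def cx_of_alg_def prod_eq_iff)

section \<open>Slice functions and the Cauchy kernel on the plane of \<open>J\<close>\<close>

context imag_unit
begin

definition slice_value :: "'a complexified \<Rightarrow> 'a"
  where "slice_value v = fst v + J * snd v"

lemma bounded_linear_slice_value: "bounded_linear slice_value"
  unfolding linear_conv_bounded_linear[symmetric] linear_iff slice_value_def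
  by (simp add: alg.add_right scaleR_mult_right algebra_simps)

text \<open>Evaluation turns multiplication by \<open>\<i>\<close> into left multiplication by
  \<open>J\<close>; thereby the dbar derivative of the stem function becomes that of its restriction
  to the plane of \<open>J\<close>.\<close>

lemma slice_value_cs: "slice_value (cx.cs a v) = cs a (slice_value v)"
  by (simp add: slice_value_def cx.cs_def cs_def alg.add_right alg.diff_right scaleR_mult_right
      algebra_simps)

text \<open>Trace and norm of \<open>line_embed J w\<close> are real, so \<open>delta_stem\<close>
  is a scalar polynomial in \<open>z\<close>, with roots \<open>w\<close> and
  \<open>cnj w\<close>.\<close>

lemma delta_stem_line_embed:
  "delta_stem (line_embed J w) z = cx_of_complex ((z - w) * (z - cnj w))"
proof -
  have tr: "alg_trace (line_embed J w) = (2 * Re w) *\<^sub>R 1"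
    unfolding alg_trace_def star_line_embed[OF J]
    by (simp add: line_embed_def flip: scaleR_add_left)
  have "alg_norm (line_embed J w) = line_embed J (w * cnj w)"
    by (simp add: alg_norm_def star_line_embed[OF J] line_embed_mult)
  also have "w * cnj w = of_real ((norm w)\<^sup>2)" by (rule complex_norm_square[symmetric])
  finally have nm: "alg_norm (line_embed J w) = ((norm w)\<^sup>2) *\<^sub>R 1"
    by (simp add: line_embed_def flip: of_real_power)
  have alg: "cx_of_alg (r *\<^sub>R 1) = cx_of_complex (of_real r)" for r
    by (simp add: cx_of_alg_def cx_of_complex_def)
  have "delta_stem (line_embed J w) z
      = cx.cs (z * z - z * of_real (2 * Re w) + of_real ((norm w)\<^sup>2)) (1, 0)"
    unfolding delta_stem_def tr nm alg cx_mult_of_complex_left unfolding cx_of_complex_eq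
    by (simp only: cx.cs.add_left cx.cs.diff_left cx.cs_mult)
  also have "z * z - z * of_real (2 * Re w) + of_real ((norm w)\<^sup>2) = (z - w) * (z - cnj w)"
    unfolding complex_norm_square complex_add_cnj[symmetric] by (simp add: algebra_simps)
  finally show ?thesis by (simp add: cx_of_complex_eq)
qed

definition kernel_stem :: "complex \<Rightarrow> complex \<Rightarrow> 'a complexified"
  where "kernel_stem w z = - cx_mult (inverse_wrt cx_mult (cx_of_complex 1) (delta_stem (line_embed J w) z))
                   (cx_of_complex z - cx_of_alg (star (line_embed J w)))"

lemma cauchy_kernel_eq_slice_function:
  "cauchy_kernel x (line_embed J w) = slice_function (kernel_stem w) x"
  by (simp add: cauchy_kernel_def kernel_stem_def[abs_def])

lemma kernel_stem_eq:
  assumes "z \<noteq> w" "z \<noteq> cnj w"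
  shows "kernel_stem w z = - cx.cs (1 / ((z - w) * (z - cnj w)))
    (cx_of_complex z - cx_of_alg (line_embed J (cnj w)))"
proof -
  have "(z - w) * (z - cnj w) \<noteq> 0" using assms by simp
  then show ?thesis
    by (simp only: kernel_stem_def delta_stem_line_embed inverse_wrt_cx_of_complex
        cx_mult_of_complex_left star_line_embed[OF J] not_False_eq_True)
qed

text \<open>Conjugation of \<open>z\<close> exchanges the conjugates of the two linear factors of
  the denominator, and elements of the algebra are fixed by \<open>cx_conj\<close>.\<close>

lemma kernel_stem_cnj:
  assumes "z \<noteq> w" "z \<noteq> cnj w"
  shows "kernel_stem w (cnj z) = cx_conj (kernel_stem w z)"
proof -
  have "cnj z \<noteq> w" "cnj z \<noteq> cnj w" using assms by auto
  then show ?thesis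
    using assms by (simp add: kernel_stem_eq cx_conj_cs mult.commute)
qed

lemma slice_value_kernel_stem:
  assumes "z \<noteq> w" "z \<noteq> cnj w"
  shows "slice_value (kernel_stem w z) = line_embed J (1 / (w - z))"
proof -
  interpret sv: bounded_linear slice_value by (rule bounded_linear_slice_value)
  interpret le: bounded_linear "line_embed J" by (rule bounded_linear_line_embed)
  have "slice_value (cx_of_complex z - cx_of_alg (line_embed J (cnj w))) = line_embed J (z - cnj w)"
    by (simp add: sv.diff le.diff)
      (simp add: slice_value_def cx_of_complex_def cx_of_alg_def line_embed_def scaleR_mult_right
        unit_right alg.zero_right)
  then have "slice_value (kernel_stem w z)
      = - (line_embed J (1 / ((z - w) * (z - cnj w))) * line_embed J (z - cnj w))"
    by (simp add: kernel_stem_eq[OF assms] sv.neg slice_value_cs cs_eq)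
  also have "\<dots> = line_embed J (- (1 / ((z - w) * (z - cnj w)) * (z - cnj w)))"
    by (simp only: line_embed_mult[symmetric] le.neg)
  also have "- (1 / ((z - w) * (z - cnj w)) * (z - cnj w)) = 1 / (w - z)"
    using assms by (simp add: divide_simps)
  finally show ?thesis .
qed

lemma cauchy_kernel_line_embed:
  assumes "z \<noteq> w" "z \<noteq> cnj w"
  shows "cauchy_kernel (line_embed J z) (line_embed J w) = line_embed J (1 / (w - z))"
  unfolding cauchy_kernel_eq_slice_function
    slice_function_line_embed[of J "kernel_stem w", OF J kernel_stem_cnj[OF assms]]
  using slice_value_kernel_stem[OF assms] by (simp add: slice_value_def)

text \<open>The values at \<open>z\<close> and \<open>cnj z\<close> are \<open>fst (F z)\<close>
  plus and minus \<open>J * snd (F z)\<close>. Half their sum is the first component;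
  \<open>J\<close> applied to half their difference is minus the second, whence the sign. Brackets
  are moved only through \<open>J * (J * v) = - v\<close>.\<close>

lemma slice_function_representation:
  assumes I: "I \<in> imag_units" and F: "F (cnj z) = cx_conj (F z)"
  defines "v \<equiv> slice_function F (line_embed J z)" and "w \<equiv> slice_function F (line_embed J (cnj z))"
  shows "slice_function F (line_embed I z) = (1 / 2) *\<^sub>R (v + w) - (1 / 2) *\<^sub>R (I * (J * (v - w)))"
proof -
  have v: "v = fst (F z) + J * snd (F z)"
    unfolding v_def by (rule slice_function_line_embed[of J F, OF J F])
  have w: "w = fst (F z) - J * snd (F z)"
    unfolding w_def using slice_function_line_embed[of J F "cnj z", OF J] F
    by (simp add: cx_conj_def alg.minus_right)
  have "v - w = 2 *\<^sub>R (J * snd (F z))" by (simp add: v w scaleR_2)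
  then have "J * (v - w) = - 2 *\<^sub>R snd (F z)" by (simp add: scaleR_mult_right)
  moreover have "v + w = 2 *\<^sub>R fst (F z)" by (simp add: v w scaleR_2)
  ultimately show ?thesis
    using slice_function_line_embed[of I F z, OF I F]
    by (simp add: alg.minus_right scaleR_mult_right)
qed

text \<open>A left inverse of \<open>line_embed J\<close> that is linear on the whole algebra, so
  derivatives and limits of curves pass through it without restriction to the plane.\<close>

definition coord :: "'a \<Rightarrow> complex"
  where "coord = (SOME L. linear L \<and> L \<circ> line_embed J = id)"

lemma bounded_linear_coord: "bounded_linear coord"
  and coord_line_embed [simp]: "coord (line_embed J z) = z"
proof -
  have "\<exists>L. linear L \<and> L \<circ> line_embed J = id"
    using linear_injective_left_inverse[OF bounded_linear.linear[OF bounded_linear_line_embed] inj_line_embed[OF J]]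
    by blast
  then have "linear coord \<and> coord \<circ> line_embed J = id"
    unfolding coord_def by (rule someI_ex)
  then show "bounded_linear coord" "coord (line_embed J z) = z"
    by (auto simp: linear_conv_bounded_linear o_def fun_eq_iff)
qed

lemma homeomorphic_map_line_embed:
  "homeomorphic_map euclidean (top_of_set (complex_line J)) (line_embed J)"
proof (rule homeomorphic_maps_imp_map)
  show "homeomorphic_maps euclidean (top_of_set (complex_line J)) (line_embed J) coord"
    unfolding homeomorphic_maps_def complex_line_eq_range
    by (auto simp: continuous_map_in_subtopology
        intro!: bounded_linear.continuous_on[OF bounded_linear_line_embed]
          bounded_linear.continuous_on[OF bounded_linear_coord] continuous_map_into_fulltopology)
qed

text \<open>A point of the plane may also arise from the unit \<open>- J\<close> at the conjugate
  parameter; symmetry of \<open>D\<close> absorbs this.\<close>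

lemma slice_domain_eq:
  assumes "cnj ` D = D"
  shows "slice_domain D J = line_embed J ` D"
proof
  show "line_embed J ` D \<subseteq> slice_domain D J"
    unfolding slice_domain_def circularization_def complex_line_eq_range using J by blast
  show "slice_domain D J \<subseteq> line_embed J ` D"
  proof
    fix x assume "x \<in> slice_domain D J"
    then obtain I z w where I: "I \<in> imag_units" "z \<in> D" "x = line_embed I z" "x = line_embed J w"
      unfolding slice_domain_def circularization_def complex_line_eq_range by blast
    then have "w = z \<or> w = cnj z" using line_embed_eq_cases[OF I(1) J] by metis
    then show "x \<in> line_embed J ` D" using I assms by blast
  qed
qed

lemma piecewise_C1_boundary_coord:
  assumes bd: "piecewise_C1_boundary J (line_embed J ` D) \<Gamma>" and D: "open D" "bounded D"
  shows "oriented_C1_boundary D \<Gamma> (\<lambda>\<gamma> t. coord (\<gamma> t))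
      (\<lambda>\<gamma> t. coord (vector_derivative \<gamma> (at t within {0..1})))"
    and "\<And>\<gamma> t. \<gamma> \<in> \<Gamma> \<Longrightarrow> t \<in> {0..1} \<Longrightarrow> line_embed J (coord (\<gamma> t)) = \<gamma> t"
    and "\<And>\<gamma> t. \<gamma> \<in> \<Gamma> \<Longrightarrow> t \<in> {0..1} \<Longrightarrow> line_embed J (coord (vector_derivative \<gamma> (at t within {0..1})))
      = vector_derivative \<gamma> (at t within {0..1})"
proof -
  let ?d = "\<lambda>\<gamma> t. vector_derivative \<gamma> (at t within {0..1})"
  have fin: "finite \<Gamma>"
    and fr: "(\<Union>\<gamma>\<in>\<Gamma>. path_image \<gamma>) = top_of_set (complex_line J) frontier_of (line_embed J ` D)"
    and pw: "pairwise (\<lambda>\<gamma> \<delta>. \<gamma> ` {0<..<1} \<inter> path_image \<delta> = {}) \<Gamma>"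
    and sp: "\<And>\<gamma>. \<gamma> \<in> \<Gamma> \<Longrightarrow> simple_path \<gamma>"
    using bd by (simp_all add: piecewise_C1_boundary_def)
  have reg: "\<exists>\<gamma>'. continuous_on {0..1} \<gamma>' \<and>
        (\<forall>t\<in>{0..1}. (\<gamma> has_vector_derivative \<gamma>' t) (at t within {0..1}) \<and> \<gamma>' t \<noteq> 0) \<and>
        (\<forall>t\<in>{0<..<1}. \<forall>\<^sub>F s in at_right 0.
          \<gamma> t + s *\<^sub>R (J * \<gamma>' t) \<in> line_embed J ` D \<and> \<gamma> t - s *\<^sub>R (J * \<gamma>' t) \<notin> line_embed J ` D)"
    if "\<gamma> \<in> \<Gamma>" for \<gamma>
    using bd that by (simp add: piecewise_C1_boundary_def)
  have dcont: "continuous_on {0..1} (?d \<gamma>)"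
    and dder: "\<And>t. t \<in> {0..1} \<Longrightarrow> (\<gamma> has_vector_derivative ?d \<gamma> t) (at t within {0..1})"
    and dnz: "\<And>t. t \<in> {0..1} \<Longrightarrow> ?d \<gamma> t \<noteq> 0"
    and dnormal: "\<And>t. t \<in> {0<..<1} \<Longrightarrow> \<forall>\<^sub>F s in at_right 0.
          \<gamma> t + s *\<^sub>R (J * ?d \<gamma> t) \<in> line_embed J ` D \<and> \<gamma> t - s *\<^sub>R (J * ?d \<gamma> t) \<notin> line_embed J ` D"
    if \<gamma>: "\<gamma> \<in> \<Gamma>" for \<gamma>
  proof -
    obtain \<gamma>' where c: "continuous_on {0..1} \<gamma>'"
      and d: "\<And>t. t\<in>{0..1} \<Longrightarrow> (\<gamma> has_vector_derivative \<gamma>' t) (at t within {0..1})"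
      and n: "\<And>t. t\<in>{0..1} \<Longrightarrow> \<gamma>' t \<noteq> 0"
      and nn: "\<And>t. t\<in>{0<..<1} \<Longrightarrow> \<forall>\<^sub>F s in at_right 0.
          \<gamma> t + s *\<^sub>R (J * \<gamma>' t) \<in> line_embed J ` D \<and> \<gamma> t - s *\<^sub>R (J * \<gamma>' t) \<notin> line_embed J ` D"
      using reg[OF \<gamma>] by blast
    \<comment> \<open>Derivatives within \<open>{0..1}\<close> are unique, so the existentially
      given velocity is the \<open>vector_derivative\<close> of the boundary integrand.\<close>
    have eq: "?d \<gamma> t = \<gamma>' t" if "t \<in> {0..1}" for t
      by (rule vector_derivative_within_closed_interval[OF _ that d[OF that]]) simp
    show "continuous_on {0..1} (?d \<gamma>)" by (rule continuous_on_eq[OF c]) (simp add: eq)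
    show "(\<gamma> has_vector_derivative ?d \<gamma> t) (at t within {0..1})" if "t \<in> {0..1}" for t
      using d[OF that] eq[OF that] by simp
    show "?d \<gamma> t \<noteq> 0" if "t \<in> {0..1}" for t using n[OF that] eq[OF that] by simp
    show "\<forall>\<^sub>F s in at_right 0.
          \<gamma> t + s *\<^sub>R (J * ?d \<gamma> t) \<in> line_embed J ` D \<and> \<gamma> t - s *\<^sub>R (J * ?d \<gamma> t) \<notin> line_embed J ` D"
      if "t \<in> {0<..<1}" for t
      using nn[OF that] eq[of t] that by simp
  qed
  \<comment> \<open>\<open>line_embed J\<close> is a homeomorphism onto the plane, so the frontier
    relative to the plane is the image of the frontier in the complex numbers.\<close>
  have fr': "(\<Union>\<gamma>\<in>\<Gamma>. path_image \<gamma>) = line_embed J ` frontier D"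
    unfolding fr using homeomorphic_map_frontier_of[OF homeomorphic_map_line_embed, of D] by simp
  show on_line: "line_embed J (coord (\<gamma> t)) = \<gamma> t" if "\<gamma> \<in> \<Gamma>" "t \<in> {0..1}" for \<gamma> t
  proof -
    have "\<gamma> t \<in> line_embed J ` frontier D"
      using that unfolding fr'[symmetric] path_image_def by blast
    then show ?thesis by auto
  qed
  have derc: "((\<lambda>t. coord (\<gamma> t)) has_vector_derivative coord (?d \<gamma> t)) (at t within {0..1})"
    if "\<gamma> \<in> \<Gamma>" "t \<in> {0..1}" for \<gamma> t
    by (rule bounded_linear.has_vector_derivative[OF bounded_linear_coord dder[OF that]])
  show on_line': "line_embed J (coord (?d \<gamma> t)) = ?d \<gamma> t" if "\<gamma> \<in> \<Gamma>" "t \<in> {0..1}" for \<gamma> t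
  proof -
    \<comment> \<open>The velocity stays in the plane: the identity \<open>on_line\<close> is
      differentiated.\<close>
    have "((\<lambda>t. line_embed J (coord (\<gamma> t))) has_vector_derivative line_embed J (coord (?d \<gamma> t)))
        (at t within {0..1})"
      by (rule bounded_linear.has_vector_derivative[OF bounded_linear_line_embed derc[OF that]])
    then have "(\<gamma> has_vector_derivative line_embed J (coord (?d \<gamma> t))) (at t within {0..1})"
      by (rule has_vector_derivative_transform[OF that(2), rotated]) (use on_line that in auto)
    then have "?d \<gamma> t = line_embed J (coord (?d \<gamma> t))"
      by (intro vector_derivative_within_closed_interval) (use that in auto)
    then show ?thesis by simp
  qed
  show "oriented_C1_boundary D \<Gamma> (\<lambda>\<gamma> t. coord (\<gamma> t)) (\<lambda>\<gamma> t. coord (?d \<gamma> t))"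
  proof
    show "open D" "bounded D" "finite \<Gamma>" by fact+
    have "frontier D = coord ` line_embed J ` frontier D" by (simp add: image_image)
    also have "\<dots> = (\<Union>\<gamma>\<in>\<Gamma>. path_image (\<lambda>t. coord (\<gamma> t)))"
      unfolding fr'[symmetric] path_image_def by (simp add: image_UN image_image)
    finally show "frontier D = (\<Union>\<gamma>\<in>\<Gamma>. path_image (\<lambda>t. coord (\<gamma> t)))" .
    show "(\<lambda>t. coord (\<gamma> t)) ` {0<..<1} \<inter> path_image (\<lambda>t. coord (\<delta> t)) = {}"
      if gd: "\<gamma> \<in> \<Gamma>" "\<delta> \<in> \<Gamma>" "\<gamma> \<noteq> \<delta>" for \<gamma> \<delta>
    proof -
      have False if ts: "t \<in> {0<..<1}" "s \<in> {0..1}" "coord (\<gamma> t) = coord (\<delta> s)" for t s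
      proof -
        have "\<gamma> t = line_embed J (coord (\<gamma> t))" using on_line[OF gd(1), of t] ts(1) by simp
        also have "\<dots> = \<delta> s" using on_line[OF gd(2) ts(2)] ts(3) by simp
        finally have "\<gamma> t \<in> path_image \<delta>"
          using ts(2) by (auto simp: path_image_def)
        moreover have "\<gamma> t \<in> \<gamma> ` {0<..<1}" using ts(1) by blast
        ultimately show False using pw gd unfolding pairwise_def by blast
      qed
      then show ?thesis unfolding path_image_def by blast
    qed
    show "simple_path (\<lambda>t. coord (\<gamma> t))" if g: "\<gamma> \<in> \<Gamma>" for \<gamma>
    proof -
      have "\<gamma> t = \<gamma> s" if "t \<in> {0..1}" "s \<in> {0..1}" "coord (\<gamma> t) = coord (\<gamma> s)" for t s
        using on_line[OF g that(1)] on_line[OF g that(2)] that(3) by metis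
      moreover have "path (\<lambda>t. coord (\<gamma> t))"
        using sp[OF g] unfolding simple_path_def path_def
        by (auto intro: bounded_linear.continuous_on[OF bounded_linear_coord])
      moreover have "loop_free \<gamma>" using sp[OF g] by (simp add: simple_path_def)
      ultimately show ?thesis
        unfolding simple_path_def loop_free_def by metis
    qed
    show "continuous_on {0..1} (\<lambda>t. coord (?d \<gamma> t))" if "\<gamma> \<in> \<Gamma>" for \<gamma>
      by (rule bounded_linear.continuous_on[OF bounded_linear_coord dcont[OF that]])
    show "((\<lambda>t. coord (\<gamma> t)) has_vector_derivative coord (?d \<gamma> t)) (at t within {0..1})"
      if "\<gamma> \<in> \<Gamma>" "t \<in> {0..1}" for \<gamma> t
      by (rule derc[OF that])
    show "coord (?d \<gamma> t) \<noteq> 0" if "\<gamma> \<in> \<Gamma>" "t \<in> {0..1}" for \<gamma> t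
      using dnz[OF that] on_line'[OF that] linear_0[OF bounded_linear.linear[OF bounded_linear_line_embed[of J]]]
      by metis
    show "\<forall>\<^sub>F s in at_right 0. coord (\<gamma> t) + s *\<^sub>R (\<i> * coord (?d \<gamma> t)) \<in> D \<and>
        coord (\<gamma> t) - s *\<^sub>R (\<i> * coord (?d \<gamma> t)) \<notin> D"
      if gt: "\<gamma> \<in> \<Gamma>" "t \<in> {0<..<1}" for \<gamma> t
      using dnormal[OF gt]
    proof eventually_elim
      case (elim s)
      interpret le: bounded_linear "line_embed J" by (rule bounded_linear_line_embed)
      have t01: "t \<in> {0..1}" using gt by simp
      have Jd: "J * ?d \<gamma> t = line_embed J (\<i> * coord (?d \<gamma> t))"
        using on_line'[OF gt(1) t01] by (simp add: line_embed_mult line_embed_ii)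
      have eq: "\<gamma> t + s *\<^sub>R (J * ?d \<gamma> t) = line_embed J (coord (\<gamma> t) + s *\<^sub>R (\<i> * coord (?d \<gamma> t)))"
        "\<gamma> t - s *\<^sub>R (J * ?d \<gamma> t) = line_embed J (coord (\<gamma> t) - s *\<^sub>R (\<i> * coord (?d \<gamma> t)))"
        unfolding Jd by (simp_all only: le.add le.diff le.scaleR on_line[OF gt(1) t01])
      show ?case
        using elim unfolding eq inj_image_mem_iff[OF inj_line_embed[OF J]] .
    qed
  qed
qed

end

section \<open>Conjugation symmetry of stem functions and their derivatives\<close>

lemma cnj_closure:
  assumes "cnj ` D = D" "z \<in> closure D"
  shows "cnj z \<in> closure D"
proof -
  have "cnj ` closure D \<subseteq> closure D"
    by (rule image_closure_subset) (use assms(1) closure_subset in \<open>auto intro!: continuous_intros\<close>)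
  then show ?thesis using assms(2) by blast
qed

text \<open>Both sides are continuous on the closure and agree on \<open>D\<close>. The extension
  matters because the boundary integral evaluates the slice function there.\<close>

lemma stem_function_on_closure:
  assumes F: "stem_function_on D F" and cont: "continuous_on (closure D) F" and D: "cnj ` D = D"
    and z: "z \<in> closure D"
  shows "F (cnj z) = cx_conj (F z)"
proof -
  have cont0: "continuous_on (closure D) (\<lambda>z. F (cnj z) - cx_conj (F z))"
    by (intro continuous_intros continuous_on_compose2[OF cont]
        bounded_linear.continuous_on[OF bounded_linear_cx_conj] cont) (use cnj_closure[OF D] in auto)
  have "F (cnj z) - cx_conj (F z) = 0"
    by (rule continuous_constant_on_closure[OF cont0 _ z])
      (use F in \<open>auto simp: stem_function_on_def\<close>)
  then show ?thesis by simp
qed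

text \<open>Differentiate \<open>F = cx_conj \<circ> F \<circ> cnj\<close> at \<open>cnj z\<close>;
  conjugation reverses the second real direction, whence the minus sign of \<open>Q\<close>.\<close>

lemma stem_partial_derivatives:
  assumes F: "stem_function_on D F" and D: "open D" "z \<in> D"
    and der: "\<And>z. z \<in> D \<Longrightarrow> (F has_derivative (\<lambda>h. Re h *\<^sub>R P z + Im h *\<^sub>R Q z)) (at z)"
  shows "P (cnj z) = cx_conj (P z)" and "Q (cnj z) = - cx_conj (Q z)"
proof -
  have z': "cnj z \<in> D" using F D(2) by (auto simp: stem_function_on_def)
  have "(cnj has_derivative cnj) (at (cnj z))"
    by (rule bounded_linear_imp_has_derivative[OF bounded_linear_cnj])
  from has_derivative_compose[OF this, of F "\<lambda>h. Re h *\<^sub>R P z + Im h *\<^sub>R Q z"] der[OF D(2)]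
  have "((\<lambda>w. F (cnj w)) has_derivative (\<lambda>h. Re (cnj h) *\<^sub>R P z + Im (cnj h) *\<^sub>R Q z)) (at (cnj z))"
    by simp
  from bounded_linear.has_derivative[OF bounded_linear_cx_conj this]
  have "((\<lambda>w. cx_conj (F (cnj w))) has_derivative
      (\<lambda>h. cx_conj (Re (cnj h) *\<^sub>R P z + Im (cnj h) *\<^sub>R Q z))) (at (cnj z))" .
  then have "(F has_derivative (\<lambda>h. cx_conj (Re (cnj h) *\<^sub>R P z + Im (cnj h) *\<^sub>R Q z))) (at (cnj z))"
    by (rule has_derivative_transform_within_open[OF _ D(1) z']) (use F in \<open>auto simp: stem_function_on_def\<close>)
  from has_derivative_unique[OF der[OF z'] this]
  have eq: "Re h *\<^sub>R P (cnj z) + Im h *\<^sub>R Q (cnj z) = cx_conj (Re (cnj h) *\<^sub>R P z + Im (cnj h) *\<^sub>R Q z)" for h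
    by metis
  show "P (cnj z) = cx_conj (P z)" "Q (cnj z) = - cx_conj (Q z)"
    using eq[of 1] eq[of \<i>] by simp_all
qed

lemma stem_dbar_eq:
  assumes "(F has_derivative (\<lambda>h. Re h *\<^sub>R p + Im h *\<^sub>R q)) (at z)"
  shows "stem_dbar F z = (1 / 2) *\<^sub>R (p + cx.cs \<i> q)"
proof -
  have "((\<lambda>t. z + of_real t) has_derivative of_real) (at 0)"
    by (auto intro!: derivative_eq_intros)
  from has_derivative_compose[OF this, of F "\<lambda>h. Re h *\<^sub>R p + Im h *\<^sub>R q"] assms
  have "((\<lambda>t. F (z + of_real t)) has_derivative (\<lambda>h. Re (of_real h) *\<^sub>R p + Im (of_real h) *\<^sub>R q)) (at 0)"
    by simp
  then have 1: "((\<lambda>t. F (z + of_real t)) has_vector_derivative p) (at 0)"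
    by (simp add: has_vector_derivative_def)
  have "((\<lambda>t. z + \<i> * of_real t) has_derivative (\<lambda>h. \<i> * of_real h)) (at 0)"
    by (auto intro!: derivative_eq_intros)
  from has_derivative_compose[OF this, of F "\<lambda>h. Re h *\<^sub>R p + Im h *\<^sub>R q"] assms
  have "((\<lambda>t. F (z + \<i> * of_real t)) has_derivative
      (\<lambda>h. Re (\<i> * of_real h) *\<^sub>R p + Im (\<i> * of_real h) *\<^sub>R q)) (at 0)"
    by simp
  then have 2: "((\<lambda>t. F (z + \<i> * of_real t)) has_vector_derivative q) (at 0)"
    by (simp add: has_vector_derivative_def)
  show ?thesis
    by (simp add: stem_dbar_def vector_derivative_at[OF 1] vector_derivative_at[OF 2] cx_mult_of_complex_left)
qed

text \<open>The minus sign of \<open>Q\<close> cancels against the one from conjugating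
  \<open>\<i>\<close>; this symmetry makes the value of \<open>slice_dbar\<close> well
  defined.\<close>

lemma stem_dbar_cnj:
  assumes F: "stem_function_on D F" and D: "open D" "z \<in> D"
    and der: "\<And>z. z \<in> D \<Longrightarrow> (F has_derivative (\<lambda>h. Re h *\<^sub>R P z + Im h *\<^sub>R Q z)) (at z)"
  shows "stem_dbar F (cnj z) = cx_conj (stem_dbar F z)"
proof -
  have z': "cnj z \<in> D" using F D(2) by (auto simp: stem_function_on_def)
  have "P (cnj z) = cx_conj (P z)" "Q (cnj z) = - cx_conj (Q z)"
    by (rule stem_partial_derivatives[OF F D der], assumption)+
  then show ?thesis
    unfolding stem_dbar_eq[OF der[OF D(2)]] stem_dbar_eq[OF der[OF z']]
    by (simp add: cx_conj_cs cx.cs.minus_left cx.cs.minus_right)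
qed

section \<open>The integral formula on the plane of \<open>J\<close>\<close>

context imag_unit
begin

text \<open>All factors to the left of the function values lie in the plane of \<open>J\<close>, so
  both integrands collapse to complex scalars acting on \<open>g\<close> and on
  \<open>H\<close>.\<close>

lemma slice_Cauchy_Pompeiu:
  assumes D: "open D" "bounded D" "cnj ` D = D" and F: "stem_function_on D F" "C1_on_closure D F"
    and bd: "piecewise_C1_boundary J (line_embed J ` D) \<Gamma>" and z0: "z0 \<in> D"
  shows "\<forall>\<gamma>\<in>\<Gamma>. boundary_integrand J (slice_function F) (line_embed J z0) \<gamma> integrable_on {0..1}"
    and "set_integrable lborel D (area_integrand J (slice_dbar F) (line_embed J z0))"
    and "slice_function F (line_embed J z0) =
      (1 / (2 * pi)) *\<^sub>R
        (\<Sum>\<gamma>\<in>\<Gamma>. integral {0..1} (boundary_integrand J (slice_function F) (line_embed J z0) \<gamma>))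
      - (1 / (2 * pi)) *\<^sub>R
        (LINT z:D|lborel. area_integrand J (slice_dbar F) (line_embed J z0) z)"
proof -
  define c where "c = (\<lambda>\<gamma> (t::real). coord (\<gamma> t))"
  define c' where "c' = (\<lambda>\<gamma> t. coord (vector_derivative \<gamma> (at t within {0..1})))"
  note coord = piecewise_C1_boundary_coord[OF bd D(1,2)]
  interpret oriented_C1_boundary D \<Gamma> c c' unfolding c_def c'_def by (rule coord(1))
  interpret complex_structure_boundary D \<Gamma> c c' "(*) J" by unfold_locales
  interpret sv: bounded_linear slice_value by (rule bounded_linear_slice_value)
  have contF: "continuous_on (closure D) F" using F(2) by (simp add: C1_on_closure_def)
  obtain P Q where P: "continuous_on (closure D) P" and Q: "continuous_on (closure D) Q"
    and derF: "\<And>z. z \<in> D \<Longrightarrow> (F has_derivative (\<lambda>h. Re h *\<^sub>R P z + Im h *\<^sub>R Q z)) (at z)"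
    using F(2) unfolding C1_on_closure_def by blast
  define g where "g z = slice_value (F z)" for z
  \<comment> \<open>Twice the dbar derivative of \<open>g\<close>.\<close>
  define H where "H z = slice_value (P z) + J * slice_value (Q z)" for z
  have g: "slice_function F (line_embed J z) = g z" if "z \<in> closure D" for z
    using slice_function_line_embed[of J F, OF J stem_function_on_closure[OF F(1) contF D(3) that]]
    by (simp add: g_def slice_value_def)
  have contg: "continuous_on (closure D) g"
    unfolding g_def by (rule sv.continuous_on[OF contF])
  have derg: "(g has_derivative (\<lambda>h. Re h *\<^sub>R slice_value (P z) + Im h *\<^sub>R slice_value (Q z))) (at z)"
    if "z \<in> D" for z
    using sv.has_derivative[OF derF[OF that]] by (simp add: g_def[abs_def] sv.add sv.scaleR)
  have dbar: "slice_dbar F (line_embed J z) = (1 / 2) *\<^sub>R H z" if z: "z \<in> D" for z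
  proof -
    have "stem_dbar F (cnj z) = cx_conj (stem_dbar F z)"
      by (rule stem_dbar_cnj[OF F(1) D(1) z derF])
    from slice_function_line_embed[of J "stem_dbar F", OF J this]
    have "slice_dbar F (line_embed J z) = slice_value (stem_dbar F z)"
      by (simp only: slice_dbar_def slice_value_def)
    also have "\<dots> = (1 / 2) *\<^sub>R H z"
      unfolding stem_dbar_eq[OF derF[OF z]] H_def
      by (simp only: sv.add sv.scaleR slice_value_cs cs_ii)
    finally show ?thesis .
  qed
  \<comment> \<open>Symmetry of \<open>D\<close> excludes \<open>cnj z0\<close> along with
    \<open>z0\<close>; at both points \<open>delta_stem\<close> vanishes.\<close>
  have ne: "w \<noteq> cnj z0" "w \<noteq> z0" if "w \<notin> D" for w
    using that z0 D(3) by blast+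
  let ?B = "boundary_integrand J (slice_function F) (line_embed J z0)"
  let ?C = "\<lambda>\<gamma> t. cs (c' \<gamma> t / (c \<gamma> t - z0)) (g (c \<gamma> t))"
  let ?A = "area_integrand J (slice_dbar F) (line_embed J z0)"
  let ?H = "\<lambda>z. cs (1 / (z - z0)) (H z)"
  have B: "?B \<gamma> t = - (J * ?C \<gamma> t)" if gt: "\<gamma> \<in> \<Gamma>" "t \<in> {0..1}" for \<gamma> t
  proof -
    have \<gamma>t: "\<gamma> t = line_embed J (c \<gamma> t)"
      and \<gamma>'t: "vector_derivative \<gamma> (at t within {0..1}) = line_embed J (c' \<gamma> t)"
      using coord(2,3)[OF gt] by (simp_all add: c_def c'_def)
    have "c \<gamma> t \<in> frontier D" using gt unfolding frontier_D path_image_def by blast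
    then have "c \<gamma> t \<notin> D" and cl: "c \<gamma> t \<in> closure D"
      using D(1) by (auto simp: frontier_def interior_open)
    then have "z0 \<noteq> c \<gamma> t" "z0 \<noteq> cnj (c \<gamma> t)"
      using ne by (metis complex_cnj_cnj)+
    then have "?B \<gamma> t = (line_embed J (1 / (c \<gamma> t - z0)) * line_embed J (- \<i>)) * line_embed J (c' \<gamma> t) * g (c \<gamma> t)"
      unfolding boundary_integrand_def \<gamma>'t inverse_wrt_J \<gamma>t
      by (simp add: cauchy_kernel_line_embed g[OF cl])
    also have "\<dots> = cs (1 / (c \<gamma> t - z0) * (- \<i>) * c' \<gamma> t) (g (c \<gamma> t))"
      by (simp only: cs_eq line_embed_mult)
    also have "1 / (c \<gamma> t - z0) * (- \<i>) * c' \<gamma> t = - \<i> * (c' \<gamma> t / (c \<gamma> t - z0))" by simp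
    also have "cs \<dots> (g (c \<gamma> t)) = - (J * ?C \<gamma> t)"
      by (simp only: cs_mult cs.minus_left cs_ii)
    finally show ?thesis .
  qed
  have A: "?A z = ?H z" if z: "z \<in> D" "z \<noteq> z0" "z \<noteq> cnj z0" for z
  proof -
    have "z0 \<noteq> z" "z0 \<noteq> cnj z" using z by auto
    then have "?A z = (line_embed J (1 / (z - z0)) * line_embed J (- \<i>)) * line_embed J (2 * \<i>) * ((1 / 2) *\<^sub>R H z)"
      unfolding area_integrand_def inverse_wrt_J wedge_star_J dbar[OF z(1)]
      by (simp add: cauchy_kernel_line_embed)
    also have "\<dots> = cs (1 / (z - z0) * (- \<i>) * (2 * \<i>)) (cs (of_real (1 / 2)) (H z))"
      unfolding cs_of_real unfolding cs_eq by (simp only: line_embed_mult)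
    also have "\<dots> = cs (1 / (z - z0) * ((- \<i>) * (2 * \<i>) * of_real (1 / 2))) (H z)"
      by (simp only: cs_mult)
    \<comment> \<open>The inverse of \<open>J\<close>, the value \<open>2 J\<close> of the form and
      the factor \<open>1 / 2\<close> of the dbar derivative multiply to 1.\<close>
    also have "(- \<i>) * (2 * \<i>) * of_real (1 / 2) = 1" by (simp add: complex_eq_iff)
    finally show ?thesis by simp
  qed
  have intC: "?C \<gamma> integrable_on {0..1}" if "\<gamma> \<in> \<Gamma>" for \<gamma>
    by (intro integrable_continuous_interval continuous_Cauchy_boundary_integrand z0 contg that)
  have Bint: "(?B \<gamma> has_integral - (J * integral {0..1} (?C \<gamma>))) {0..1}" if \<gamma>: "\<gamma> \<in> \<Gamma>" for \<gamma>
  proof -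
    have "((\<lambda>t. - (J * ?C \<gamma> t)) has_integral - (J * integral {0..1} (?C \<gamma>))) {0..1}"
      using has_integral_linear[OF integrable_integral[OF intC[OF \<gamma>]] bounded_linear_J]
      by (intro has_integral_neg) (simp add: o_def)
    then show ?thesis by (rule has_integral_eq[rotated]) (use B[OF \<gamma>] in auto)
  qed
  then show "\<forall>\<gamma>\<in>\<Gamma>. ?B \<gamma> integrable_on {0..1}" by blast
  note pompeiu = z0 contg sv.continuous_on[OF P] sv.continuous_on[OF Q] derg
  have intH: "set_integrable lborel D ?H"
    unfolding H_def by (rule set_integrable_Cauchy_kernel_dbar[OF pompeiu])
  \<comment> \<open>At \<open>z0\<close> and \<open>cnj z0\<close> the kernel is a junk value, as \<open>delta_stem\<close> is not invertible there.\<close>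
  have iff: "integrable lborel (\<lambda>z. indicator D z *\<^sub>R ?H z) \<longleftrightarrow> integrable lborel (\<lambda>z. indicator D z *\<^sub>R ?A z)"
    by (rule integrable_discrete_difference[where X = "{z0, cnj z0}"]) (auto simp: A indicator_def)
  show intA: "set_integrable lborel D ?A"
    using intH iff by (simp add: set_integrable_def)
  have eqA: "(LINT z:D|lborel. ?H z) = (LINT z:D|lborel. ?A z)"
    unfolding set_lebesgue_integral_def
    by (rule integral_discrete_difference[where X = "{z0, cnj z0}"]) (auto simp: A indicator_def)
  have "(\<Sum>\<gamma>\<in>\<Gamma>. integral {0..1} (?B \<gamma>)) = (\<Sum>\<gamma>\<in>\<Gamma>. - (J * integral {0..1} (?C \<gamma>)))"
    using Bint by (intro sum.cong refl integral_unique)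
  also have "\<dots> = - (J * (\<Sum>\<gamma>\<in>\<Gamma>. integral {0..1} (?C \<gamma>)))"
    by (simp add: sum_negf alg.sum_right)
  finally have "(2 * pi) *\<^sub>R g z0 = (\<Sum>\<gamma>\<in>\<Gamma>. integral {0..1} (?B \<gamma>)) - (LINT z:D|lborel. ?A z)"
    using Cauchy_Pompeiu[OF pompeiu] by (simp add: eqA[symmetric] H_def)
  then have "(1 / (2 * pi)) *\<^sub>R ((2 * pi) *\<^sub>R g z0) = (1 / (2 * pi)) *\<^sub>R (\<Sum>\<gamma>\<in>\<Gamma>. integral {0..1} (?B \<gamma>))
      - (1 / (2 * pi)) *\<^sub>R (LINT z:D|lborel. ?A z)"
    by (simp only: scaleR_diff_right)
  moreover have "slice_function F (line_embed J z0) = g z0" using g z0 closure_subset by blast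
  ultimately show "slice_function F (line_embed J z0) = (1 / (2 * pi)) *\<^sub>R (\<Sum>\<gamma>\<in>\<Gamma>. integral {0..1} (?B \<gamma>))
      - (1 / (2 * pi)) *\<^sub>R (LINT z:D|lborel. ?A z)"
    by simp
qed

end

theorem theorem27:
  fixes D :: "complex set"
    and F :: "complex \<Rightarrow> 'a::alternative_star_algebra complexified"
    and J x :: 'a
    and \<Gamma> :: "(real \<Rightarrow> 'a) set"
  assumes "DIM('a) > 1"
    and "open D" and "cnj ` D = D"
    and "stem_function_on D F"
    and "C1_on_closure D F"
    and "J \<in> imag_units"
    and "openin (top_of_set (complex_line J)) (slice_domain D J)"
    and "compact (closure (slice_domain D J))"
    and "piecewise_C1_boundary J (slice_domain D J) \<Gamma>"
    and "x \<in> (if \<forall>a b c::'a. (a * b) * c = a * (b * c) then circularization D else slice_domain D J)"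
  shows "(\<forall>\<gamma>\<in>\<Gamma>. boundary_integrand J (slice_function F) x \<gamma> integrable_on {0..1}) \<and>
    set_integrable lborel (line_embed J -` slice_domain D J)
      (area_integrand J (slice_dbar F) x) \<and>
    slice_function F x =
      (1 / (2 * pi)) *\<^sub>R
        (\<Sum>\<gamma>\<in>\<Gamma>. integral {0..1} (boundary_integrand J (slice_function F) x \<gamma>))
      - (1 / (2 * pi)) *\<^sub>R
        (LINT z:line_embed J -` slice_domain D J|lborel. area_integrand J (slice_dbar F) x z)"
proof -
  interpret imag_unit J by unfold_locales fact
  note Dc = assms(3)
  have sd: "slice_domain D J = line_embed J ` D" by (rule slice_domain_eq[OF Dc])
  then have vim: "line_embed J -` slice_domain D J = D"
    using inj_vimage_image_eq[OF inj_line_embed[OF J]] by simp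
  have "bounded (slice_domain D J)"
    by (rule bounded_subset[OF compact_imp_bounded[OF assms(8)] closure_subset])
  then have "bounded (coord ` line_embed J ` D)"
    unfolding sd by (rule bounded_linear_image[OF _ bounded_linear_coord])
  then have bdD: "bounded D" by (simp add: image_image)
  note on_line = slice_Cauchy_Pompeiu[OF assms(2) bdD Dc assms(4,5) assms(9)[unfolded sd]]
  show ?thesis
  proof (cases "\<forall>a b c::'a. (a * b) * c = a * (b * c)")
    case False
    then have "x \<in> line_embed J ` D" using assms(10) unfolding sd by (simp only: if_False)
    then obtain z0 where "z0 \<in> D" "x = line_embed J z0" by blast
    then show ?thesis using on_line[of z0] by (simp only: vim) blast
  next
    case True
    then have assoc: "(a * b) * c = a * (b * c)" for a b c :: 'a by blast
    obtain I z0 where I: "I \<in> imag_units" and z0: "z0 \<in> D" and x: "x = line_embed I z0"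
      using assms(10) unfolding if_P[OF True] circularization_def by blast
    have z0': "cnj z0 \<in> D" using z0 Dc by blast
    \<comment> \<open>Under associativity these are the left multiplications by
      \<open>(1 - I * J) / 2\<close> and \<open>(1 + I * J) / 2\<close>; \<open>rep\<close>
      identifies \<open>T1 v + T2 w\<close> with the representation formula.\<close>
    define T1 where "T1 v = (1 / 2) *\<^sub>R v - (1 / 2) *\<^sub>R (I * (J * v))" for v
    define T2 where "T2 v = (1 / 2) *\<^sub>R v + (1 / 2) *\<^sub>R (I * (J * v))" for v
    have T: "bounded_linear T1" "bounded_linear T2"
      unfolding T1_def T2_def linear_conv_bounded_linear[symmetric] linear_iff
      by (simp_all add: alg.add_right scaleR_mult_right algebra_simps)
    \<comment> \<open>Associativity enters here: right factors pass through \<open>T1\<close> and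
      \<open>T2\<close>, so the representation of the kernel extends to both integrands.\<close>
    have T_mult: "T1 v * w = T1 (v * w)" "T2 v * w = T2 (v * w)" for v w
      by (simp_all add: T1_def T2_def alg.add_left alg.diff_left scaleR_mult_left assoc)
    have rep: "(1 / 2) *\<^sub>R (v + w) - (1 / 2) *\<^sub>R (I * (J * (v - w))) = T1 v + T2 w" for v w
      by (simp add: T1_def T2_def alg.diff_right algebra_simps)
    have repF: "slice_function F x = T1 (slice_function F (line_embed J z0))
        + T2 (slice_function F (line_embed J (cnj z0)))"
      unfolding x rep[symmetric]
      by (rule slice_function_representation[OF I]) (use assms(4) z0 in \<open>auto simp: stem_function_on_def\<close>)
    have repC: "cauchy_kernel x (line_embed J w) = T1 (cauchy_kernel (line_embed J z0) (line_embed J w))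
        + T2 (cauchy_kernel (line_embed J (cnj z0)) (line_embed J w))"
      if "w \<noteq> z0" "w \<noteq> cnj z0" for w
      unfolding x rep[symmetric] cauchy_kernel_eq_slice_function
      by (rule slice_function_representation[where F = "kernel_stem w", OF I], rule kernel_stem_cnj)
        (use that in auto)
    let ?B = "\<lambda>x. boundary_integrand J (slice_function F) x"
    let ?A = "\<lambda>x. area_integrand J (slice_dbar F) x"
    let ?x = "line_embed J z0" and ?x' = "line_embed J (cnj z0)"
    note coord = piecewise_C1_boundary_coord[OF assms(9)[unfolded sd] assms(2) bdD]
    have B: "?B x \<gamma> t = T1 (?B ?x \<gamma> t) + T2 (?B ?x' \<gamma> t)" if gt: "\<gamma> \<in> \<Gamma>" "t \<in> {0..1}" for \<gamma> t
    proof -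
      interpret b: oriented_C1_boundary D \<Gamma> "\<lambda>\<gamma> t. coord (\<gamma> t)"
        "\<lambda>\<gamma> t. coord (vector_derivative \<gamma> (at t within {0..1}))" by (rule coord(1))
      have "coord (\<gamma> t) \<in> frontier D" using gt unfolding b.frontier_D path_image_def by blast
      then have "coord (\<gamma> t) \<notin> D" using assms(2) by (auto simp: frontier_def interior_open)
      \<comment> \<open>Boundary points avoid both \<open>z0\<close> and \<open>cnj z0\<close>, as
        the kernel representation requires.\<close>
      then have "coord (\<gamma> t) \<noteq> z0" "coord (\<gamma> t) \<noteq> cnj z0" using z0 z0' by metis+
      from repC[OF this]
      have "cauchy_kernel x (\<gamma> t) = T1 (cauchy_kernel ?x (\<gamma> t)) + T2 (cauchy_kernel ?x' (\<gamma> t))"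
        by (simp only: coord(2)[OF gt])
      then show ?thesis
        by (simp only: boundary_integrand_def alg.add_left T_mult)
    qed
    have A: "?A x z = T1 (?A ?x z) + T2 (?A ?x' z)" if "z \<noteq> z0" "z \<noteq> cnj z0" for z
      by (simp only: area_integrand_def repC[OF that] alg.add_left T_mult)
    have Bint: "(?B x \<gamma> has_integral T1 (integral {0..1} (?B ?x \<gamma>)) + T2 (integral {0..1} (?B ?x' \<gamma>))) {0..1}"
      if \<gamma>: "\<gamma> \<in> \<Gamma>" for \<gamma>
    proof -
      have "((\<lambda>t. T1 (?B ?x \<gamma> t)) has_integral T1 (integral {0..1} (?B ?x \<gamma>))) {0..1}"
        using has_integral_linear[OF integrable_integral T(1), of "?B ?x \<gamma>"] on_line(1)[OF z0] \<gamma>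
        by (simp add: o_def)
      moreover have "((\<lambda>t. T2 (?B ?x' \<gamma> t)) has_integral T2 (integral {0..1} (?B ?x' \<gamma>))) {0..1}"
        using has_integral_linear[OF integrable_integral T(2), of "?B ?x' \<gamma>"] on_line(1)[OF z0'] \<gamma>
        by (simp add: o_def)
      ultimately have "((\<lambda>t. T1 (?B ?x \<gamma> t) + T2 (?B ?x' \<gamma> t)) has_integral
          T1 (integral {0..1} (?B ?x \<gamma>)) + T2 (integral {0..1} (?B ?x' \<gamma>))) {0..1}"
        by (rule has_integral_add)
      then show ?thesis by (rule has_integral_eq[rotated]) (use B[OF \<gamma>] in auto)
    qed
    let ?ind = "\<lambda>x z. indicator D z *\<^sub>R ?A x z"
    have i: "integrable lborel (?ind ?x)" "integrable lborel (?ind ?x')"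
      using on_line(2)[OF z0] on_line(2)[OF z0'] by (simp_all add: set_integrable_def)
    note iT = integrable_bounded_linear[OF T(1) i(1)] integrable_bounded_linear[OF T(2) i(2)]
    have ind: "T1 (?ind ?x z) + T2 (?ind ?x' z) = ?ind x z" if "z \<notin> {z0, cnj z0}" for z
      using that A by (simp add: indicator_def linear_0 bounded_linear.linear T)
    \<comment> \<open>In the area integral the kernel representation is available except at two
      points, which form a null set.\<close>
    have iff: "integrable lborel (\<lambda>z. T1 (?ind ?x z) + T2 (?ind ?x' z)) \<longleftrightarrow> integrable lborel (?ind x)"
      by (rule integrable_discrete_difference[where X = "{z0, cnj z0}"]) (use ind in auto)
    have int: "integral\<^sup>L lborel (\<lambda>z. T1 (?ind ?x z) + T2 (?ind ?x' z)) = integral\<^sup>L lborel (?ind x)"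
      by (rule integral_discrete_difference[where X = "{z0, cnj z0}"]) (use ind in auto)
    have "set_integrable lborel D (?A x)"
      using iff iT by (simp add: set_integrable_def)
    moreover have "\<forall>\<gamma>\<in>\<Gamma>. ?B x \<gamma> integrable_on {0..1}" using Bint by blast
    moreover have "slice_function F x = (1 / (2 * pi)) *\<^sub>R (\<Sum>\<gamma>\<in>\<Gamma>. integral {0..1} (?B x \<gamma>))
      - (1 / (2 * pi)) *\<^sub>R (LINT z:D|lborel. ?A x z)"
    proof -
      interpret t1: bounded_linear T1 by (rule T(1))
      interpret t2: bounded_linear T2 by (rule T(2))
      have a: "(LINT z:D|lborel. ?A x z) = T1 (LINT z:D|lborel. ?A ?x z) + T2 (LINT z:D|lborel. ?A ?x' z)"
        unfolding set_lebesgue_integral_def int[symmetric]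
        using iT integral_bounded_linear[OF T(1) i(1)] integral_bounded_linear[OF T(2) i(2)] by simp
      have b: "(\<Sum>\<gamma>\<in>\<Gamma>. integral {0..1} (?B x \<gamma>))
          = T1 (\<Sum>\<gamma>\<in>\<Gamma>. integral {0..1} (?B ?x \<gamma>)) + T2 (\<Sum>\<gamma>\<in>\<Gamma>. integral {0..1} (?B ?x' \<gamma>))"
        unfolding t1.sum t2.sum sum.distrib[symmetric]
        by (intro sum.cong refl integral_unique Bint)
      show ?thesis
        unfolding repF a b on_line(3)[OF z0] on_line(3)[OF z0'] t1.diff t2.diff t1.scaleR t2.scaleR
        by (simp only: scaleR_add_right add_diff_add)
    qed
    ultimately show ?thesis by (simp only: vim)
  qed
qed

end
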